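(* Let $\Omega\subset\mathbb{R}^{n+1}$ be a bounded convex body with $V(\Omega)=V(B(1))$, let $z_s\in\Omega$ be the Santaló point of $\Omega$, and let $u_s=u_{z_s}$ be the support function of $\Omega$ with respect to $z_s$. Then $$\frac1{\omega_n}\int_{\mathbb{S}^n}\log u_s\,d\theta\ge 0,$$ with equality if and only if $\Omega$ is a round ball centered at $z_s$. In particular $\mathcal{E}(\Omega)\ge 0$, and the inequality is strict unless $\Omega$ is a round ball centered at $z_s$. Moreover, for a general bounded convex body $\Omega\subset\mathbb{R}^{n+1}$ (without volume normalization), $$\mathcal{E}(\Omega)\ge\frac{\log V(\Omega)-\log V(B(1))}{n+1}.$$
   Context: A bounded convex body is a compact convex subset of $\mathbb{R}^{n+1}$ with nonempty interior; $V$ is $(n+1)$-dimensional Lebesgue measure; $B(1)$ is the unit ball of $\mathbb{R}^{n+1}$; $d\theta$ is the standard surface measure on $\mathbb{S}^n$ and $\omega_n$ the area of $\mathbb{S}^n$. For $z_0\in\Omega$, the support function with respect to $z_0$ is $u_{z_0}(x)=\max_{z\in\Omega}\langle x,z-z_0\rangle$, $x\in\mathbb{S}^n$. The entropy is $$\mathcal{E}(\Omega)=\sup_{u_{z_0}>0}\frac1{\omega_n}\int_{\mathbb{S}^n}\log u_{z_0}(x)\,d\theta(x),$$ the supremum being over all $z_0\in\Omega$ with $u_{z_0}>0$ on $\mathbb{S}^n$ (equivalently $z_0\in\operatorname{Int}(\Omega)$). For $z_0\in\operatorname{Int}(\Omega)$, the polar dual with respect to $z_0$ is $\Omega^*_{z_0}=\{y+z_0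 : \max_{z\in\Omega}\langle y,z-z_0\rangle\le 1\}$. The Santaló point $z_s$ is the unique point of $\operatorname{Int}(\Omega)$ at which $z_0\mapsto V(\Omega^*_{z_0})$ is minimal. *)

theory Defs
  imports "HOL-Analysis.Analysis"
begin

text \<open>
  The ambient space \<open>\<real>\<^sup>n\<^sup>+\<^sup>1\<close> is an arbitrary Euclidean space \<open>'a\<close>, so that \<open>n + 1 = DIM('a)\<close>.
\<close>

definition convex_body :: "'a::euclidean_space set \<Rightarrow> bool" where
  "convex_body \<Omega> \<longleftrightarrow> compact \<Omega> \<and> convex \<Omega> \<and> interior \<Omega> \<noteq> {}"

text \<open>
  Surface measure on the unit sphere, as it arises from polar coordinates: the area of \<open>A\<close> is
  \<open>n + 1\<close> times the volume of the cone over \<open>A\<close> with apex \<open>0\<close> (\<open>emeasure_sphere_measure\<close> below).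
  Here \<open>sgn x = x /\<^sub>R norm x\<close> is the radial projection.
\<close>

definition sphere_measure :: "'a::euclidean_space measure" where
  "sphere_measure =
     scale_measure (of_nat DIM('a))
       (distr (restrict_space lborel (cball 0 1 - {0})) (restrict_space borel (sphere 0 1)) sgn)"

lemma space_sphere_measure [simp]: "space (sphere_measure :: 'a::euclidean_space measure) = sphere 0 1"
  by (simp add: sphere_measure_def space_restrict_space space_scale_measure)

lemma sets_sphere_measure [simp, measurable_cong]:
  "sets (sphere_measure :: 'a::euclidean_space measure) = sets (restrict_space borel (sphere 0 1))"
  by (simp add: sphere_measure_def)

lemma emeasure_sphere_measure:
  fixes A :: "'a::euclidean_space set"
  assumes "A \<in> sets sphere_measure"
  shows "emeasure sphere_measure A =
    of_nat DIM('a) * emeasure lborel {r *\<^sub>R x | r x. 0 < r \<and> r \<le> 1 \<and> x \<in> A}"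
proof -
  let ?M = "restrict_space lborel (cball 0 1 - {0::'a})"
  let ?N = "restrict_space borel (sphere (0::'a) 1)"
  have A: "A \<in> sets ?N" "A \<subseteq> sphere 0 1"
    using assms sets.sets_into_space[OF assms] by simp_all
  have "(sgn :: 'a \<Rightarrow> 'a) \<in> borel_measurable borel"
    unfolding sgn_div_norm[abs_def] by measurable
  then have sgn: "sgn \<in> ?M \<rightarrow>\<^sub>M ?N"
    by (intro measurable_restrict_space2 measurable_restrict_space1)
       (auto simp: space_restrict_space norm_sgn)
  have "sgn -` A \<inter> space ?M = {r *\<^sub>R x | r x. 0 < r \<and> r \<le> 1 \<and> x \<in> A}" (is "?L = ?R")
  proof (intro equalityI subsetI)
    fix y assume "y \<in> ?L"
    then have "y = norm y *\<^sub>R sgn y" "0 < norm y" "norm y \<le> 1" "sgn y \<in> A"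
      by (auto simp: space_restrict_space sgn_div_norm)
    then show "y \<in> ?R" by blast
  next
    fix y assume "y \<in> ?R"
    then obtain r x where "y = r *\<^sub>R x" "0 < r" "r \<le> 1" "x \<in> A" by blast
    moreover from this A have "norm x = 1" by auto
    moreover from this have "x \<noteq> 0" by auto
    ultimately show "y \<in> ?L"
      by (auto simp: space_restrict_space sgn_div_norm)
  qed
  moreover have "emeasure ?M (?L) = emeasure lborel ?L"
    by (rule emeasure_restrict_space) (auto simp: space_restrict_space)
  ultimately show ?thesis
    by (simp add: sphere_measure_def emeasure_distr[OF sgn A(1)])
qed

definition sphere_area :: "'a::euclidean_space itself \<Rightarrow> real" where
  "sphere_area _ = measure (sphere_measure :: 'a measure) (sphere 0 1)"

text \<open>
  The supremum is a maximum when \<open>\<Omega>\<close> is compact and nonempty. The argument \<open>x\<close> ranges over the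
  whole space, since the polar dual uses the same expression for vectors that are not unit vectors.
\<close>

definition support_fun :: "'a::euclidean_space set \<Rightarrow> 'a \<Rightarrow> 'a \<Rightarrow> real" where
  "support_fun \<Omega> z0 x = (SUP z\<in>\<Omega>. x \<bullet> (z - z0))"

definition mean_log_support :: "'a::euclidean_space set \<Rightarrow> 'a \<Rightarrow> real" where
  "mean_log_support \<Omega> z0 =
     1 / sphere_area TYPE('a) * (\<integral>x. ln (support_fun \<Omega> z0 x) \<partial>sphere_measure)"

text \<open>
  For a convex body the set of values is nonempty and bounded above (by the logarithm of the
  diameter), so the real-valued supremum is the intended one.
\<close>

definition entropy :: "'a::euclidean_space set \<Rightarrow> real" where
  "entropy \<Omega> =
     (SUP z0\<in>{z0\<in>\<Omega>. \<forall>x\<in>sphere 0 1. support_fun \<Omega> z0 x > 0}. mean_log_support \<Omega> z0)"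

definition polar_dual :: "'a::euclidean_space set \<Rightarrow> 'a \<Rightarrow> 'a set" where
  "polar_dual \<Omega> z0 = {y + z0 | y. support_fun \<Omega> z0 y \<le> 1}"

definition santalo_point :: "'a::euclidean_space set \<Rightarrow> 'a" where
  "santalo_point \<Omega> =
     (THE z. z \<in> interior \<Omega> \<and>
        (\<forall>w\<in>interior \<Omega>. measure lebesgue (polar_dual \<Omega> z) \<le> measure lebesgue (polar_dual \<Omega> w)))"

definition round_ball_centered_at :: "'a::euclidean_space \<Rightarrow> 'a set \<Rightarrow> bool" where
  "round_ball_centered_at z \<Omega> \<longleftrightarrow> (\<exists>r>0. \<Omega> = cball z r)"

end

theory Submission
  imports Defs "HOL-Probability.Probability"
begin

text \<open>
  Write \<open>d = n + 1\<close>, \<open>v = V(B(1))\<close> and \<open>u = u\<^sub>z\<close>. In polar coordinates the mean of \<open>u\<^sup>-\<^sup>d\<close> over the sphere is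
  \<open>V(\<Omega>\<^sup>*\<^sub>z) / v\<close>, so Jensen's inequality for \<open>ln\<close> bounds the mean of \<open>ln u\<close> from below by
  \<open>- ln (V(\<Omega>\<^sup>*\<^sub>z) / v) / d\<close>, with equality only for constant \<open>u\<close>, that is, for a ball centred at \<open>z\<close>.
  At the Santalo point \<open>V(\<Omega>\<^sup>*\<^sub>z) \<le> v\<^sup>2 / V(\<Omega>)\<close> by the Blaschke-Santalo inequality, which gives both claims;
  its equality case is not needed.

  As the Santalo point minimises \<open>V(\<Omega>\<^sup>*\<^sub>z)\<close>, it is enough to have the Blaschke-Santalo inequality for one interior
  \<open>z\<close>, and the centroid will do. It follows from the functional form of Ball and Lehec: if \<open>f\<close> has
  barycentre \<open>0\<close> and \<open>f(x) g(y) \<le> e\<^sup>-\<^sup>\<langle>\<^sup>x\<^sup>,\<^sup>y\<^sup>\<rangle>\<close>, then \<open>\<integral>f \<integral>g \<le> (2\<pi>)\<^sup>d\<close>. This is Lehec's induction on the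
  dimension: a hyperplane halves the mass of \<open>g\<close>, and on each side integration along the line through the
  two barycentres reduces the dimension by one, using the one-dimensional case on the half line.
\<close>

section \<open>The product inequality on the half line\<close>

text \<open>Volumes alone do not support an induction on the dimension: integrating an indicator
  function along lines does not give an indicator function again. Pairs of functions with a bound on
  f(x) g(y) survive such integrations. The dimension is the size of a finite index set, because the
  dimension of a type cannot be an induction variable. Integrals of f and g are extended
  nonnegative, so every signed identity, such as the vanishing of a barycentre, is split into
  positive and negative parts.

  Gaussians are extremal throughout. On the half line f(s) = g(s) = exp(-s^2/2) attains the constant
  pi/2. Each of the two half spaces contributes pi/2 and carries only half of the mass of g, so one
  more dimension costs 2 * (pi/2 + pi/2) = 2 pi. The way back to sets K and L with k.l <= 1 is
  through exp(-a^2/2) and exp(-b^2/2), where a and b are the gauges at x and y, since x.y <= a b <=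
  a^2/2 + b^2/2. For the unit ball this is the Gaussian itself, which expresses (2 pi)^d by the
  volume of the ball.\<close>

lemma nn_integral_layer_cake:
  fixes f :: "'a \<Rightarrow> real"
  assumes "sigma_finite_measure M" and f[measurable]: "f \<in> borel_measurable M"
  shows "(\<integral>\<^sup>+x. ennreal (f x) \<partial>M) = (\<integral>\<^sup>+t. emeasure M {x\<in>space M. t < f x} * indicator {0<..} t \<partial>lborel)"
proof -
  interpret M: sigma_finite_measure M by fact
  interpret P: pair_sigma_finite M "lborel :: real measure" ..
  have "(\<integral>\<^sup>+x. ennreal (f x) \<partial>M) = (\<integral>\<^sup>+x. (\<integral>\<^sup>+t. indicator {0<..} t * (if t < f x then 1 else 0) \<partial>lborel) \<partial>M)"
  proof (rule nn_integral_cong)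
    fix x assume "x \<in> space M"
    have "(\<integral>\<^sup>+t. indicator {0<..} t * (if t < f x then 1 else 0) \<partial>lborel) = (\<integral>\<^sup>+t. indicator {0<..<f x} t \<partial>lborel)"
      by (intro nn_integral_cong) (auto split: split_indicator)
    also have "\<dots> = ennreal (f x)"
      by (cases "0 \<le> f x") (auto simp: ennreal_neg)
    finally show "ennreal (f x) = (\<integral>\<^sup>+t. indicator {0<..} t * (if t < f x then 1 else 0) \<partial>lborel)" ..
  qed
  also have "\<dots> = (\<integral>\<^sup>+t. (\<integral>\<^sup>+x. indicator {0<..} t * (if t < f x then 1 else 0) \<partial>M) \<partial>lborel)"
    by (rule P.Fubini'[symmetric]) measurable
  also have "\<dots> = (\<integral>\<^sup>+t. emeasure M {x\<in>space M. t < f x} * indicator {0<..} t \<partial>lborel)"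
  proof (rule nn_integral_cong)
    fix t :: real
    have "(\<integral>\<^sup>+x. indicator {0<..} t * (if t < f x then 1 else 0) \<partial>M) = (\<integral>\<^sup>+x. indicator {0<..} t * indicator {x\<in>space M. t < f x} x \<partial>M)"
      by (intro nn_integral_cong) (auto split: split_indicator)
    then show "(\<integral>\<^sup>+x. indicator {0<..} t * (if t < f x then 1 else 0) \<partial>M) = emeasure M {x\<in>space M. t < f x} * indicator {0<..} t"
      by (simp add: nn_integral_cmult mult.commute)
  qed
  finally show ?thesis .
qed

lemma nn_integral_half_gaussian:
  "(\<integral>\<^sup>+s. ennreal (exp (- s\<^sup>2 / 2)) * indicator {0<..} s \<partial>lborel) = ennreal (sqrt (pi / 2))"
proof -
  have "(\<integral>\<^sup>+s. ennreal (exp (- s\<^sup>2 / 2)) * indicator {0<..} s \<partial>lborel)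
      = (\<integral>\<^sup>+s. ennreal (exp (- s\<^sup>2 / 2)) * indicator {0..} s \<partial>lborel)"
    by (intro nn_integral_cong_AE) (use AE_lborel_singleton[of 0] in eventually_elim, auto split: split_indicator)
  also have "\<dots> = ennreal (sqrt 2) * (\<integral>\<^sup>+s. ennreal (exp (- s\<^sup>2)) * indicator {0..} s \<partial>lborel)"
  proof (subst nn_integral_real_affine[where c = "sqrt 2" and t = 0])
    show "ennreal \<bar>sqrt 2\<bar> * (\<integral>\<^sup>+ x. ennreal (exp (- (0 + sqrt 2 * x)\<^sup>2 / 2)) * indicator {0..} (0 + sqrt 2 * x) \<partial>lborel)
      = ennreal (sqrt 2) * (\<integral>\<^sup>+ s. ennreal (exp (- s\<^sup>2)) * indicator {0..} s \<partial>lborel)"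
      by (auto intro!: arg_cong2[where f="(*)"] nn_integral_cong simp: power_mult_distrib zero_le_mult_iff split: split_indicator)
  qed simp_all
  also have "(\<integral>\<^sup>+s. ennreal (exp (- s\<^sup>2)) * indicator {0..} s \<partial>lborel) = ennreal (sqrt pi / 2)"
  proof -
    have "(\<integral>\<^sup>+s. ennreal (indicator {0..} s *\<^sub>R exp (- s\<^sup>2)) \<partial>lborel) = ennreal (sqrt pi / 2)"
      by (subst nn_integral_eq_integral) (use gaussian_moment_0 in \<open>auto simp: has_bochner_integral_iff\<close>)
    then show ?thesis by (simp add: mult.commute ennreal_mult' ennreal_indicator)
  qed
  also have "ennreal (sqrt 2) * ennreal (sqrt pi / 2) = ennreal (sqrt (pi / 2))"
    by (simp add: ennreal_mult[symmetric] real_sqrt_divide field_simps)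
  finally show ?thesis .
qed

text \<open>Lebesgue measure in the variable ln s. It turns the geometric mean sqrt (s t), through
  which the bound exp (- s t) depends on s and t, into an arithmetic mean.\<close>

definition log_measure :: "real measure" where
  "log_measure = density lborel (\<lambda>s. ennreal (1 / s) * indicator {0<..} s)"

lemma sets_log_measure [simp, measurable_cong]: "sets log_measure = sets borel"
  by (simp add: log_measure_def)

lemma space_log_measure [simp]: "space log_measure = UNIV"
  by (simp add: log_measure_def)

lemma sigma_finite_log_measure: "sigma_finite_measure log_measure"
  unfolding log_measure_def
  by (subst sigma_finite_measure.sigma_finite_iff_density_finite[OF lborel.sigma_finite_measure_axioms])
     (auto split: split_indicator simp: ennreal_mult_eq_top_iff)

lemma nn_integral_log_measure:
  assumes [measurable]: "f \<in> borel_measurable borel"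
  shows "(\<integral>\<^sup>+s. ennreal s * f s \<partial>log_measure) = (\<integral>\<^sup>+s. f s * indicator {0<..} s \<partial>lborel)"
  unfolding log_measure_def
  by (subst nn_integral_density)
     (auto intro!: nn_integral_cong split: split_indicator simp: mult.assoc[symmetric] ennreal_mult[symmetric])

lemma emeasure_log_measure_Icc:
  assumes "0 < a" "a \<le> b"
  shows "emeasure log_measure {a..b} = ennreal (ln b - ln a)"
proof -
  have "emeasure log_measure {a..b} = (\<integral>\<^sup>+s. ennreal (1 / s) * indicator {a..b} s \<partial>lborel)"
    unfolding log_measure_def using assms
    by (subst emeasure_density) (auto intro!: nn_integral_cong split: split_indicator)
  also have "\<dots> = ennreal (ln b - ln a)"
    by (rule nn_integral_FTC_Icc) (use assms in \<open>auto intro!: derivative_eq_intros simp: field_simps\<close>)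
  finally show ?thesis .
qed

text \<open>A nonempty A lies in the interval from its infimum to \<open>exp c\<close> times its
  infimum. The bound on the differences of logarithms keeps the infimum away from 0.\<close>

lemma emeasure_log_measure_le:
  assumes [measurable]: "A \<in> sets borel" and A: "A \<subseteq> {0<..}"
    and c: "0 \<le> c" and le: "\<And>x y. x \<in> A \<Longrightarrow> y \<in> A \<Longrightarrow> ln y - ln x \<le> c"
  shows "emeasure log_measure A \<le> ennreal c"
proof (cases "A = {}")
  case False
  have le': "y * exp (- c) \<le> x" if "x \<in> A" "y \<in> A" for x y
  proof -
    have "x > 0" "y > 0" using A that by auto
    moreover have "exp (ln y - c) \<le> exp (ln x)" using le[OF that] by simp
    ultimately show ?thesis by (simp add: exp_diff exp_minus field_simps)
  qed
  obtain y0 where y0: "y0 \<in> A" using False by auto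
  have bdd: "bdd_below A" using le'[OF _ y0] by (auto intro!: bdd_belowI)
  define a where "a = Inf A"
  have ya: "y * exp (- c) \<le> a" if "y \<in> A" for y
    unfolding a_def using le' that False by (intro cInf_greatest) auto
  have "0 < y0" using A y0 by auto
  then have "0 < y0 * exp (- c)" by simp
  with ya[OF y0] have a: "0 < a" by simp
  have "A \<subseteq> {a..a * exp c}"
  proof
    fix y assume "y \<in> A"
    with ya[of y] cInf_lower[OF this bdd] show "y \<in> {a..a * exp c}"
      by (auto simp: a_def exp_minus field_simps)
  qed
  then have "emeasure log_measure A \<le> emeasure log_measure {a..a * exp c}"
    by (intro emeasure_mono) auto
  also have "\<dots> = ennreal c" using a c by (subst emeasure_log_measure_Icc) (auto simp: ln_mult)
  finally show ?thesis .
qed simp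

text \<open>
  In the variable \<open>ln s\<close> this is the one-dimensional Brunn-Minkowski inequality. It is only needed when the
  sumset lies in an interval, where comparing extreme points suffices and measurability of sumsets is no issue.
\<close>

lemma log_measure_brunn_minkowski:
  assumes [measurable]: "A \<in> sets borel" "B \<in> sets borel" "I \<in> sets borel"
    and A: "A \<subseteq> {0<..}" "A \<noteq> {}" and B: "B \<subseteq> {0<..}" "B \<noteq> {}"
    and sqrt: "\<And>a b. a \<in> A \<Longrightarrow> b \<in> B \<Longrightarrow> sqrt (a * b) \<in> I"
    and I: "\<And>x y. x \<in> I \<Longrightarrow> y \<in> I \<Longrightarrow> 0 < x \<Longrightarrow> x \<le> y \<Longrightarrow> {x..y} \<subseteq> I"
  shows "emeasure log_measure A + emeasure log_measure B \<le> 2 * emeasure log_measure I"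
proof (cases "emeasure log_measure I")
  case (real m)
  \<comment> \<open>Both geometric means lie in I, and so does the interval between them, whose
    measure is half of the left side. If they come in the wrong order, the left side is not
    positive.\<close>
  have key: "(ln a2 - ln a1) + (ln b2 - ln b1) \<le> 2 * m" if "a1 \<in> A" "a2 \<in> A" "b1 \<in> B" "b2 \<in> B" for a1 a2 b1 b2
  proof -
    have pos: "0 < a1" "0 < a2" "0 < b1" "0 < b2" using that A B by auto
    then have ln: "ln (sqrt (a1 * b1)) = (ln a1 + ln b1) / 2" "ln (sqrt (a2 * b2)) = (ln a2 + ln b2) / 2"
      by (simp_all add: ln_sqrt ln_mult)
    show ?thesis
    proof (cases "sqrt (a1 * b1) \<le> sqrt (a2 * b2)")
      case True
      have "emeasure log_measure {sqrt (a1 * b1)..sqrt (a2 * b2)} \<le> emeasure log_measure I"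
        using I[OF sqrt sqrt _ True] pos that by (intro emeasure_mono) auto
      also have "emeasure log_measure {sqrt (a1 * b1)..sqrt (a2 * b2)} = ennreal (ln (sqrt (a2 * b2)) - ln (sqrt (a1 * b1)))"
        using pos True by (intro emeasure_log_measure_Icc) auto
      finally show ?thesis using real by (simp add: ln field_simps)
    next
      case False
      then have "ln (sqrt (a2 * b2)) \<le> ln (sqrt (a1 * b1))"
        using pos by (subst ln_le_cancel_iff) auto
      then show ?thesis using real(1) by (simp add: ln field_simps)
    qed
  qed
  obtain a0 b0 where a0: "a0 \<in> A" and b0: "b0 \<in> B" using A B by auto
  \<comment> \<open>With b1 and b2 fixed, the supremum over pairs in A replaces their difference of
    logarithms by the measure of A. The same is then done for B.\<close>
  have A_le: "emeasure log_measure A \<le> ennreal (2 * m - (ln b2 - ln b1))" if "b1 \<in> B" "b2 \<in> B" for b1 b2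
    using key[OF _ _ that] key[OF a0 a0 that] A by (intro emeasure_log_measure_le) (auto simp: field_simps)
  obtain \<alpha> where \<alpha>: "emeasure log_measure A = ennreal \<alpha>" "0 \<le> \<alpha>"
    using A_le[OF b0 b0] by (cases "emeasure log_measure A") (auto simp: top_unique)
  have B_le: "ln b2 - ln b1 \<le> 2 * m - \<alpha>" if "b1 \<in> B" "b2 \<in> B" for b1 b2
    using A_le[OF that] key[OF a0 a0 that] by (simp add: \<alpha>)
  have "emeasure log_measure B \<le> ennreal (2 * m - \<alpha>)"
    using B_le[OF b0 b0] B_le B by (intro emeasure_log_measure_le) auto
  then have "emeasure log_measure A + emeasure log_measure B \<le> ennreal \<alpha> + ennreal (2 * m - \<alpha>)"
    by (simp add: \<alpha>)
  also have "\<dots> = 2 * emeasure log_measure I"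
    using \<alpha> B_le[OF b0 b0] real by (simp add: ennreal_plus[symmetric] ennreal_mult' del: ennreal_plus)
  finally show ?thesis .
qed (simp add: ennreal_mult_top)

text \<open>The function increases up to 1 and decreases afterwards. Hence its superlevel sets are
  intervals, as the set I of \<open>log_measure_brunn_minkowski\<close> has to be.\<close>

lemma mult_exp_half_square_unimodal:
  fixes x y z :: real
  assumes "0 < x" "x \<le> z" "z \<le> y"
  shows "min (x * exp (- x\<^sup>2 / 2)) (y * exp (- y\<^sup>2 / 2)) \<le> z * exp (- z\<^sup>2 / 2)"
proof -
  have deriv: "((\<lambda>u. u * exp (- u\<^sup>2 / 2)) has_real_derivative (1 - u\<^sup>2) * exp (- u\<^sup>2 / 2)) (at u)" for u :: real
    by (auto intro!: derivative_eq_intros simp: algebra_simps power2_eq_square)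
  show ?thesis
  proof (cases "z \<le> 1")
    case True
    have "x * exp (- x\<^sup>2 / 2) \<le> z * exp (- z\<^sup>2 / 2)"
    proof (rule DERIV_nonneg_imp_nondecreasing[OF \<open>x \<le> z\<close>])
      fix u assume "x \<le> u" "u \<le> z"
      then have "u\<^sup>2 \<le> 1" using assms True by (simp add: power_le_one)
      then show "\<exists>d. ((\<lambda>u. u * exp (- u\<^sup>2 / 2)) has_real_derivative d) (at u) \<and> 0 \<le> d"
        using deriv[of u] by auto
    qed
    then show ?thesis by simp
  next
    case False
    have "y * exp (- y\<^sup>2 / 2) \<le> z * exp (- z\<^sup>2 / 2)"
    proof (rule DERIV_nonpos_imp_nonincreasing[OF \<open>z \<le> y\<close>])
      fix u assume "z \<le> u" "u \<le> y"
      then have "1 \<le> u\<^sup>2" using False by (simp add: one_le_power)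
      then show "\<exists>d. ((\<lambda>u. u * exp (- u\<^sup>2 / 2)) has_real_derivative d) (at u) \<and> d \<le> 0"
        using deriv[of u] by (auto simp: mult_nonpos_nonneg intro!: exI)
    qed
    then show ?thesis by simp
  qed
qed

text \<open>With \<theta> as below, the hypothesis reads F s * G t \<le> c * \<theta>(sqrt (s t))^2,
  the Prekopa-Leindler condition in the variable ln s. Brunn-Minkowski on the level sets of F and G,
  each divided by its supremum, bounds the sum of the normalised integrals; the arithmetic-geometric
  mean inequality then bounds their product.\<close>

lemma log_measure_product_bound:
  fixes F G :: "real \<Rightarrow> real" and c :: real
  assumes [measurable]: "F \<in> borel_measurable borel" "G \<in> borel_measurable borel"
    and F0: "\<And>s. 0 \<le> F s" "\<And>s. s \<le> 0 \<Longrightarrow> F s = 0" and G0: "\<And>t. 0 \<le> G t" "\<And>t. t \<le> 0 \<Longrightarrow> G t = 0"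
    and s0: "0 < F s0" and t0: "0 < G t0"
    and FG: "\<And>s t. 0 < s \<Longrightarrow> 0 < t \<Longrightarrow> F s * G t \<le> c * (s * t * exp (- s * t))"
  shows "(\<integral>\<^sup>+s. ennreal (F s) \<partial>log_measure) * (\<integral>\<^sup>+t. ennreal (G t) \<partial>log_measure) \<le> ennreal (c * pi / 2)"
proof -
  define \<theta> where "\<theta> u = u * exp (- u\<^sup>2 / 2)" for u :: real
  have [measurable]: "\<theta> \<in> borel_measurable borel" unfolding \<theta>_def[abs_def] by measurable
  have pos: "0 < s0" "0 < t0" using F0(2)[of s0] G0(2)[of t0] s0 t0 by force+
  have "0 < F s0 * G t0" using s0 t0 by simp
  also have "\<dots> \<le> c * (s0 * t0 * exp (- s0 * t0))" using FG pos by blast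
  finally have c: "0 < c" by (rule zero_less_mult_pos2) (use pos in simp)
  have \<theta>_sq: "F s * G t \<le> c * (\<theta> (sqrt (s * t)))\<^sup>2" if "0 < s" "0 < t" for s t
    using FG[OF that] that by (simp add: \<theta>_def power_mult_distrib exp_double[symmetric] mult.assoc)
  have st: "u * exp (- u) \<le> 1" for u :: real
  proof -
    have "u \<le> exp u" using exp_ge_add_one_self[of u] by linarith
    then show ?thesis by (simp add: exp_minus field_simps)
  qed
  have FGc: "F s * G t \<le> c" for s t
  proof (cases "0 < s \<and> 0 < t")
    case True
    then have "F s * G t \<le> c * (s * t * exp (- s * t))" using FG by blast
    also have "\<dots> \<le> c * 1" using c st[of "s * t"] by (intro mult_left_mono) auto
    finally show ?thesis by simp
  next
    case False
    then show ?thesis using F0 G0 c by (auto simp: not_less)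
  qed
  define M where "M = (SUP s. F s)"
  define N where "N = (SUP t. G t)"
  \<comment> \<open>F is bounded because G is positive somewhere, and conversely.\<close>
  have bF: "bdd_above (range F)" using FGc[of _ t0] t0 by (intro bdd_aboveI[of _ "c / G t0"]) (auto simp: field_simps)
  have bG: "bdd_above (range G)" using FGc[of s0 _] s0 by (intro bdd_aboveI[of _ "c / F s0"]) (auto simp: field_simps)
  have FM: "F s \<le> M" for s unfolding M_def by (intro cSUP_upper bF) auto
  have GN: "G s \<le> N" for s unfolding N_def by (intro cSUP_upper bG) auto
  have M: "0 < M" and N: "0 < N" using s0 t0 FM[of s0] GN[of t0] by auto
  \<comment> \<open>Chosen such that F a > t M and G b > t N force \<theta>(sqrt (a b)) > t
    \<kappa>.\<close>
  define \<kappa> where "\<kappa> = sqrt (M * N / c)"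
  have \<kappa>: "0 < \<kappa>" "\<kappa>\<^sup>2 * c = M * N" using M N c by (auto simp: \<kappa>_def)
  have level: "emeasure log_measure {s. t < F s / M} + emeasure log_measure {s. t < G s / N}
      \<le> 2 * emeasure log_measure {s. t < \<theta> s / \<kappa>}" if t: "0 < t" for t
  \<comment> \<open>Brunn-Minkowski needs both sets nonempty. After the normalisation by the suprema
    both level sets are nonempty for t < 1, and both are empty otherwise.\<close>
  proof (cases "t < 1")
    case True
    have "t * M < M" "t * N < N" using True M N by auto
    then obtain a b where ab: "t * M < F a" "t * N < G b"
      unfolding M_def N_def using less_cSUP_iff[OF _ bF] less_cSUP_iff[OF _ bG] by (metis UNIV_not_empty)
    have le0: "\<not> t < F s / M" "\<not> t < G s / N" if "s \<le> 0" for s using F0 G0 that t by auto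
    show ?thesis
    proof (rule log_measure_brunn_minkowski)
      fix a b assume a: "a \<in> {s. t < F s / M}" and b: "b \<in> {s. t < G s / N}"
      have ab: "0 < a" "0 < b" using a b le0[of a] le0[of b] by (auto simp: not_le[symmetric])
      have "(t * \<kappa>)\<^sup>2 * c = (t * M) * (t * N)" using \<kappa>(2) by (simp add: power2_eq_square algebra_simps)
      also have "\<dots> < F a * G b" using a b M N t less_trans[of 0 "t * M" "F a"] by (intro mult_strict_mono) (auto simp: field_simps)
      also have "\<dots> \<le> c * (\<theta> (sqrt (a * b)))\<^sup>2" by (rule \<theta>_sq[OF ab])
      finally have "(t * \<kappa>)\<^sup>2 < (\<theta> (sqrt (a * b)))\<^sup>2" using c by (simp add: mult.commute)
      moreover have "0 \<le> \<theta> (sqrt (a * b))" using ab by (simp add: \<theta>_def)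
      ultimately have "t * \<kappa> < \<theta> (sqrt (a * b))" by (rule power_less_imp_less_base)
      then show "sqrt (a * b) \<in> {s. t < \<theta> s / \<kappa>}" using \<kappa> by (simp add: field_simps)
    next
      fix x y assume x: "x \<in> {s. t < \<theta> s / \<kappa>}" and y: "y \<in> {s. t < \<theta> s / \<kappa>}" and x0: "0 < x"
      show "{x..y} \<subseteq> {s. t < \<theta> s / \<kappa>}"
      proof
        fix z assume "z \<in> {x..y}"
        then have "min (\<theta> x) (\<theta> y) \<le> \<theta> z"
          unfolding \<theta>_def using x0 by (intro mult_exp_half_square_unimodal) auto
        then have "min (\<theta> x) (\<theta> y) / \<kappa> \<le> \<theta> z / \<kappa>" using \<kappa> by (intro divide_right_mono) auto
        moreover have "t < min (\<theta> x) (\<theta> y) / \<kappa>" using x y by (auto simp: min_def)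
        ultimately show "z \<in> {s. t < \<theta> s / \<kappa>}" by simp
      qed
    qed (use le0 ab M N in \<open>auto simp: field_simps not_le[symmetric]\<close>)
  next
    case False
    have "F s / M \<le> 1" "G s / N \<le> 1" for s using FM[of s] GN[of s] M N by auto
    then have "{s. t < F s / M} = {}" "{s. t < G s / N} = {}"
      using False by (auto simp: not_less intro: order_trans)
    then show ?thesis by simp
  qed
  note lc = nn_integral_layer_cake[OF sigma_finite_log_measure, simplified]
  \<comment> \<open>The density 1 / s cancels the factor s of \<theta>, which leaves a half
    Gaussian.\<close>
  have int\<theta>: "(\<integral>\<^sup>+s. ennreal (\<theta> s / \<kappa>) \<partial>log_measure) = ennreal (sqrt (pi / 2) / \<kappa>)"
  proof -
    have "(\<integral>\<^sup>+s. ennreal (\<theta> s / \<kappa>) \<partial>log_measure) = (\<integral>\<^sup>+s. ennreal s * ennreal (exp (- s\<^sup>2 / 2) / \<kappa>) \<partial>log_measure)"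
      using \<kappa> by (intro nn_integral_cong) (auto simp: \<theta>_def ennreal_mult''[symmetric])
    also have "\<dots> = (\<integral>\<^sup>+s. ennreal (1 / \<kappa>) * (ennreal (exp (- s\<^sup>2 / 2)) * indicator {0<..} s) \<partial>lborel)"
      using \<kappa> by (subst nn_integral_log_measure) (auto intro!: nn_integral_cong simp: mult.assoc[symmetric] ennreal_mult''[symmetric])
    also have "\<dots> = ennreal (sqrt (pi / 2) / \<kappa>)"
      using \<kappa> by (subst nn_integral_cmult) (auto simp: nn_integral_half_gaussian[simplified] ennreal_mult''[symmetric])
    finally show ?thesis .
  qed
  have "(\<integral>\<^sup>+s. ennreal (F s / M) \<partial>log_measure) + (\<integral>\<^sup>+s. ennreal (G s / N) \<partial>log_measure)
    = (\<integral>\<^sup>+t. (emeasure log_measure {s. t < F s / M} + emeasure log_measure {s. t < G s / N}) * indicator {0<..} t \<partial>lborel)"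
    (is "?P0 + ?Q0 = _")
  proof -
    interpret sigma_finite_measure log_measure by (rule sigma_finite_log_measure)
    show ?thesis by (simp add: lc nn_integral_add[symmetric] distrib_right)
  qed
  also have "\<dots> \<le> (\<integral>\<^sup>+t. 2 * (emeasure log_measure {s. t < \<theta> s / \<kappa>} * indicator {0<..} t) \<partial>lborel)"
    using level by (intro nn_integral_mono) (auto split: split_indicator)
  also have "\<dots> = 2 * (\<integral>\<^sup>+s. ennreal (\<theta> s / \<kappa>) \<partial>log_measure)"
  proof -
    interpret sigma_finite_measure log_measure by (rule sigma_finite_log_measure)
    show ?thesis by (simp add: lc nn_integral_cmult)
  qed
  finally have le0: "?P0 + ?Q0 \<le> 2 * (\<integral>\<^sup>+s. ennreal (\<theta> s / \<kappa>) \<partial>log_measure)" .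
  then have sum: "(\<integral>\<^sup>+s. ennreal (F s / M) \<partial>log_measure) + (\<integral>\<^sup>+s. ennreal (G s / N) \<partial>log_measure)
    \<le> ennreal (2 * sqrt (pi / 2) / \<kappa>)" (is "?P + ?Q \<le> _")
  proof -
    have "2 * ennreal (sqrt (pi / 2) / \<kappa>) = ennreal (2 * (sqrt (pi / 2) / \<kappa>))" by (subst ennreal_mult') auto
    then show ?thesis using le0 by (simp add: int\<theta>)
  qed
  then obtain p q where pq: "?P = ennreal p" "0 \<le> p" "?Q = ennreal q" "0 \<le> q"
    by (cases ?P; cases ?Q) (auto simp: top_unique)
  have pq_le: "p + q \<le> 2 * sqrt (pi / 2) / \<kappa>"
    using sum pq \<kappa> by (simp add: ennreal_plus[symmetric] del: ennreal_plus)
  have "4 * (p * q) \<le> (p + q)\<^sup>2" using sum_squares_bound[of p q] by (simp add: power2_sum)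
  also have "\<dots> \<le> (2 * sqrt (pi / 2) / \<kappa>)\<^sup>2" using pq pq_le by (intro power_mono) auto
  also have "\<dots> = 4 * (pi / 2) / \<kappa>\<^sup>2" by (simp add: power_divide power_mult_distrib)
  finally have "p * q * \<kappa>\<^sup>2 \<le> pi / 2" using \<kappa>(1) by (simp add: field_simps)
  then have "p * q * \<kappa>\<^sup>2 * c \<le> pi / 2 * c" using c by (intro mult_right_mono) auto
  moreover have "p * q * \<kappa>\<^sup>2 * c = (M * p) * (N * q)" by (simp only: mult.assoc \<kappa>(2)) (simp add: mult_ac)
  ultimately have "(M * p) * (N * q) \<le> pi / 2 * c" by (rule ord_eq_le_trans[OF sym, rotated])
  then have le: "(M * p) * (N * q) \<le> c * pi / 2" by (simp add: mult_ac)
  have "(\<integral>\<^sup>+s. ennreal (F s) \<partial>log_measure) = (\<integral>\<^sup>+s. ennreal M * ennreal (F s / M) \<partial>log_measure)"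
    using M F0 by (intro nn_integral_cong) (auto simp: ennreal_mult''[symmetric])
  then have "(\<integral>\<^sup>+s. ennreal (F s) \<partial>log_measure) = ennreal (M * p)"
    using M pq by (simp add: nn_integral_cmult ennreal_mult)
  moreover have "(\<integral>\<^sup>+s. ennreal (G s) \<partial>log_measure) = (\<integral>\<^sup>+s. ennreal N * ennreal (G s / N) \<partial>log_measure)"
    using N G0 by (intro nn_integral_cong) (auto simp: ennreal_mult''[symmetric])
  then have "(\<integral>\<^sup>+s. ennreal (G s) \<partial>log_measure) = ennreal (N * q)"
    using N pq by (simp add: nn_integral_cmult ennreal_mult)
  ultimately show ?thesis using le M N pq by (simp add: ennreal_mult[symmetric] ennreal_leI)
qed

text \<open>The functions s f(s) and t g(t) absorb the density of \<open>log_measure\<close>, and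
  their product supplies the factor s t in the hypothesis of
  \<open>log_measure_product_bound\<close>.\<close>

lemma half_line_product_bound:
  fixes f g :: "real \<Rightarrow> ennreal" and c :: real
  assumes [measurable]: "f \<in> borel_measurable borel" "g \<in> borel_measurable borel"
    and fg: "\<And>s t. 0 < s \<Longrightarrow> 0 < t \<Longrightarrow> f s * g t \<le> ennreal (c * exp (- s * t))"
  shows "(\<integral>\<^sup>+s. f s * indicator {0<..} s \<partial>lborel) * (\<integral>\<^sup>+t. g t * indicator {0<..} t \<partial>lborel) \<le> ennreal (c * pi / 2)"
proof (cases "(\<exists>s>0. f s \<noteq> 0) \<and> (\<exists>t>0. g t \<noteq> 0)")
  case False
  then have "(\<integral>\<^sup>+s. f s * indicator {0<..} s \<partial>lborel) = 0 \<or> (\<integral>\<^sup>+t. g t * indicator {0<..} t \<partial>lborel) = 0"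
    by (subst (1 2) nn_integral_0_iff_AE) (auto split: split_indicator)
  then show ?thesis by auto
next
  case True
  then obtain s0 t0 where 0: "0 < s0" "f s0 \<noteq> 0" "0 < t0" "g t0 \<noteq> 0" by blast
  \<comment> \<open>An infinite value of f would make the product with the nonzero
    \<open>g t0\<close> infinite. So passing to real-valued functions loses nothing.\<close>
  have f_fin: "f s < \<infinity>" if "0 < s" for s
  proof -
    have "f s * g t0 < \<infinity>" using fg[OF that 0(3)] by (rule le_less_trans) simp
    then show ?thesis using 0 by (auto simp: ennreal_mult_less_top less_top[symmetric])
  qed
  have g_fin: "g t < \<infinity>" if "0 < t" for t
  proof -
    have "f s0 * g t < \<infinity>" using fg[OF 0(1) that] by (rule le_less_trans) simp
    then show ?thesis using 0 by (auto simp: ennreal_mult_less_top less_top[symmetric])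
  qed
  define F where "F s = (if 0 < s then s * enn2real (f s) else 0)" for s
  define G where "G s = (if 0 < s then s * enn2real (g s) else 0)" for s
  have [measurable]: "F \<in> borel_measurable borel" "G \<in> borel_measurable borel"
    unfolding F_def[abs_def] G_def[abs_def] by measurable
  have eF: "ennreal (F s) = ennreal s * (f s * indicator {0<..} s)" for s
    using f_fin[of s] by (auto simp: F_def ennreal_mult less_top split: split_indicator)
  have eG: "ennreal (G s) = ennreal s * (g s * indicator {0<..} s)" for s
    using g_fin[of s] by (auto simp: G_def ennreal_mult less_top split: split_indicator)
  have "(\<integral>\<^sup>+s. ennreal (F s) \<partial>log_measure) * (\<integral>\<^sup>+t. ennreal (G t) \<partial>log_measure) \<le> ennreal (c * pi / 2)"
  proof (rule log_measure_product_bound)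
    show "0 < F s0" "0 < G t0" using 0 f_fin[of s0] g_fin[of t0] by (auto simp: F_def G_def enn2real_positive_iff zero_less_iff_neq_zero)
    fix s t :: real assume st: "0 < s" "0 < t"
    have "ennreal (enn2real (f s) * enn2real (g t)) = f s * g t"
      using f_fin g_fin st by (simp add: ennreal_mult less_top)
    also have "\<dots> \<le> ennreal (c * exp (- s * t))" using fg st by blast
    finally have "ennreal (enn2real (f s) * enn2real (g t)) \<le> ennreal (c * exp (- s * t))" .
    moreover have "0 \<le> c"
    proof (rule ccontr)
      assume "\<not> 0 \<le> c"
      then have "f s0 * g t0 \<le> 0" using fg[OF 0(1,3)] by (simp add: ennreal_neg mult_nonpos_nonneg)
      then show False using 0 by simp
    qed
    ultimately have "enn2real (f s) * enn2real (g t) \<le> c * exp (- s * t)" by (simp add: ennreal_le_iff)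
    then have "(s * t) * (enn2real (f s) * enn2real (g t)) \<le> (s * t) * (c * exp (- s * t))"
      using st by (intro mult_left_mono) auto
    then show "F s * G t \<le> c * (s * t * exp (- s * t))" using st by (simp add: F_def G_def algebra_simps)
  qed (auto simp: F_def G_def)
  then show ?thesis
    by (simp add: eF eG nn_integral_log_measure mult.assoc indicator_inter_arith[symmetric])
qed

section \<open>The functional Santalo inequality\<close>

abbreviation lborel_PiM :: "'i set \<Rightarrow> ('i \<Rightarrow> real) measure" where
  "lborel_PiM I \<equiv> Pi\<^sub>M I (\<lambda>_. lborel)"

definition sum_prod :: "'i set \<Rightarrow> ('i \<Rightarrow> real) \<Rightarrow> ('i \<Rightarrow> real) \<Rightarrow> real" where
  "sum_prod I x y = (\<Sum>i\<in>I. x i * y i)"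

text \<open>
  Barycentre \<open>0\<close>, tested on linear functionals: the positive and negative parts of \<open>x \<bullet> z\<close> have the same finite
  integral. Note that \<open>ennreal\<close> maps negative reals to \<open>0\<close>.
\<close>

definition centered :: "'i set \<Rightarrow> (('i \<Rightarrow> real) \<Rightarrow> ennreal) \<Rightarrow> bool" where
  "centered I f \<longleftrightarrow> (\<forall>z. (\<integral>\<^sup>+x. f x * ennreal (sum_prod I x z) \<partial>lborel_PiM I) < \<infinity> \<and>
     (\<integral>\<^sup>+x. f x * ennreal (sum_prod I x z) \<partial>lborel_PiM I) = (\<integral>\<^sup>+x. f x * ennreal (- sum_prod I x z) \<partial>lborel_PiM I))"

definition santalo_property :: "'i set \<Rightarrow> bool" where
  "santalo_property I \<longleftrightarrow> (\<forall>f\<in>borel_measurable (lborel_PiM I). \<forall>g\<in>borel_measurable (lborel_PiM I).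
     centered I f \<longrightarrow>
     (\<forall>x\<in>space (lborel_PiM I). \<forall>y\<in>space (lborel_PiM I). f x * g y \<le> ennreal (exp (- sum_prod I x y))) \<longrightarrow>
     (\<integral>\<^sup>+x. f x \<partial>lborel_PiM I) * (\<integral>\<^sup>+y. g y \<partial>lborel_PiM I) \<le> ennreal ((2 * pi) ^ card I))"

lemma santalo_propertyD:
  assumes "santalo_property I" "f \<in> borel_measurable (lborel_PiM I)" "g \<in> borel_measurable (lborel_PiM I)" "centered I f"
    and "\<And>x y. x \<in> space (lborel_PiM I) \<Longrightarrow> y \<in> space (lborel_PiM I) \<Longrightarrow> f x * g y \<le> ennreal (exp (- sum_prod I x y))"
  shows "(\<integral>\<^sup>+x. f x \<partial>lborel_PiM I) * (\<integral>\<^sup>+y. g y \<partial>lborel_PiM I) \<le> ennreal ((2 * pi) ^ card I)"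
  using assms unfolding santalo_property_def by auto

interpretation lborel_PiM: product_sigma_finite "\<lambda>_. lborel :: real measure" ..

lemma measurable_sum_prod [measurable]: "(\<lambda>x. sum_prod I x z) \<in> borel_measurable (lborel_PiM I)"
  unfolding sum_prod_def by measurable

lemma measurable_sum_prod' [measurable]: "(\<lambda>x. sum_prod I z x) \<in> borel_measurable (lborel_PiM I)"
  unfolding sum_prod_def by measurable

lemma sum_prod_add: "sum_prod I (\<lambda>i. x i + y i) z = sum_prod I x z + sum_prod I y z"
  "sum_prod I z (\<lambda>i. x i + y i) = sum_prod I z x + sum_prod I z y"
  by (simp_all add: sum_prod_def algebra_simps sum.distrib)

lemma sum_prod_mult: "sum_prod I (\<lambda>i. c * x i) z = c * sum_prod I x z"
  by (simp add: sum_prod_def algebra_simps sum_distrib_left)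

lemma sum_prod_cong: "(\<And>i. i \<in> I \<Longrightarrow> x i = x' i) \<Longrightarrow> (\<And>i. i \<in> I \<Longrightarrow> y i = y' i) \<Longrightarrow> sum_prod I x y = sum_prod I x' y'"
  by (simp add: sum_prod_def)

lemma sum_prod_insert: "finite I \<Longrightarrow> i \<notin> I \<Longrightarrow> sum_prod (insert i I) x y = x i * y i + sum_prod I x y"
  by (simp add: sum_prod_def)

section \<open>Volume-preserving changes of coordinates\<close>

lemma measurable_fun_upd_insert:
  assumes "f \<in> N \<rightarrow>\<^sub>M Pi\<^sub>M J M" "h \<in> N \<rightarrow>\<^sub>M M i"
  shows "(\<lambda>x. (f x)(i := h x)) \<in> N \<rightarrow>\<^sub>M Pi\<^sub>M (insert i J) M"
  by (rule measurable_fun_upd[OF _ assms]) blast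

text \<open>Translation invariance in each coordinate gives it on boxes, which determine the product
  measure. The restriction to J is there because points of the product space are extensional
  functions.\<close>

lemma distr_translate_PiM:
  assumes "finite J"
  shows "distr (lborel_PiM J) (lborel_PiM J) (\<lambda>x. \<lambda>j\<in>J. x j + a j) = lborel_PiM J"
proof (rule lborel_PiM.PiM_eqI[OF assms])
  fix A assume A: "\<And>i. i \<in> J \<Longrightarrow> A i \<in> sets (lborel :: real measure)"
  let ?A = "\<lambda>j. (\<lambda>t. a j + t) -` A j"
  have A': "?A i \<in> sets lborel" if "i \<in> J" for i
    using measurable_sets[of "(+) (a i)" borel borel "A i"] A[OF that] by simp
  have "emeasure (distr (lborel_PiM J) (lborel_PiM J) (\<lambda>x. \<lambda>j\<in>J. x j + a j)) (Pi\<^sub>E J A)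
     = emeasure (lborel_PiM J) ((\<lambda>x. \<lambda>j\<in>J. x j + a j) -` Pi\<^sub>E J A \<inter> space (lborel_PiM J))"
    using A assms by (intro emeasure_distr) (auto intro!: sets_PiM_I_finite)
  also have "(\<lambda>x. \<lambda>j\<in>J. x j + a j) -` Pi\<^sub>E J A \<inter> space (lborel_PiM J) = Pi\<^sub>E J ?A"
    by (auto simp: space_PiM PiE_iff add.commute)
  also have "emeasure (lborel_PiM J) (Pi\<^sub>E J ?A) = (\<Prod>i\<in>J. emeasure lborel (?A i))"
    using assms A' by (intro lborel_PiM.emeasure_PiM) auto
  also have "\<dots> = (\<Prod>i\<in>J. emeasure lborel (A i))"
  proof (rule prod.cong[OF refl])
    fix i assume "i \<in> J"
    then have "emeasure (distr lborel borel ((+) (a i))) (A i) = emeasure lborel (?A i)"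
      using A[of i] by (subst emeasure_distr) auto
    then show "emeasure lborel (?A i) = emeasure lborel (A i)" by (simp add: lborel_distr_plus)
  qed
  finally show "emeasure (distr (lborel_PiM J) (lborel_PiM J) (\<lambda>x. \<lambda>j\<in>J. x j + a j)) (Pi\<^sub>E J A)
    = (\<Prod>i\<in>J. emeasure lborel (A i))" .
qed simp

lemma nn_integral_translate_PiM:
  assumes "finite J" and [measurable]: "f \<in> borel_measurable (lborel_PiM J)"
  shows "(\<integral>\<^sup>+x. f (\<lambda>j\<in>J. x j + a j) \<partial>lborel_PiM J) = (\<integral>\<^sup>+x. f x \<partial>lborel_PiM J)"
  by (subst (2) distr_translate_PiM[OF assms(1), of a, symmetric]) (simp add: nn_integral_distr)

text \<open>Such a hyperplane meets every line parallel to the i-axis in a single point. This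
  disposes of the boundary between two half spaces, both for y i = \<tau> and for the hyperplane
  orthogonal to (v, 1).\<close>

lemma nn_integral_null_hyperplane:
  assumes "finite J" "i \<notin> J" and [measurable]: "f \<in> borel_measurable (lborel_PiM (insert i J))"
  shows "(\<integral>\<^sup>+x. f x * of_bool (x i + sum_prod J v x = c) \<partial>lborel_PiM (insert i J)) = 0"
proof -
  have [measurable]: "(\<lambda>x. sum_prod J v x) \<in> borel_measurable (lborel_PiM (insert i J))"
    unfolding sum_prod_def by measurable
  have "(\<integral>\<^sup>+x. f x * of_bool (x i + sum_prod J v x = c) \<partial>lborel_PiM (insert i J))
    = (\<integral>\<^sup>+x. (\<integral>\<^sup>+t. f (x(i := t)) * of_bool ((x(i := t)) i + sum_prod J v (x(i := t)) = c) \<partial>lborel) \<partial>lborel_PiM J)"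
    by (rule lborel_PiM.product_nn_integral_insert[OF assms(1,2)]) measurable
  also have "\<dots> = (\<integral>\<^sup>+x. 0 \<partial>lborel_PiM J)"
  proof (rule nn_integral_cong)
    fix x :: "'a \<Rightarrow> real"
    have "sum_prod J v (x(i := t)) = sum_prod J v x" for t
      using assms(2) by (intro sum_prod_cong) auto
    then have "AE t in lborel. f (x(i := t)) * of_bool ((x(i := t)) i + sum_prod J v (x(i := t)) = c) = 0"
      using AE_lborel_singleton[of "c - sum_prod J v x"] by auto
    from nn_integral_cong_AE[OF this] show "(\<integral>\<^sup>+t. f (x(i := t)) * of_bool ((x(i := t)) i + sum_prod J v (x(i := t)) = c) \<partial>lborel) = 0" by simp
  qed
  finally show ?thesis by simp
qed

text \<open>Here and below the sign e distinguishes the two sides of a hyperplane, so that one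
  argument serves both.\<close>

lemma nn_integral_unit_affine:
  fixes e :: real
  assumes "e = 1 \<or> e = -1" and [measurable]: "f \<in> borel_measurable borel"
  shows "(\<integral>\<^sup>+s. f (t + e * s) \<partial>lborel) = (\<integral>\<^sup>+s. f s \<partial>lborel)"
  using assms nn_integral_real_affine[of f e t] by auto

text \<open>For fixed t the coordinates in J are only translated, by e t v. After exchanging the
  integrals, it remains to substitute e t for t.\<close>

lemma nn_integral_shear_translate:
  assumes J: "finite J" "i \<notin> J" and e: "e = 1 \<or> e = (-1::real)"
    and [measurable]: "h \<in> borel_measurable (lborel_PiM (insert i J))"
  shows "(\<integral>\<^sup>+x. (\<integral>\<^sup>+t. h ((\<lambda>j\<in>J. x j + e * t * v j)(i := e * t)) * indicator {0<..} t \<partial>lborel) \<partial>lborel_PiM J)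
    = (\<integral>\<^sup>+x. h x * of_bool (0 < e * x i) \<partial>lborel_PiM (insert i J))"
proof -
  interpret J: finite_product_sigma_finite "\<lambda>_. lborel :: real measure" J by standard fact
  interpret P: pair_sigma_finite "lborel_PiM J" "lborel :: real measure" ..
  have [measurable]: "(\<lambda>(x, t). (\<lambda>j\<in>J. x j + e * t * v j)(i := e * t)) \<in> lborel_PiM J \<Otimes>\<^sub>M lborel \<rightarrow>\<^sub>M lborel_PiM (insert i J)"
    unfolding case_prod_beta
    by (rule measurable_fun_upd_insert; measurable)
  have "(\<integral>\<^sup>+x. (\<integral>\<^sup>+t. h ((\<lambda>j\<in>J. x j + e * t * v j)(i := e * t)) * indicator {0<..} t \<partial>lborel) \<partial>lborel_PiM J)
    = (\<integral>\<^sup>+t. (\<integral>\<^sup>+x. h ((\<lambda>j\<in>J. x j + e * t * v j)(i := e * t)) * indicator {0<..} t \<partial>lborel_PiM J) \<partial>lborel)"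
    by (rule P.Fubini'[symmetric]) measurable
  also have "\<dots> = (\<integral>\<^sup>+t. (\<integral>\<^sup>+x. h (x(i := 0 + e * t)) * of_bool (0 < e * (0 + e * t)) \<partial>lborel_PiM J) \<partial>lborel)"
  proof (rule nn_integral_cong)
    fix t :: real
    have [measurable]: "(\<lambda>x. x(i := e * t)) \<in> lborel_PiM J \<rightarrow>\<^sub>M lborel_PiM (insert i J)"
      by (rule measurable_fun_upd_insert; measurable)
    have "0 < e * (e * t) \<longleftrightarrow> 0 < t" using e by auto
    then show "(\<integral>\<^sup>+x. h ((\<lambda>j\<in>J. x j + e * t * v j)(i := e * t)) * indicator {0<..} t \<partial>lborel_PiM J)
      = (\<integral>\<^sup>+x. h (x(i := 0 + e * t)) * of_bool (0 < e * (0 + e * t)) \<partial>lborel_PiM J)"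
      using nn_integral_translate_PiM[OF J(1), of "\<lambda>x. h (x(i := e * t)) * indicator {0<..} t" "\<lambda>j. e * t * v j"]
      by (simp add: indicator_def of_bool_def)
  qed
  also have "\<dots> = (\<integral>\<^sup>+t. (\<integral>\<^sup>+x. h (x(i := t)) * of_bool (0 < e * t) \<partial>lborel_PiM J) \<partial>lborel)"
  proof (rule nn_integral_unit_affine[OF e, where f = "\<lambda>s. (\<integral>\<^sup>+x. h (x(i := s)) * of_bool (0 < e * s) \<partial>lborel_PiM J)"])
    have [measurable]: "(\<lambda>(s, x). x(i := s)) \<in> borel \<Otimes>\<^sub>M lborel_PiM J \<rightarrow>\<^sub>M lborel_PiM (insert i J)"
      unfolding case_prod_beta
      by (rule measurable_fun_upd_insert; measurable)
    show "(\<lambda>s. (\<integral>\<^sup>+x. h (x(i := s)) * of_bool (0 < e * s) \<partial>lborel_PiM J)) \<in> borel_measurable borel"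
      by measurable
  qed
  also have "\<dots> = (\<integral>\<^sup>+x. h x * of_bool (0 < e * x i) \<partial>lborel_PiM (insert i J))"
    by (subst lborel_PiM.product_nn_integral_insert_rev[OF J]) (auto intro!: nn_integral_cong)
  finally show ?thesis .
qed

text \<open>On the fibre over y this is a translation of the coordinate i alone, with a reflection
  if e = -1. The linear map is the inverse transpose of the one in
  \<open>nn_integral_shear_translate\<close>, hence compatible with the pairing.\<close>

lemma nn_integral_shear_coordinate:
  assumes J: "finite J" "i \<notin> J" and e: "e = 1 \<or> e = (-1::real)"
    and [measurable]: "h \<in> borel_measurable (lborel_PiM (insert i J))"
  shows "(\<integral>\<^sup>+y. (\<integral>\<^sup>+s. h (y(i := e * s - sum_prod J v y)) * indicator {0<..} s \<partial>lborel) \<partial>lborel_PiM J)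
    = (\<integral>\<^sup>+y. h y * of_bool (0 < e * (y i + sum_prod J v y)) \<partial>lborel_PiM (insert i J))"
proof -
  have [measurable]: "(\<lambda>x. sum_prod J v x) \<in> borel_measurable (lborel_PiM (insert i J))"
    unfolding sum_prod_def by measurable
  have "(\<integral>\<^sup>+y. h y * of_bool (0 < e * (y i + sum_prod J v y)) \<partial>lborel_PiM (insert i J))
    = (\<integral>\<^sup>+y. (\<integral>\<^sup>+s. h (y(i := s)) * of_bool (0 < e * ((y(i := s)) i + sum_prod J v (y(i := s)))) \<partial>lborel) \<partial>lborel_PiM J)"
    by (rule lborel_PiM.product_nn_integral_insert[OF J]) measurable
  also have "\<dots> = (\<integral>\<^sup>+y. (\<integral>\<^sup>+s. h (y(i := e * s - sum_prod J v y)) * indicator {0<..} s \<partial>lborel) \<partial>lborel_PiM J)"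
  proof (rule nn_integral_cong)
    fix y assume y: "y \<in> space (lborel_PiM J)"
    have sp: "sum_prod J v (y(i := s)) = sum_prod J v y" for s
      using J(2) by (intro sum_prod_cong) auto
    have [measurable]: "(\<lambda>s. y(i := s)) \<in> borel \<rightarrow>\<^sub>M lborel_PiM (insert i J)"
      by (rule measurable_fun_upd_insert) (use y in simp_all)
    have "e * e = 1" using e by auto
    then have "(\<integral>\<^sup>+s. h (y(i := e * s - sum_prod J v y)) * indicator {0<..} s \<partial>lborel)
      = (\<integral>\<^sup>+s. h (y(i := - sum_prod J v y + e * s)) * of_bool (0 < e * ((- sum_prod J v y + e * s) + sum_prod J v y)) \<partial>lborel)"
      by (intro nn_integral_cong) (auto simp: algebra_simps split: split_indicator)
    also have "\<dots> = (\<integral>\<^sup>+s. h (y(i := s)) * of_bool (0 < e * (s + sum_prod J v y)) \<partial>lborel)"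
      by (rule nn_integral_unit_affine[OF e, where f = "\<lambda>s. h (y(i := s)) * of_bool (0 < e * (s + sum_prod J v y))"]) measurable
    finally show "(\<integral>\<^sup>+s. h (y(i := s)) * of_bool (0 < e * ((y(i := s)) i + sum_prod J v (y(i := s)))) \<partial>lborel)
      = (\<integral>\<^sup>+s. h (y(i := e * s - sum_prod J v y)) * indicator {0<..} s \<partial>lborel)"
      by (simp add: sp)
  qed
  finally show ?thesis ..
qed

text \<open>
  The substitutions \<open>(x, t) \<mapsto> (x + e t v, e t)\<close> in \<open>p\<close> and \<open>(y, s) \<mapsto> (y, e s - v \<bullet> y)\<close> in \<open>q\<close> preserve volume and turn the
  pairing into \<open>x \<bullet> y + s t\<close>, so the half line inequality applies in \<open>(s, t)\<close>. The moment conditions say that the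
  barycentre of \<open>p\<close> on the half space lies on the line spanned by \<open>(v, 1)\<close>.
\<close>

lemma half_space_product_bound:
  fixes p q :: "('i \<Rightarrow> real) \<Rightarrow> ennreal" and e :: real
  assumes J: "finite J" "i \<notin> J" and e: "e = 1 \<or> e = -1" and santalo: "santalo_property J"
    and [measurable]: "p \<in> borel_measurable (lborel_PiM (insert i J))" "q \<in> borel_measurable (lborel_PiM (insert i J))"
    and pq: "\<And>x y. x \<in> space (lborel_PiM (insert i J)) \<Longrightarrow> y \<in> space (lborel_PiM (insert i J)) \<Longrightarrow>
      p x * q y \<le> ennreal (exp (- sum_prod (insert i J) x y))"
    and fin: "\<And>z. z i = - sum_prod J v z \<Longrightarrow>
      (\<integral>\<^sup>+x. p x * ennreal (sum_prod (insert i J) x z) * of_bool (0 < e * x i) \<partial>lborel_PiM (insert i J)) < \<infinity>"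
    and bal: "\<And>z. z i = - sum_prod J v z \<Longrightarrow>
      (\<integral>\<^sup>+x. p x * ennreal (sum_prod (insert i J) x z) * of_bool (0 < e * x i) \<partial>lborel_PiM (insert i J))
      = (\<integral>\<^sup>+x. p x * ennreal (- sum_prod (insert i J) x z) * of_bool (0 < e * x i) \<partial>lborel_PiM (insert i J))"
  shows "(\<integral>\<^sup>+x. p x * of_bool (0 < e * x i) \<partial>lborel_PiM (insert i J)) *
      (\<integral>\<^sup>+y. q y * of_bool (0 < e * (y i + sum_prod J v y)) \<partial>lborel_PiM (insert i J))
    \<le> ennreal (pi / 2 * (2 * pi) ^ card J)"
proof -
  let ?I = "insert i J"
  define P where "P x = (\<integral>\<^sup>+t. p ((\<lambda>j\<in>J. x j + e * t * v j)(i := e * t)) * indicator {0<..} t \<partial>lborel)" for x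
  define Q where "Q y = (\<integral>\<^sup>+s. q (y(i := e * s - sum_prod J v y)) * indicator {0<..} s \<partial>lborel)" for y
  have mP [measurable]: "(\<lambda>(x, t). (\<lambda>j\<in>J. x j + e * t * v j)(i := e * t)) \<in> lborel_PiM J \<Otimes>\<^sub>M borel \<rightarrow>\<^sub>M lborel_PiM ?I"
    unfolding case_prod_beta
    by (rule measurable_fun_upd_insert; measurable)
  have mQ [measurable]: "(\<lambda>(y, s). y(i := e * s - sum_prod J v y)) \<in> lborel_PiM J \<Otimes>\<^sub>M borel \<rightarrow>\<^sub>M lborel_PiM ?I"
    unfolding case_prod_beta
    by (rule measurable_fun_upd_insert; measurable)
  have [measurable]: "P \<in> borel_measurable (lborel_PiM J)" "Q \<in> borel_measurable (lborel_PiM J)"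
    unfolding P_def[abs_def] Q_def[abs_def] by measurable
  have PQ: "P x * Q y \<le> ennreal (exp (- sum_prod J x y) * pi / 2)"
    if x: "x \<in> space (lborel_PiM J)" and y: "y \<in> space (lborel_PiM J)" for x y
    unfolding P_def Q_def
  proof (rule half_line_product_bound)
    have "(\<lambda>t. (x, t)) \<in> borel \<rightarrow>\<^sub>M lborel_PiM J \<Otimes>\<^sub>M borel" "(\<lambda>t. (y, t)) \<in> borel \<rightarrow>\<^sub>M lborel_PiM J \<Otimes>\<^sub>M borel"
      using x y by measurable
    from measurable_compose[OF this(1) mP] measurable_compose[OF this(2) mQ]
    have [measurable]: "(\<lambda>t. (\<lambda>j\<in>J. x j + e * t * v j)(i := e * t)) \<in> borel \<rightarrow>\<^sub>M lborel_PiM ?I"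
      "(\<lambda>s. y(i := e * s - sum_prod J v y)) \<in> borel \<rightarrow>\<^sub>M lborel_PiM ?I" by simp_all
    show "(\<lambda>t. p ((\<lambda>j\<in>J. x j + e * t * v j)(i := e * t))) \<in> borel_measurable borel"
      "(\<lambda>s. q (y(i := e * s - sum_prod J v y))) \<in> borel_measurable borel" by measurable
    fix t s :: real
    let ?x = "(\<lambda>j\<in>J. x j + e * t * v j)(i := e * t)" and ?y = "y(i := e * s - sum_prod J v y)"
    have "sum_prod J ?x ?y = sum_prod J (\<lambda>j. x j + (e * t) * v j) y"
      using J by (intro sum_prod_cong) auto
    also have "\<dots> = sum_prod J x y + e * t * sum_prod J v y"
      by (simp only: sum_prod_add sum_prod_mult)
    finally have "sum_prod ?I ?x ?y = sum_prod J x y + (e * e) * t * s"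
      using J by (simp add: sum_prod_insert algebra_simps)
    also have "e * e = 1" using e by auto
    finally have *: "sum_prod ?I ?x ?y = sum_prod J x y + t * s" by (simp only: mult_1)
    have "?x \<in> space (lborel_PiM ?I)" "?y \<in> space (lborel_PiM ?I)"
      using x y by (auto simp: space_PiM PiE_iff extensional_def)
    from pq[OF this] show "p ?x * q ?y \<le> ennreal (exp (- sum_prod J x y) * exp (- t * s))"
      by (simp only: * exp_add[symmetric]) simp
  qed
  \<comment> \<open>The functional z on J is extended by the value - v . z at i, so that it vanishes
    on (v, 1). It then does not change along the lines over which p is integrated. The cases c = 1
    and c = -1 give the two parts of the barycentre.\<close>
  have shear: "(\<integral>\<^sup>+x. P x * ennreal (c * sum_prod J x z) \<partial>lborel_PiM J)
    = (\<integral>\<^sup>+x. p x * ennreal (c * sum_prod ?I x (z(i := - sum_prod J v z))) * of_bool (0 < e * x i) \<partial>lborel_PiM ?I)" for c z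
  proof -
    have "(\<integral>\<^sup>+x. P x * ennreal (c * sum_prod J x z) \<partial>lborel_PiM J)
      = (\<integral>\<^sup>+x. (\<integral>\<^sup>+t. (p ((\<lambda>j\<in>J. x j + e * t * v j)(i := e * t)) *
          ennreal (c * sum_prod ?I ((\<lambda>j\<in>J. x j + e * t * v j)(i := e * t)) (z(i := - sum_prod J v z)))) * indicator {0<..} t \<partial>lborel) \<partial>lborel_PiM J)"
    proof (rule nn_integral_cong)
      fix x assume x: "x \<in> space (lborel_PiM J)"
      have "(\<lambda>t. (x, t)) \<in> borel \<rightarrow>\<^sub>M lborel_PiM J \<Otimes>\<^sub>M borel" using x by measurable
      from measurable_compose[OF this mP]
      have [measurable]: "(\<lambda>t. (\<lambda>j\<in>J. x j + e * t * v j)(i := e * t)) \<in> borel \<rightarrow>\<^sub>M lborel_PiM ?I" by simp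
      have "sum_prod ?I ((\<lambda>j\<in>J. x j + e * t * v j)(i := e * t)) (z(i := - sum_prod J v z)) = sum_prod J x z" for t
      proof -
        have "sum_prod J ((\<lambda>j\<in>J. x j + e * t * v j)(i := e * t)) (z(i := - sum_prod J v z)) = sum_prod J (\<lambda>j. x j + (e * t) * v j) z"
          using J by (intro sum_prod_cong) auto
        also have "\<dots> = sum_prod J x z + e * t * sum_prod J v z"
          by (simp only: sum_prod_add sum_prod_mult)
        finally show ?thesis using J by (simp add: sum_prod_insert)
      qed
      then show "P x * ennreal (c * sum_prod J x z) = (\<integral>\<^sup>+t. (p ((\<lambda>j\<in>J. x j + e * t * v j)(i := e * t)) *
          ennreal (c * sum_prod ?I ((\<lambda>j\<in>J. x j + e * t * v j)(i := e * t)) (z(i := - sum_prod J v z)))) * indicator {0<..} t \<partial>lborel)"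
        unfolding P_def by (subst nn_integral_multc[symmetric]) (auto intro!: nn_integral_cong simp: mult_ac)
    qed
    also have "\<dots> = (\<integral>\<^sup>+x. p x * ennreal (c * sum_prod ?I x (z(i := - sum_prod J v z))) * of_bool (0 < e * x i) \<partial>lborel_PiM ?I)"
      by (rule nn_integral_shear_translate[OF J e, where h = "\<lambda>x. p x * ennreal (c * sum_prod ?I x (z(i := - sum_prod J v z)))"]) measurable
    finally show ?thesis .
  qed
  have "centered J P"
    unfolding centered_def
  proof
    fix z :: "'i \<Rightarrow> real"
    define z' where "z' = z(i := - sum_prod J v z)"
    have "z' i = - sum_prod J v z'" using J by (auto simp: z'_def intro!: sum_prod_cong)
    from fin[OF this] bal[OF this] show "(\<integral>\<^sup>+x. P x * ennreal (sum_prod J x z) \<partial>lborel_PiM J) < \<infinity> \<and>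
     (\<integral>\<^sup>+x. P x * ennreal (sum_prod J x z) \<partial>lborel_PiM J) = (\<integral>\<^sup>+x. P x * ennreal (- sum_prod J x z) \<partial>lborel_PiM J)"
      using shear[of 1 z, folded z'_def] shear[of "-1" z, folded z'_def] by simp
  qed
  \<comment> \<open>The factor 2 / pi removes the constant of the half line inequality, since the
    induction hypothesis admits no constant in front of the exponential.\<close>
  moreover have "P x * (ennreal (2 / pi) * Q y) \<le> ennreal (exp (- sum_prod J x y))"
    if "x \<in> space (lborel_PiM J)" "y \<in> space (lborel_PiM J)" for x y
  proof -
    have "P x * (ennreal (2 / pi) * Q y) = ennreal (2 / pi) * (P x * Q y)" by (simp add: mult_ac)
    also have "\<dots> \<le> ennreal (2 / pi) * ennreal (exp (- sum_prod J x y) * pi / 2)"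
      using PQ[OF that] by (rule mult_left_mono) simp
    also have "\<dots> = ennreal (exp (- sum_prod J x y))"
      by (simp add: ennreal_mult[symmetric])
    finally show ?thesis .
  qed
  ultimately have "(\<integral>\<^sup>+x. P x \<partial>lborel_PiM J) * (\<integral>\<^sup>+y. ennreal (2 / pi) * Q y \<partial>lborel_PiM J) \<le> ennreal ((2 * pi) ^ card J)"
    using santalo unfolding santalo_property_def by (elim ballE impE) auto
  then have "ennreal (pi / 2) * (ennreal (2 / pi) * ((\<integral>\<^sup>+x. P x \<partial>lborel_PiM J) * (\<integral>\<^sup>+y. Q y \<partial>lborel_PiM J)))
    \<le> ennreal (pi / 2) * ennreal ((2 * pi) ^ card J)"
    by (intro mult_left_mono) (simp_all add: nn_integral_cmult mult.left_commute del: ennreal_mult)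
  then have "(\<integral>\<^sup>+x. P x \<partial>lborel_PiM J) * (\<integral>\<^sup>+y. Q y \<partial>lborel_PiM J) \<le> ennreal (pi / 2 * (2 * pi) ^ card J)"
    by (simp add: mult.assoc[symmetric] ennreal_mult[symmetric])
  then show ?thesis
    unfolding P_def Q_def
    by (simp add: nn_integral_shear_translate[OF J e] nn_integral_shear_coordinate[OF J e])
qed

text \<open>Moving the other function by \<open>z\<close> multiplies a centred \<open>f\<close> by \<open>e\<^sup>x\<^sup>\<bullet>\<^sup>z\<close>, which cannot decrease its mass.\<close>

lemma centered_imp_integral_le_exp:
  assumes [measurable]: "f \<in> borel_measurable (lborel_PiM I)" and f: "centered I f"
  shows "(\<integral>\<^sup>+x. f x \<partial>lborel_PiM I) \<le> (\<integral>\<^sup>+x. f x * ennreal (exp (sum_prod I x z)) \<partial>lborel_PiM I)"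
proof -
  let ?T = "\<integral>\<^sup>+x. f x * ennreal (sum_prod I x z) \<partial>lborel_PiM I"
  have T: "?T < \<infinity>" "?T = (\<integral>\<^sup>+x. f x * ennreal (- sum_prod I x z) \<partial>lborel_PiM I)"
    using f unfolding centered_def by blast+
  \<comment> \<open>This is 1 + a \<le> exp a with the negative part of a moved to the other side.
    After integration the positive and negative parts of the first moment are equal and finite, so
    they cancel.\<close>
  have exp_ge: "1 + ennreal a \<le> ennreal (- a) + ennreal (exp a)" for a :: real
  proof (cases "0 \<le> a")
    case True
    then have "1 + ennreal a = ennreal (1 + a)" by simp
    also have "\<dots> \<le> ennreal (exp a)" by (intro ennreal_leI) simp
    finally show ?thesis using True by (simp add: ennreal_neg)
  next
    case False
    then have "1 + ennreal a = ennreal 1" by (simp add: ennreal_neg)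
    also have "\<dots> \<le> ennreal (- a + exp a)" using exp_ge_add_one_self[of a] by (intro ennreal_leI) linarith
    also have "\<dots> = ennreal (- a) + ennreal (exp a)" using False by (intro ennreal_plus) auto
    finally show ?thesis .
  qed
  have "?T + (\<integral>\<^sup>+x. f x \<partial>lborel_PiM I) = (\<integral>\<^sup>+x. f x * (1 + ennreal (sum_prod I x z)) \<partial>lborel_PiM I)"
    by (simp add: nn_integral_add[symmetric] distrib_left add.commute)
  also have "\<dots> \<le> (\<integral>\<^sup>+x. f x * (ennreal (- sum_prod I x z) + ennreal (exp (sum_prod I x z))) \<partial>lborel_PiM I)"
    by (intro nn_integral_mono mult_left_mono exp_ge) simp
  also have "\<dots> = ?T + (\<integral>\<^sup>+x. f x * ennreal (exp (sum_prod I x z)) \<partial>lborel_PiM I)"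
    unfolding T(2) by (simp add: nn_integral_add[symmetric] distrib_left)
  finally show ?thesis using T(1) by (simp add: ennreal_add_left_cancel_le less_top[symmetric])
qed

text \<open>Without atoms the distribution function is continuous, so it takes the value of exactly
  half the mass.\<close>

lemma finite_borel_measure_median:
  assumes "finite_borel_measure N" and atom: "\<And>t. measure N {t} = 0" and pos: "0 < measure N (space N)"
  obtains \<tau> where "measure N {..\<tau>} = measure N (space N) / 2"
proof -
  interpret finite_borel_measure N by fact
  let ?m = "measure N (space N)"
  have "\<forall>\<^sub>F x in at_bot. cdf N x < ?m / 2"
    using cdf_lim_at_bot by (rule order_tendstoD) (use pos in simp)
  then obtain a where a: "cdf N a < ?m / 2" by (meson eventually_at_bot_linorder order_refl)
  have "\<forall>\<^sub>F x in at_top. ?m / 2 < cdf N x"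
    using cdf_lim_at_top by (rule order_tendstoD) (use pos in simp)
  then obtain b where b: "?m / 2 < cdf N b" by (meson eventually_at_top_linorder order_refl)
  have "a \<le> b"
  proof (rule ccontr)
    assume "\<not> a \<le> b"
    then have "cdf N b \<le> cdf N a" by (intro cdf_nondecreasing) simp
    with a b show False by simp
  qed
  moreover have "continuous_on {a..b} (cdf N)"
    using isCont_cdf atom by (intro continuous_at_imp_continuous_on) auto
  ultimately obtain \<tau> where "cdf N \<tau> = ?m / 2"
    using IVT'[of "cdf N" a "?m / 2" b] a b by auto
  then show thesis using that by (simp add: cdf_def)
qed

text \<open>Translates a vanishing Bochner integral into the form in which \<open>centered\<close>
  and \<open>half_space_product_bound\<close> state their moment conditions.\<close>

lemma nn_integral_pos_neg_parts_eq:
  fixes \<psi> :: "'b \<Rightarrow> real"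
  assumes "integrable M \<psi>" "integral\<^sup>L M \<psi> = 0"
  shows "(\<integral>\<^sup>+x. ennreal (\<psi> x) \<partial>M) < \<infinity>" "(\<integral>\<^sup>+x. ennreal (\<psi> x) \<partial>M) = (\<integral>\<^sup>+x. ennreal (- \<psi> x) \<partial>M)"
proof -
  have fin: "(\<integral>\<^sup>+x. ennreal (\<psi> x) \<partial>M) \<noteq> \<infinity>" "(\<integral>\<^sup>+x. ennreal (- \<psi> x) \<partial>M) \<noteq> \<infinity>"
    using assms(1) by (auto simp: real_integrable_def)
  then show "(\<integral>\<^sup>+x. ennreal (\<psi> x) \<partial>M) < \<infinity>" by (simp add: less_top)
  have "enn2real (\<integral>\<^sup>+x. ennreal (\<psi> x) \<partial>M) = enn2real (\<integral>\<^sup>+x. ennreal (- \<psi> x) \<partial>M)"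
    using real_lebesgue_integral_def[OF assms(1)] assms(2) by simp
  then show "(\<integral>\<^sup>+x. ennreal (\<psi> x) \<partial>M) = (\<integral>\<^sup>+x. ennreal (- \<psi> x) \<partial>M)"
    using fin by (metis ennreal_enn2real less_top infinity_ennreal_def)
qed

text \<open>
  Here \<open>B e\<close> is the barycentre of \<open>g\<close> on the side \<open>e = \<plusminus>1\<close> of the hyperplane \<open>y\<^sub>i = \<tau>\<close> halving its mass, \<open>w\<close> the point where the
  line through \<open>B 1\<close> and \<open>B (-1)\<close> meets that hyperplane, and \<open>(v, 1)\<close> the direction of this line.
\<close>

lemma santalo_step_bounded:
  fixes f :: "('i \<Rightarrow> real) \<Rightarrow> ennreal" and g :: "('i \<Rightarrow> real) \<Rightarrow> real"
  assumes J: "finite J" "i \<notin> J" and santalo: "santalo_property J"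
    and [measurable]: "f \<in> borel_measurable (lborel_PiM (insert i J))" "g \<in> borel_measurable (lborel_PiM (insert i J))"
    and f: "centered (insert i J) f"
    and g: "\<And>y. 0 \<le> g y" "\<And>y. g y \<le> C" "\<And>y j. j \<in> insert i J \<Longrightarrow> g y \<noteq> 0 \<Longrightarrow> \<bar>y j\<bar> \<le> k"
    and fg: "\<And>x y. x \<in> space (lborel_PiM (insert i J)) \<Longrightarrow> y \<in> space (lborel_PiM (insert i J)) \<Longrightarrow>
      f x * ennreal (g y) \<le> ennreal (exp (- sum_prod (insert i J) x y))"
  shows "(\<integral>\<^sup>+x. f x \<partial>lborel_PiM (insert i J)) * (\<integral>\<^sup>+y. ennreal (g y) \<partial>lborel_PiM (insert i J))
    \<le> ennreal ((2 * pi) ^ card (insert i J))"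
proof -
  let ?I = "insert i J"
  let ?P = "lborel_PiM ?I"
  have I: "finite ?I" using J by simp
  \<comment> \<open>Since g is bounded and supported in a box, all its moments exist; the
    barycentres below are therefore defined.\<close>
  have int: "integrable ?P (\<lambda>y. g y * \<phi> y)" if [measurable]: "\<phi> \<in> borel_measurable ?P"
    and le: "\<And>y. (\<And>j. j \<in> ?I \<Longrightarrow> \<bar>y j\<bar> \<le> k) \<Longrightarrow> \<bar>\<phi> y\<bar> \<le> D" for \<phi> D
  proof (rule integrableI_bounded_set[where A = "Pi\<^sub>E ?I (\<lambda>_. {-k..k})" and B = "C * D"])
    show "Pi\<^sub>E ?I (\<lambda>_. {-k..k}) \<in> sets ?P" using I by (intro sets_PiM_I_finite) auto
    show "emeasure ?P (Pi\<^sub>E ?I (\<lambda>_. {-k..k})) < \<infinity>"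
      using I by (subst lborel_PiM.emeasure_PiM) (auto simp: emeasure_lborel_Icc_eq ennreal_prod_eq_top power_eq_top_ennreal less_top[symmetric])
    show "AE y\<in>Pi\<^sub>E ?I (\<lambda>_. {-k..k}) in ?P. norm (g y * \<phi> y) \<le> C * D"
    proof (intro AE_I2 impI)
      fix y assume "y \<in> Pi\<^sub>E ?I (\<lambda>_. {-k..k})"
      then have "\<bar>\<phi> y\<bar> \<le> D" by (intro le) (auto simp: PiE_iff abs_le_iff minus_le_iff)
      then show "norm (g y * \<phi> y) \<le> C * D"
        using g(1)[of y] g(2)[of y] by (auto simp: abs_mult intro!: mult_mono)
    qed
    show "AE y in ?P. y \<notin> Pi\<^sub>E ?I (\<lambda>_. {-k..k}) \<longrightarrow> g y * \<phi> y = 0"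
    proof (intro AE_I2 impI)
      fix y assume "y \<in> space ?P" "y \<notin> Pi\<^sub>E ?I (\<lambda>_. {-k..k})"
      then have "\<not> (\<forall>j\<in>?I. \<bar>y j\<bar> \<le> k)" by (auto simp: space_PiM PiE_iff abs_le_iff minus_le_iff)
      then obtain j where "j \<in> ?I" "\<not> \<bar>y j\<bar> \<le> k" by blast
      with g(3)[of j y] show "g y * \<phi> y = 0" by auto
    qed
  qed measurable
  have intg: "integrable ?P g" using int[of "\<lambda>_. 1" 1] by simp
  define m where "m = (\<integral>y. g y \<partial>?P)"
  have m: "(\<integral>\<^sup>+y. ennreal (g y) \<partial>?P) = ennreal m" "0 \<le> m"
    using nn_integral_eq_integral[OF intg] g(1) by (auto simp: m_def)
  show ?thesis
  proof (cases "m = 0")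
    case False
    then have m0: "0 < m" using m(2) by simp
    \<comment> \<open>The distribution of the coordinate y i under the mass g; its median gives the
      halving hyperplane.\<close>
    define N where "N = distr (density ?P (\<lambda>y. ennreal (g y))) borel (\<lambda>y. y i)"
    have emN: "emeasure N A = (\<integral>\<^sup>+y. ennreal (g y) * indicator A (y i) \<partial>?P)" if [measurable]: "A \<in> sets borel" for A
    proof -
      have "emeasure N A = emeasure (density ?P (\<lambda>y. ennreal (g y))) ((\<lambda>y. y i) -` A \<inter> space ?P)"
        unfolding N_def by (subst emeasure_distr) auto
      also have "\<dots> = (\<integral>\<^sup>+y. ennreal (g y) * indicator ((\<lambda>y. y i) -` A \<inter> space ?P) y \<partial>?P)"
        by (rule emeasure_density) measurable
      also have "\<dots> = (\<integral>\<^sup>+y. ennreal (g y) * indicator A (y i) \<partial>?P)"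
        by (intro nn_integral_cong) (auto split: split_indicator)
      finally show ?thesis .
    qed
    have N_space: "emeasure N (space N) = ennreal m"
      using emN[of UNIV] m by (simp add: N_def)
    have null: "(\<integral>\<^sup>+y. ennreal (g y) * of_bool (y i = t) \<partial>?P) = 0" for t
      using nn_integral_null_hyperplane[OF J, of "\<lambda>y. ennreal (g y)" "\<lambda>_. 0" t] by (simp add: sum_prod_def)
    have "finite_measure N" by (rule finite_measureI) (use N_space in simp)
    then have fbm: "finite_borel_measure N"
      by (simp add: finite_borel_measure_def finite_borel_measure_axioms_def N_def)
    have atom: "measure N {t} = 0" for t
      using null[of t] by (simp add: measure_def emN indicator_def of_bool_def)
    have total: "measure N (space N) = m" using N_space m by (simp add: measure_def)
    obtain \<tau> where \<tau>: "measure N {..\<tau>} = m / 2"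
      using finite_borel_measure_median[OF fbm atom] m0 unfolding total by blast
    define h :: "real \<Rightarrow> ('i \<Rightarrow> real) \<Rightarrow> real" where "h e y = of_bool (0 < e * (y i - \<tau>))" for e y
    have [measurable]: "h e \<in> borel_measurable ?P" for e unfolding h_def by measurable
    have h01: "0 \<le> h e y" "\<bar>h e y\<bar> \<le> 1" for e y by (auto simp: h_def)
    have int_h: "integrable ?P (\<lambda>y. g y * h e y)" for e
      using int[of "h e" 1] h01 by auto
    have int_hj: "integrable ?P (\<lambda>y. g y * (y j * h e y))" if "j \<in> ?I" for e j
      using that by (intro int[where D = "\<bar>k\<bar>"]) (auto simp: h_def intro: order_trans[OF _ abs_ge_self])
    have AE_ne: "AE y in ?P. ennreal (g y) * of_bool (y i = \<tau>) = 0"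
      using null[of \<tau>] by (subst (asm) nn_integral_0_iff_AE) auto
    have g_eq_0: "ennreal (g y) = 0 \<longleftrightarrow> g y = 0" for y
      using g(1)[of y] by (auto simp: ennreal_eq_0_iff intro: antisym)
    have half: "(\<integral>y. g y * h e y \<partial>?P) = m / 2" if "e = 1 \<or> e = -1" for e
    proof -
      have "(\<integral>\<^sup>+y. ennreal (g y * h (-1) y) \<partial>?P) = (\<integral>\<^sup>+y. ennreal (g y) * indicator {..\<tau>} (y i) \<partial>?P)"
        by (intro nn_integral_cong_AE) (use AE_ne in eventually_elim, auto simp: h_def split: split_indicator)
      also have "\<dots> = ennreal (m / 2)"
        by (subst emN[symmetric], simp)
          (simp only: finite_measure.emeasure_eq_measure[OF \<open>finite_measure N\<close>] \<tau>)
      finally have neg: "(\<integral>y. g y * h (-1) y \<partial>?P) = m / 2"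
        using nn_integral_eq_integral[OF int_h[of "-1"]] g(1) h01(1) m0
        by (simp add: integral_nonneg_AE)
      have "m = (\<integral>y. g y * h 1 y + g y * h (-1) y \<partial>?P)"
        unfolding m_def by (intro integral_cong_AE) (measurable, use AE_ne in eventually_elim, auto simp: h_def g_eq_0)
      also have "\<dots> = (\<integral>y. g y * h 1 y \<partial>?P) + (\<integral>y. g y * h (-1) y \<partial>?P)"
        by (intro Bochner_Integration.integral_add int_h)
      finally show ?thesis using neg that by auto
    qed
    define M where "M = m / 2"
    have M: "0 < M" using m0 by (simp add: M_def)
    define B where "B e j = (\<integral>y. g y * (y j * h e y) \<partial>?P) / M" for e j
    define \<eta> where "\<eta> e = B e i - \<tau>" for e
    \<comment> \<open>The two barycentres lie at different heights over the hyperplane, so the line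
      through them is transversal to it and v is well defined. The difference, times M, is the
      integral of g * \<bar>y i - \<tau>\<bar>, which vanishes only if g does almost
      everywhere.\<close>
    have \<eta>: "0 < \<eta> 1 - \<eta> (-1)"
    proof -
      have eq: "g y * (y i * h 1 y) - g y * (y i * h (-1) y) - \<tau> * (g y * h 1 y) + \<tau> * (g y * h (-1) y) = g y * \<bar>y i - \<tau>\<bar>" for y
        by (auto simp: h_def algebra_simps abs_if)
      have "(\<integral>y. g y * \<bar>y i - \<tau>\<bar> \<partial>?P) = M * B 1 i - M * B (-1) i - \<tau> * M + \<tau> * M"
        unfolding eq[symmetric] using M int_h int_hj half[of 1] half[of "-1"] by (simp add: B_def M_def)
      then have *: "M * (\<eta> 1 - \<eta> (-1)) = (\<integral>y. g y * \<bar>y i - \<tau>\<bar> \<partial>?P)"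
        by (simp add: \<eta>_def algebra_simps)
      have inta: "integrable ?P (\<lambda>y. g y * \<bar>y i - \<tau>\<bar>)"
        unfolding eq[symmetric] using int_h int_hj by (intro Bochner_Integration.integrable_add Bochner_Integration.integrable_diff integrable_mult_right) auto
      have "(\<integral>y. g y * \<bar>y i - \<tau>\<bar> \<partial>?P) \<noteq> 0"
      proof
        assume "(\<integral>y. g y * \<bar>y i - \<tau>\<bar> \<partial>?P) = 0"
        then have "AE y in ?P. g y * \<bar>y i - \<tau>\<bar> = 0"
          using integral_nonneg_eq_0_iff_AE[OF inta] g(1) by auto
        then have "(\<integral>y. g y * h 1 y \<partial>?P) = (\<integral>y. 0 \<partial>?P)"
          by (intro integral_cong_AE) (measurable, auto simp: h_def)
        then show False using half[of 1] m0 by simp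
      qed
      moreover have "0 \<le> (\<integral>y. g y * \<bar>y i - \<tau>\<bar> \<partial>?P)" using g(1) by (intro integral_nonneg_AE) auto
      ultimately have "0 < M * (\<eta> 1 - \<eta> (-1))" unfolding * by simp
      then show ?thesis using M by (simp add: zero_less_mult_iff)
    qed
    define v where "v j = (B 1 j - B (-1) j) / (\<eta> 1 - \<eta> (-1))" for j
    define w where "w j = (if j = i then \<tau> else B 1 j - \<eta> 1 * v j)" for j
    have Bw: "B e j = w j + \<eta> e * (if j = i then 1 else v j)" if "e = 1 \<or> e = -1" for e j
    proof (cases "j = i \<or> e = 1")
      case False
      have "(\<eta> 1 - \<eta> (-1)) * v j = B 1 j - B (-1) j" using \<eta> by (simp add: v_def)
      with False that show ?thesis by (auto simp: w_def algebra_simps)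
    qed (auto simp: w_def \<eta>_def)
    \<comment> \<open>The translated g takes the part of p in
      \<open>half_space_product_bound\<close>, because it is g whose halves are balanced about the
      line. The exponential factor in q undoes the effect of the translation on the product
      bound.\<close>
    define p where "p y = ennreal (g (\<lambda>j\<in>?I. y j + w j))" for y
    define q where "q x = f x * ennreal (exp (sum_prod ?I x w))" for x
    have [measurable]: "p \<in> borel_measurable ?P" "q \<in> borel_measurable ?P"
      unfolding p_def[abs_def] q_def[abs_def] by measurable
    have side: "(\<integral>\<^sup>+x. p x * of_bool (0 < e * x i) \<partial>?P) * (\<integral>\<^sup>+y. q y * of_bool (0 < e * (y i + sum_prod J v y)) \<partial>?P)
      \<le> ennreal (pi / 2 * (2 * pi) ^ card J)" if e: "e = 1 \<or> e = -1" for e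
    proof (rule half_space_product_bound[OF J e santalo])
      fix x y assume x: "x \<in> space ?P" and y: "y \<in> space ?P"
      let ?x = "\<lambda>j\<in>?I. x j + w j"
      have "sum_prod ?I y ?x = sum_prod ?I y (\<lambda>j. x j + w j)" by (intro sum_prod_cong) auto
      also have "\<dots> = sum_prod ?I x y + sum_prod ?I y w" by (simp add: sum_prod_add) (simp add: sum_prod_def mult.commute)
      finally have eq: "- sum_prod ?I y ?x + sum_prod ?I y w = - sum_prod ?I x y" by simp
      have "p x * q y = (f y * ennreal (g ?x)) * ennreal (exp (sum_prod ?I y w))"
        by (simp add: p_def q_def mult_ac)
      also have "\<dots> \<le> ennreal (exp (- sum_prod ?I y ?x)) * ennreal (exp (sum_prod ?I y w))"
        using x y by (intro mult_right_mono fg) (auto simp: space_PiM)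
      also have "\<dots> = ennreal (exp (- sum_prod ?I x y))"
        by (simp only: ennreal_mult'[symmetric] exp_ge_zero exp_add[symmetric] eq)
      finally show "p x * q y \<le> ennreal (exp (- sum_prod ?I x y))" .
    next
      fix z :: "'i \<Rightarrow> real" assume z: "z i = - sum_prod J v z"
      \<comment> \<open>The moment of g on side e about w in the direction z. Its integral is M *
        \<eta> e * (z i + v . z), as the barycentre is w + \<eta> e (v, 1), and this is 0 by the
        choice of z.\<close>
      define \<psi> where "\<psi> y = g y * (sum_prod ?I (\<lambda>j. y j - w j) z * h e y)" for y
      have \<psi>_sum: "\<psi> y = (\<Sum>j\<in>?I. z j * (g y * (y j * h e y)) - z j * w j * (g y * h e y))" for y
        by (simp add: \<psi>_def sum_prod_def sum_distrib_left sum_distrib_right algebra_simps)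
      have int\<psi>: "integrable ?P \<psi>"
        unfolding \<psi>_sum[abs_def] using int_h int_hj
        by (intro Bochner_Integration.integrable_sum Bochner_Integration.integrable_diff integrable_mult_right) auto
      have "integral\<^sup>L ?P \<psi> = (\<Sum>j\<in>?I. z j * (M * B e j) - z j * w j * M)"
        unfolding \<psi>_sum[abs_def] using int_h int_hj half[OF e] M
        by (subst Bochner_Integration.integral_sum) (auto simp: B_def M_def intro!: sum.cong)
      also have "\<dots> = M * \<eta> e * (\<Sum>j\<in>?I. (if j = i then 1 else v j) * z j)"
        by (simp add: Bw[OF e] sum_distrib_left algebra_simps cong: if_cong)
      also have "(\<Sum>j\<in>?I. (if j = i then 1 else v j) * z j) = z i + sum_prod J v z"
        using J unfolding sum_prod_def by (subst sum.insert) (auto intro!: sum.cong)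
      finally have int0: "integral\<^sup>L ?P \<psi> = 0" using z by simp
      have shift: "(\<integral>\<^sup>+x. p x * ennreal (c * sum_prod ?I x z) * of_bool (0 < e * x i) \<partial>?P) = (\<integral>\<^sup>+y. ennreal (c * \<psi> y) \<partial>?P)" for c
      proof -
        have "p x * ennreal (c * sum_prod ?I x z) * of_bool (0 < e * x i) = ennreal (c * \<psi> (\<lambda>j\<in>?I. x j + w j))" for x
        proof -
          define y where "y = (\<lambda>j\<in>?I. x j + w j)"
          have "sum_prod ?I (\<lambda>j. y j - w j) z = sum_prod ?I x z"
            unfolding y_def by (intro sum_prod_cong) auto
          moreover have "h e y = of_bool (0 < e * x i)"
            by (simp add: h_def y_def w_def)
          moreover have "p x = ennreal (g y)" by (simp only: p_def y_def)
          moreover have "ennreal (g y) * ennreal (c * sum_prod ?I x z) = ennreal (c * (g y * sum_prod ?I x z))"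
            using g(1)[of y] by (simp add: ennreal_mult'[symmetric] mult_ac)
          ultimately show ?thesis
            unfolding y_def[symmetric] by (cases "0 < e * x i") (simp_all add: \<psi>_def)
        qed
        moreover have "\<psi> \<in> borel_measurable ?P" using int\<psi> by simp
        ultimately show ?thesis
          using nn_integral_translate_PiM[OF I, of "\<lambda>y. ennreal (c * \<psi> y)" w] by simp
      qed
      show "(\<integral>\<^sup>+x. p x * ennreal (sum_prod ?I x z) * of_bool (0 < e * x i) \<partial>?P) < \<infinity>"
        using shift[of 1] nn_integral_pos_neg_parts_eq[OF int\<psi> int0] by simp
      show "(\<integral>\<^sup>+x. p x * ennreal (sum_prod ?I x z) * of_bool (0 < e * x i) \<partial>?P)
        = (\<integral>\<^sup>+x. p x * ennreal (- sum_prod ?I x z) * of_bool (0 < e * x i) \<partial>?P)"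
        using shift[of 1] shift[of "-1"] nn_integral_pos_neg_parts_eq[OF int\<psi> int0] by simp
    qed measurable
    have mass: "(\<integral>\<^sup>+x. p x * of_bool (0 < e * x i) \<partial>?P) = ennreal M" if e: "e = 1 \<or> e = -1" for e
    proof -
      have "p x * of_bool (0 < e * x i) = ennreal (g (\<lambda>j\<in>?I. x j + w j) * h e (\<lambda>j\<in>?I. x j + w j))" for x
        by (auto simp: p_def h_def w_def)
      then have "(\<integral>\<^sup>+x. p x * of_bool (0 < e * x i) \<partial>?P) = (\<integral>\<^sup>+y. ennreal (g y * h e y) \<partial>?P)"
        using nn_integral_translate_PiM[OF I, of "\<lambda>y. ennreal (g y * h e y)" w] by simp
      also have "\<dots> = ennreal M"
        using nn_integral_eq_integral[OF int_h[of e]] g(1) h01(1) half[OF e] by (simp add: M_def)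
      finally show ?thesis .
    qed
    have [measurable]: "(\<lambda>x. sum_prod J v x) \<in> borel_measurable ?P"
      unfolding sum_prod_def by measurable
    define qs where "qs e y = q y * of_bool (0 < e * (y i + sum_prod J v y))" for e :: real and y
    have [measurable]: "qs e \<in> borel_measurable ?P" for e
      unfolding qs_def by measurable
    have qs_le: "ennreal M * (\<integral>\<^sup>+y. qs e y \<partial>?P) \<le> ennreal (pi / 2 * (2 * pi) ^ card J)" if "e = 1 \<or> e = -1" for e
      using side[OF that] unfolding mass[OF that] qs_def[symmetric] .
    \<comment> \<open>The half spaces for q are bounded by the hyperplane through 0 orthogonal to
      (v, 1). Both are paired with the same mass M, so their bounds add up.\<close>
    have "(\<integral>\<^sup>+y. q y \<partial>?P) = (\<integral>\<^sup>+y. (qs 1 y + qs (-1) y) + q y * of_bool (y i + sum_prod J v y = 0) \<partial>?P)"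
      by (intro nn_integral_cong) (auto simp: qs_def not_less)
    also have "\<dots> = (\<integral>\<^sup>+y. qs 1 y + qs (-1) y \<partial>?P) + (\<integral>\<^sup>+y. q y * of_bool (y i + sum_prod J v y = 0) \<partial>?P)"
      by (rule nn_integral_add) measurable
    also have "\<dots> = (\<integral>\<^sup>+y. qs 1 y + qs (-1) y \<partial>?P)"
      by (subst nn_integral_null_hyperplane[OF J]) simp_all
    also have "\<dots> = (\<integral>\<^sup>+y. qs 1 y \<partial>?P) + (\<integral>\<^sup>+y. qs (-1) y \<partial>?P)"
      by (rule nn_integral_add) measurable
    finally have "ennreal M * (\<integral>\<^sup>+y. q y \<partial>?P) \<le> ennreal (pi / 2 * (2 * pi) ^ card J) + ennreal (pi / 2 * (2 * pi) ^ card J)"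
      using add_mono[OF qs_le[of 1] qs_le[of "-1"]] by (simp add: distrib_left)
    also have "\<dots> = ennreal (pi * (2 * pi) ^ card J)"
      by (subst ennreal_plus[symmetric]) auto
    finally have Mq: "ennreal M * (\<integral>\<^sup>+y. q y \<partial>?P) \<le> ennreal (pi * (2 * pi) ^ card J)" .
    \<comment> \<open>The only use of the centring of f: multiplying it by the exponential did not
      lower its integral. As m = 2 M, the constant pi becomes 2 pi.\<close>
    have "(\<integral>\<^sup>+x. f x \<partial>?P) * ennreal m \<le> (\<integral>\<^sup>+y. q y \<partial>?P) * ennreal (2 * M)"
      unfolding q_def using centered_imp_integral_le_exp[OF _ f, of w] by (intro mult_mono) (auto simp: M_def)
    also have "\<dots> = 2 * (ennreal M * (\<integral>\<^sup>+y. q y \<partial>?P))"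
      using M by (simp add: ennreal_mult' mult_ac)
    also have "\<dots> \<le> 2 * ennreal (pi * (2 * pi) ^ card J)"
      using Mq by (rule mult_left_mono) simp
    also have "\<dots> = ennreal 2 * ennreal (pi * (2 * pi) ^ card J)" by simp
    also have "\<dots> = ennreal ((2 * pi) ^ card ?I)"
      using J by (subst ennreal_mult'[symmetric]) (auto simp: mult_ac)
    finally show ?thesis by (simp add: m)
  qed (simp add: m)
qed

text \<open>Cutting off in height and in space at once yields the bounded functions of bounded
  support that \<open>santalo_step_bounded\<close> requires.\<close>

lemma SUP_truncation:
  fixes a :: ennreal
  assumes "finite I"
  shows "(SUP n::nat. if \<forall>j\<in>I. \<bar>y j\<bar> \<le> real n then min a (of_nat n) else 0) = a"
proof (rule antisym)
  show "(SUP n::nat. if \<forall>j\<in>I. \<bar>y j\<bar> \<le> real n then min a (of_nat n) else 0) \<le> a"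
    by (rule SUP_least) auto
  show "a \<le> (SUP n::nat. if \<forall>j\<in>I. \<bar>y j\<bar> \<le> real n then min a (of_nat n) else 0)"
  proof (rule dense_le)
    \<comment> \<open>Even if a is infinite, t is finite, so a single n dominates t and all
      coordinates of y.\<close>
    fix t assume t: "t < a"
    then obtain r where r: "t = ennreal r" "0 \<le> r" by (cases t) auto
    define n where "n = nat \<lceil>Max (insert r ((\<lambda>j. \<bar>y j\<bar>) ` I))\<rceil>"
    have n: "u \<le> real n" if "u \<in> insert r ((\<lambda>j. \<bar>y j\<bar>) ` I)" for u
    proof -
      have "u \<le> Max (insert r ((\<lambda>j. \<bar>y j\<bar>) ` I))" using that assms by (intro Max_ge) auto
      then show ?thesis unfolding n_def by linarith
    qed
    have "t \<le> of_nat n" using n[of r] r by (simp add: ennreal_of_nat_eq_real_of_nat ennreal_leI)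
    then have "t \<le> (if \<forall>j\<in>I. \<bar>y j\<bar> \<le> real n then min a (of_nat n) else 0)"
      using n t by auto
    also have "\<dots> \<le> (SUP n::nat. if \<forall>j\<in>I. \<bar>y j\<bar> \<le> real n then min a (of_nat n) else 0)"
      by (rule SUP_upper) simp
    finally show "t \<le> (SUP n::nat. if \<forall>j\<in>I. \<bar>y j\<bar> \<le> real n then min a (of_nat n) else 0)" .
  qed
qed

text \<open>Only g is truncated. The product bound passes to smaller functions, whereas truncating f
  would destroy its centring.\<close>

lemma santalo_property_finite: "finite I \<Longrightarrow> santalo_property I"
proof (induction I rule: finite_induct)
  case empty
  show ?case
    unfolding santalo_property_def
    by (auto simp: lborel_PiM.nn_integral_empty space_PiM sum_prod_def)
next
  case (insert i J)
  let ?I = "insert i J"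
  let ?P = "lborel_PiM ?I"
  show ?case
    unfolding santalo_property_def
  proof (intro ballI impI)
    fix f g :: "('a \<Rightarrow> real) \<Rightarrow> ennreal"
    assume [measurable]: "f \<in> borel_measurable ?P" "g \<in> borel_measurable ?P" and f: "centered ?I f"
      and fg: "\<forall>x\<in>space ?P. \<forall>y\<in>space ?P. f x * g y \<le> ennreal (exp (- sum_prod ?I x y))"
    define G where "G n y = (if \<forall>j\<in>?I. \<bar>y j\<bar> \<le> real n then min (g y) (of_nat n) else 0)" for n :: nat and y
    have "finite ?I" using insert by simp
    then have [measurable]: "G n \<in> borel_measurable ?P" for n
      unfolding G_def[abs_def] by measurable
    have G_le: "G n y \<le> of_nat n" "G n y \<le> g y" for n y by (auto simp: G_def)
    have "incseq G"
      unfolding incseq_def le_fun_def G_def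
    proof (intro allI impI)
      fix m n :: nat and y :: "'a \<Rightarrow> real" assume mn: "m \<le> n"
      then have "(of_nat m :: ennreal) \<le> of_nat n" "real m \<le> real n" by (auto intro: of_nat_mono)
      then show "(if \<forall>j\<in>?I. \<bar>y j\<bar> \<le> real m then min (g y) (of_nat m) else 0)
        \<le> (if \<forall>j\<in>?I. \<bar>y j\<bar> \<le> real n then min (g y) (of_nat n) else 0)"
        by (auto intro!: min.mono dest: order_trans simp del: min_le_iff_disj min.bounded_iff)
    qed
    then have "(\<integral>\<^sup>+y. (SUP n. G n y) \<partial>?P) = (SUP n. (\<integral>\<^sup>+y. G n y \<partial>?P))"
      by (intro nn_integral_monotone_convergence_SUP) auto
    moreover have "(SUP n. G n y) = g y" for y
      using insert unfolding G_def by (intro SUP_truncation) auto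
    ultimately have "(\<integral>\<^sup>+x. f x \<partial>?P) * (\<integral>\<^sup>+y. g y \<partial>?P) = (SUP n. (\<integral>\<^sup>+x. f x \<partial>?P) * (\<integral>\<^sup>+y. G n y \<partial>?P))"
      by (simp add: SUP_mult_left_ennreal)
    also have "\<dots> \<le> ennreal ((2 * pi) ^ card ?I)"
    proof (rule SUP_least)
      fix n
      have G_fin: "ennreal (enn2real (G n y)) = G n y" for y
        using le_less_trans[OF G_le(1)[of n y], of top] by (simp add: of_nat_less_top)
      have "(\<integral>\<^sup>+x. f x \<partial>?P) * (\<integral>\<^sup>+y. ennreal (enn2real (G n y)) \<partial>?P) \<le> ennreal ((2 * pi) ^ card ?I)"
      proof (rule santalo_step_bounded[OF insert.hyps insert.IH _ _ f])
        show "enn2real (G n y) \<le> real n" for y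
          by (rule enn2real_leI) (use G_le(1) in \<open>auto simp: ennreal_of_nat_eq_real_of_nat\<close>)
        show "\<bar>y j\<bar> \<le> real n" if "j \<in> ?I" "enn2real (G n y) \<noteq> 0" for y j
          using that by (auto simp: G_def split: if_splits)
        show "f x * ennreal (enn2real (G n y)) \<le> ennreal (exp (- sum_prod ?I x y))"
          if "x \<in> space ?P" "y \<in> space ?P" for x y
          unfolding G_fin using fg that mult_left_mono[OF G_le(2)[of n y], of "f x"] by (auto intro: order_trans)
      qed auto
      then show "(\<integral>\<^sup>+x. f x \<partial>?P) * (\<integral>\<^sup>+y. G n y \<partial>?P) \<le> ennreal ((2 * pi) ^ card ?I)"
        by (simp add: G_fin)
    qed
    finally show "(\<integral>\<^sup>+x. f x \<partial>?P) * (\<integral>\<^sup>+y. g y \<partial>?P) \<le> ennreal ((2 * pi) ^ card ?I)" .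
  qed
qed

theorem functional_santalo:
  fixes f g :: "'a::euclidean_space \<Rightarrow> ennreal"
  assumes [measurable]: "f \<in> borel_measurable borel" "g \<in> borel_measurable borel"
    and fin: "\<And>z. (\<integral>\<^sup>+x. f x * ennreal (x \<bullet> z) \<partial>lborel) < \<infinity>"
    and bal: "\<And>z. (\<integral>\<^sup>+x. f x * ennreal (x \<bullet> z) \<partial>lborel) = (\<integral>\<^sup>+x. f x * ennreal (- (x \<bullet> z)) \<partial>lborel)"
    and fg: "\<And>x y. f x * g y \<le> ennreal (exp (- (x \<bullet> y)))"
  shows "(\<integral>\<^sup>+x. f x \<partial>lborel) * (\<integral>\<^sup>+y. g y \<partial>lborel) \<le> ennreal ((2 * pi) ^ DIM('a))"
proof -
  let ?B = "Basis :: 'a set"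
  define \<Phi> where "\<Phi> x = (\<Sum>b\<in>?B. x b *\<^sub>R b)" for x
  have \<Phi> [measurable]: "\<Phi> \<in> lborel_PiM ?B \<rightarrow>\<^sub>M borel" unfolding \<Phi>_def[abs_def] by measurable
  have int: "(\<integral>\<^sup>+x. h x \<partial>lborel) = (\<integral>\<^sup>+x. h (\<Phi> x) \<partial>lborel_PiM ?B)" if "h \<in> borel_measurable borel" for h :: "'a \<Rightarrow> ennreal"
    using that by (subst lborel_eq) (simp add: nn_integral_distr \<Phi>_def[symmetric])
  have inner: "\<Phi> x \<bullet> z = sum_prod ?B x (\<lambda>b. b \<bullet> z)" for x z
    by (simp add: \<Phi>_def inner_sum_left sum_prod_def)
  have coord: "b \<bullet> \<Phi> z = z b" if "b \<in> ?B" for b z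
    using that by (simp add: \<Phi>_def inner_sum_right inner_Basis if_distrib cong: if_cong)
  have sp: "sum_prod ?B x z = \<Phi> x \<bullet> \<Phi> z" for x z
    unfolding inner by (intro sum_prod_cong) (simp_all add: coord)
  have "(\<integral>\<^sup>+x. f (\<Phi> x) \<partial>lborel_PiM ?B) * (\<integral>\<^sup>+y. g (\<Phi> y) \<partial>lborel_PiM ?B) \<le> ennreal ((2 * pi) ^ card ?B)"
  proof -
    have "centered ?B (\<lambda>x. f (\<Phi> x))"
      unfolding centered_def
    proof
      fix z :: "'a \<Rightarrow> real"
      show "(\<integral>\<^sup>+x. f (\<Phi> x) * ennreal (sum_prod ?B x z) \<partial>lborel_PiM ?B) < \<infinity> \<and>
        (\<integral>\<^sup>+x. f (\<Phi> x) * ennreal (sum_prod ?B x z) \<partial>lborel_PiM ?B) = (\<integral>\<^sup>+x. f (\<Phi> x) * ennreal (- sum_prod ?B x z) \<partial>lborel_PiM ?B)"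
        using fin[of "\<Phi> z"] bal[of "\<Phi> z"] int[of "\<lambda>x. f x * ennreal (x \<bullet> \<Phi> z)"] int[of "\<lambda>x. f x * ennreal (- (x \<bullet> \<Phi> z))"]
        by (simp add: sp)
    qed
    then show ?thesis
      by (intro santalo_propertyD[OF santalo_property_finite[OF finite_Basis]]) (use fg in \<open>simp_all add: sp\<close>)
  qed
  then show ?thesis by (simp add: int)
qed

lemma nn_integral_lborel_scaleR:
  fixes f :: "'a::euclidean_space \<Rightarrow> ennreal"
  assumes [measurable]: "f \<in> borel_measurable borel" and c: "0 < c"
  shows "(\<integral>\<^sup>+x. f x \<partial>lborel) = ennreal (c ^ DIM('a)) * (\<integral>\<^sup>+x. f (c *\<^sub>R x) \<partial>lborel)"
  by (subst lborel_affine[of c 0]) (use c in \<open>simp_all add: nn_integral_density nn_integral_distr nn_integral_cmult ennreal_power\<close>)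

section \<open>The Blaschke-Santalo inequality for centred sets\<close>

text \<open>
  For \<open>K\<close> closed and star-shaped about \<open>0\<close> this is \<open>exp (- g\<^sup>2 / 2)\<close> with \<open>g\<close> the gauge of \<open>K\<close>, and it needs no gauge to be defined.
\<close>

definition gauss_layer :: "'a::euclidean_space set \<Rightarrow> 'a \<Rightarrow> ennreal" where
  "gauss_layer K x = (\<integral>\<^sup>+t. ennreal (t * exp (- t\<^sup>2 / 2)) * indicator {0<..} t * indicator K (x /\<^sub>R t) \<partial>lborel)"

text \<open>The constant that relates integrals of \<open>gauss_layer K\<close> to integrals over K.
  One factor t comes from the density t exp (- t^2 / 2) of the layers, the other powers from the
  scaling of volume and of the integrand.\<close>

definition gauss_moment :: "nat \<Rightarrow> ennreal" where
  "gauss_moment k = (\<integral>\<^sup>+t. ennreal (t ^ Suc k * exp (- t\<^sup>2 / 2)) * indicator {0<..} t \<partial>lborel)"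

lemma measurable_gauss_layer [measurable]:
  assumes [measurable]: "K \<in> sets borel"
  shows "gauss_layer K \<in> borel_measurable borel"
  unfolding gauss_layer_def[abs_def] by measurable

text \<open>Exchange the integrals and rescale x by t. The factor does not depend on K; k = 0 gives
  volumes and k = 1 first moments, so centring passes from K to its layer function.\<close>

lemma nn_integral_gauss_layer:
  fixes K :: "'a::euclidean_space set"
  assumes [measurable]: "K \<in> sets borel" "h \<in> borel_measurable borel"
    and h: "\<And>t x. 0 < t \<Longrightarrow> h (t *\<^sub>R x) = ennreal (t ^ k) * h x"
  shows "(\<integral>\<^sup>+x. gauss_layer K x * h x \<partial>lborel) = gauss_moment (DIM('a) + k) * (\<integral>\<^sup>+x. indicator K x * h x \<partial>lborel)"
proof -
  let ?w = "\<lambda>t::real. ennreal (t * exp (- t\<^sup>2 / 2)) * indicator {0<..} t"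
  have "(\<integral>\<^sup>+x. gauss_layer K x * h x \<partial>lborel) = (\<integral>\<^sup>+x. (\<integral>\<^sup>+t. ?w t * indicator K (x /\<^sub>R t) * h x \<partial>lborel) \<partial>lborel)"
    unfolding gauss_layer_def by (intro nn_integral_cong nn_integral_multc[symmetric]) measurable
  also have "\<dots> = (\<integral>\<^sup>+t. (\<integral>\<^sup>+x. ?w t * indicator K (x /\<^sub>R t) * h x \<partial>lborel) \<partial>lborel)"
    by (rule lborel_pair.Fubini'[symmetric]) measurable
  also have "\<dots> = (\<integral>\<^sup>+t. ennreal (t ^ Suc (DIM('a) + k) * exp (- t\<^sup>2 / 2)) * indicator {0<..} t * (\<integral>\<^sup>+x. indicator K x * h x \<partial>lborel) \<partial>lborel)"
  proof (rule nn_integral_cong)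
    fix t :: real
    show "(\<integral>\<^sup>+x. ?w t * indicator K (x /\<^sub>R t) * h x \<partial>lborel)
      = ennreal (t ^ Suc (DIM('a) + k) * exp (- t\<^sup>2 / 2)) * indicator {0<..} t * (\<integral>\<^sup>+x. indicator K x * h x \<partial>lborel)"
    proof (cases "0 < t")
      case True
      have "(\<integral>\<^sup>+x. ?w t * indicator K (x /\<^sub>R t) * h x \<partial>lborel)
        = ennreal (t ^ DIM('a)) * (\<integral>\<^sup>+x. ?w t * indicator K ((t *\<^sub>R x) /\<^sub>R t) * h (t *\<^sub>R x) \<partial>lborel)"
        by (rule nn_integral_lborel_scaleR[OF _ True]) measurable
      also have "(\<integral>\<^sup>+x. ?w t * indicator K ((t *\<^sub>R x) /\<^sub>R t) * h (t *\<^sub>R x) \<partial>lborel)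
        = (\<integral>\<^sup>+x. (?w t * ennreal (t ^ k)) * (indicator K x * h x) \<partial>lborel)"
        using True by (intro nn_integral_cong) (simp add: h mult_ac)
      also have "\<dots> = (?w t * ennreal (t ^ k)) * (\<integral>\<^sup>+x. indicator K x * h x \<partial>lborel)"
        by (rule nn_integral_cmult) measurable
      also have "ennreal (t ^ DIM('a)) * ((?w t * ennreal (t ^ k)) * (\<integral>\<^sup>+x. indicator K x * h x \<partial>lborel))
        = ennreal (t ^ Suc (DIM('a) + k) * exp (- t\<^sup>2 / 2)) * indicator {0<..} t * (\<integral>\<^sup>+x. indicator K x * h x \<partial>lborel)"
      proof -
        have "ennreal (t ^ Suc (DIM('a) + k) * exp (- t\<^sup>2 / 2)) = ennreal (t ^ DIM('a) * ((t * exp (- t\<^sup>2 / 2)) * t ^ k))"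
          by (simp add: power_add mult_ac)
        also have "\<dots> = ennreal (t ^ DIM('a)) * (ennreal (t * exp (- t\<^sup>2 / 2)) * ennreal (t ^ k))"
          using True by (subst ennreal_mult', simp)+ simp
        finally show ?thesis using True by (simp only: mult.assoc indicator_simps greaterThan_iff mult_1_left)
      qed
      finally show ?thesis .
    qed simp
  qed
  also have "\<dots> = gauss_moment (DIM('a) + k) * (\<integral>\<^sup>+x. indicator K x * h x \<partial>lborel)"
    unfolding gauss_moment_def by (rule nn_integral_multc) measurable
  finally show ?thesis .
qed

lemma nn_integral_gauss_tail:
  assumes "0 \<le> a"
  shows "(\<integral>\<^sup>+t. ennreal (t * exp (- t\<^sup>2 / 2)) * indicator {a..} t \<partial>lborel) = ennreal (exp (- a\<^sup>2 / 2))"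
proof -
  have "(\<integral>\<^sup>+t. ennreal (t * exp (- t\<^sup>2 / 2)) * indicator {a..} t \<partial>lborel) = ennreal (0 - (- exp (- a\<^sup>2 / 2)))"
  proof (rule nn_integral_FTC_atLeast)
    show "((\<lambda>t. - exp (- t\<^sup>2 / 2)) has_real_derivative t * exp (- t\<^sup>2 / 2)) (at t)" for t :: real
      by (auto intro!: derivative_eq_intros)
    show "((\<lambda>t::real. - exp (- t\<^sup>2 / 2)) \<longlongrightarrow> 0) at_top" by real_asymp
  qed (use assms in auto)
  then show ?thesis by simp
qed

lemma gauss_layer_le:
  assumes "\<And>t. 0 < t \<Longrightarrow> x /\<^sub>R t \<in> K \<Longrightarrow> a \<le> t" "0 \<le> a"
  shows "gauss_layer K x \<le> ennreal (exp (- a\<^sup>2 / 2))"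
  unfolding gauss_layer_def nn_integral_gauss_tail[OF assms(2), symmetric]
  using assms by (intro nn_integral_mono) (auto split: split_indicator)

text \<open>Let \<sigma> and \<tau> be the infima of the s with x in s K and of the t with y in t L.
  Then x . y \<le> \<sigma> \<tau> \<le> \<sigma>^2 / 2 + \<tau>^2 / 2, while the layer functions
  are at most exp (- \<sigma>^2 / 2) and exp (- \<tau>^2 / 2).\<close>

lemma gauss_layer_product_le:
  assumes KL: "\<And>k l. k \<in> K \<Longrightarrow> l \<in> L \<Longrightarrow> k \<bullet> l \<le> 1"
  shows "gauss_layer K x * gauss_layer L y \<le> ennreal (exp (- (x \<bullet> y)))"
proof -
  let ?S = "{s. 0 < s \<and> x /\<^sub>R s \<in> K}" and ?T = "{t. 0 < t \<and> y /\<^sub>R t \<in> L}"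
  have st: "x \<bullet> y \<le> s * t" if "s \<in> ?S" "t \<in> ?T" for s t
    using KL[of "x /\<^sub>R s" "y /\<^sub>R t"] that by (simp add: field_simps)
  show ?thesis
  \<comment> \<open>If x lies in no positive multiple of K, the gauge is infinite and the layer
    function vanishes.\<close>
  proof (cases "?S = {} \<or> ?T = {}")
    case True
    have "gauss_layer K x = 0" if "?S = {}"
      using that unfolding gauss_layer_def by (subst nn_integral_cong[where v = "\<lambda>_. 0"]) (auto split: split_indicator)
    moreover have "gauss_layer L y = 0" if "?T = {}"
      using that unfolding gauss_layer_def by (subst nn_integral_cong[where v = "\<lambda>_. 0"]) (auto split: split_indicator)
    ultimately show ?thesis using True by auto
  next
    case False
    define \<sigma> where "\<sigma> = Inf ?S"
    define \<tau> where "\<tau> = Inf ?T"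
    have bdd: "bdd_below ?S" "bdd_below ?T" by (auto intro!: bdd_belowI[of _ 0])
    have 0: "0 \<le> \<sigma>" "0 \<le> \<tau>" unfolding \<sigma>_def \<tau>_def using False by (auto intro!: cInf_greatest)
    have le\<sigma>: "x \<bullet> y \<le> \<sigma> * t" if "t \<in> ?T" for t
    proof -
      have "x \<bullet> y / t \<le> \<sigma>"
        unfolding \<sigma>_def using False st[OF _ that] that by (intro cInf_greatest) (auto simp: field_simps)
      then show ?thesis using that by (simp add: field_simps)
    qed
    have "x \<bullet> y \<le> \<sigma> * \<tau>"
    \<comment> \<open>One cannot divide by \<sigma> = 0, but then \<open>le\<sigma>\<close> already
      gives x . y \<le> 0.\<close>
    proof (cases "\<sigma> = 0")
      case False
      then have "x \<bullet> y / \<sigma> \<le> \<tau>"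
        unfolding \<tau>_def using \<open>\<not> (?S = {} \<or> ?T = {})\<close> le\<sigma> 0 by (intro cInf_greatest) (auto simp: field_simps)
      then show ?thesis using False 0 by (simp add: field_simps)
    qed (use le\<sigma> False in auto)
    also have "\<dots> \<le> \<sigma>\<^sup>2 / 2 + \<tau>\<^sup>2 / 2" using sum_squares_bound[of \<sigma> \<tau>] by simp
    finally have xy: "- \<sigma>\<^sup>2 / 2 + - \<tau>\<^sup>2 / 2 \<le> - (x \<bullet> y)" by simp
    have "gauss_layer K x * gauss_layer L y \<le> ennreal (exp (- \<sigma>\<^sup>2 / 2)) * ennreal (exp (- \<tau>\<^sup>2 / 2))"
      using 0 cInf_lower[OF _ bdd(1)] cInf_lower[OF _ bdd(2)]
      by (intro mult_mono gauss_layer_le) (auto simp: \<sigma>_def \<tau>_def)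
    also have "\<dots> = ennreal (exp (- \<sigma>\<^sup>2 / 2 + - \<tau>\<^sup>2 / 2))" by (simp only: exp_add ennreal_mult' exp_ge_zero)
    also have "\<dots> \<le> ennreal (exp (- (x \<bullet> y)))" using xy by (intro ennreal_leI) simp
    finally show ?thesis .
  qed
qed

section \<open>Normalisation by the Gaussian integral\<close>

lemma nn_integral_gaussian_real: "(\<integral>\<^sup>+t. ennreal (exp (- t\<^sup>2 / 2)) \<partial>lborel) = ennreal (sqrt (2 * pi))"
proof -
  have "(\<integral>\<^sup>+t. ennreal (exp (- t\<^sup>2 / 2)) \<partial>lborel) = (\<integral>\<^sup>+t. ennreal (sqrt (2 * pi)) * ennreal (std_normal_density t) \<partial>lborel)"
    by (intro nn_integral_cong) (simp add: std_normal_density_def ennreal_mult'[symmetric])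
  also have "\<dots> = ennreal (sqrt (2 * pi)) * (\<integral>\<^sup>+t. ennreal (std_normal_density t) \<partial>lborel)"
    by (rule nn_integral_cmult) simp
  also have "(\<integral>\<^sup>+t. ennreal (std_normal_density t) \<partial>lborel) = 1"
    by (subst nn_integral_eq_integral) auto
  finally show ?thesis by simp
qed

lemma nn_integral_gaussian:
  "(\<integral>\<^sup>+x. ennreal (exp (- (norm x)\<^sup>2 / 2)) \<partial>(lborel :: 'a::euclidean_space measure)) = ennreal (sqrt (2 * pi) ^ DIM('a))"
proof -
  have "(\<integral>\<^sup>+x. ennreal (exp (- (norm x)\<^sup>2 / 2)) \<partial>(lborel :: 'a measure)) = (\<integral>\<^sup>+x. (\<Prod>b\<in>Basis. ennreal (exp (- (x \<bullet> b)\<^sup>2 / 2))) \<partial>(lborel :: 'a measure))"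
  proof (rule nn_integral_cong)
    fix x :: 'a
    have "(norm x)\<^sup>2 = (\<Sum>b\<in>Basis. (x \<bullet> b)\<^sup>2)"
      by (subst power2_norm_eq_inner, subst euclidean_inner) (simp add: power2_eq_square)
    then have "- (norm x)\<^sup>2 / 2 = (\<Sum>b\<in>Basis. - (x \<bullet> b)\<^sup>2 / 2)"
      by (simp add: sum_negf sum_divide_distrib)
    then show "ennreal (exp (- (norm x)\<^sup>2 / 2)) = (\<Prod>b\<in>Basis. ennreal (exp (- (x \<bullet> b)\<^sup>2 / 2)))"
      by (simp only: exp_sum finite_Basis) (simp add: prod_ennreal)
  qed
  also have "\<dots> = (\<Prod>b\<in>(Basis::'a set). \<integral>\<^sup>+t. ennreal (exp (- t\<^sup>2 / 2)) \<partial>lborel)"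
    by (rule nn_integral_lborel_prod) auto
  also have "\<dots> = ennreal (sqrt (2 * pi) ^ DIM('a))"
    unfolding nn_integral_gaussian_real by (simp add: ennreal_power)
  finally show ?thesis .
qed

text \<open>Together with the Gaussian integral this evaluates \<open>gauss_moment\<close> times the
  volume of the ball, without knowing either factor.\<close>

lemma gauss_layer_cball:
  fixes x :: "'a::euclidean_space"
  assumes "x \<noteq> 0"
  shows "gauss_layer (cball 0 1) x = ennreal (exp (- (norm x)\<^sup>2 / 2))"
proof -
  have "indicator {0<..} t * indicator (cball 0 1) (x /\<^sub>R t) = (indicator {norm x..} t :: ennreal)" for t
  proof (cases "0 < t")
    case False
    then have "\<not> norm x \<le> t" using assms zero_less_norm_iff[of x] by linarith
    then show ?thesis using False by simp
  qed (simp add: field_simps indicator_def)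
  then show ?thesis
    unfolding gauss_layer_def mult.assoc by (simp only: nn_integral_gauss_tail norm_ge_zero)
qed

lemma gauss_moment_finite: "gauss_moment k < \<infinity>"
proof -
  have "integrable lborel (\<lambda>t. std_normal_density t * \<bar>t\<bar> ^ Suc k)" by (rule integrable_std_normal_moment_abs)
  then have "integrable lborel (\<lambda>t. sqrt (2 * pi) * (std_normal_density t * \<bar>t\<bar> ^ Suc k))" by (rule integrable_mult_right)
  then have "(\<integral>\<^sup>+t. ennreal (sqrt (2 * pi) * (std_normal_density t * \<bar>t\<bar> ^ Suc k)) \<partial>lborel) < \<infinity>"
    by (subst nn_integral_eq_integral) auto
  moreover have "gauss_moment k \<le> (\<integral>\<^sup>+t. ennreal (sqrt (2 * pi) * (std_normal_density t * \<bar>t\<bar> ^ Suc k)) \<partial>lborel)"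
    unfolding gauss_moment_def
    by (intro nn_integral_mono) (auto split: split_indicator simp: std_normal_density_def)
  ultimately show ?thesis by (rule le_less_trans[rotated])
qed

theorem blaschke_santalo_centered:
  fixes K L :: "'a::euclidean_space set"
  assumes [measurable]: "K \<in> sets borel" "L \<in> sets borel"
    and fin: "\<And>z. (\<integral>\<^sup>+x. indicator K x * ennreal (x \<bullet> z) \<partial>lborel) < \<infinity>"
    and bal: "\<And>z. (\<integral>\<^sup>+x. indicator K x * ennreal (x \<bullet> z) \<partial>lborel) = (\<integral>\<^sup>+x. indicator K x * ennreal (- (x \<bullet> z)) \<partial>lborel)"
    and KL: "\<And>k l. k \<in> K \<Longrightarrow> l \<in> L \<Longrightarrow> k \<bullet> l \<le> 1"
  shows "emeasure lborel K * emeasure lborel L \<le> (emeasure lborel (cball (0::'a) 1))\<^sup>2"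
proof -
  let ?c = "gauss_moment DIM('a)"
  have vol: "(\<integral>\<^sup>+x. gauss_layer A x \<partial>lborel) = ?c * emeasure lborel A" if "A \<in> sets borel" for A :: "'a set"
    using nn_integral_gauss_layer[of A "\<lambda>_. 1" 0] that by simp
  have "AE x in lborel. gauss_layer (cball 0 1) x = ennreal (exp (- (norm (x::'a))\<^sup>2 / 2))"
    using AE_lborel_singleton[of 0] by eventually_elim (simp add: gauss_layer_cball)
  then have "(\<integral>\<^sup>+x. gauss_layer (cball 0 1) (x::'a) \<partial>lborel) = (\<integral>\<^sup>+x. ennreal (exp (- (norm (x::'a))\<^sup>2 / 2)) \<partial>lborel)"
    by (rule nn_integral_cong_AE)
  then have ball: "?c * emeasure lborel (cball (0::'a) 1) = ennreal (sqrt (2 * pi) ^ DIM('a))"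
    using vol[of "cball 0 1"] nn_integral_gaussian[where 'a = 'a] by simp
  moreover have "0 < sqrt (2 * pi) ^ DIM('a)" by simp
  ultimately have c0: "?c \<noteq> 0" by (metis mult_zero_left ennreal_eq_0_iff not_le)
  have c_fin: "?c \<noteq> \<infinity>" using gauss_moment_finite[of "DIM('a)"] by simp
  have "(?c * emeasure lborel K) * (?c * emeasure lborel L) \<le> ennreal ((2 * pi) ^ DIM('a))"
    unfolding vol[symmetric, OF assms(1)] vol[symmetric, OF assms(2)]
  proof (rule functional_santalo)
    fix z
    have pos: "(\<integral>\<^sup>+x. gauss_layer K x * ennreal (x \<bullet> z) \<partial>lborel) = gauss_moment (DIM('a) + 1) * (\<integral>\<^sup>+x. indicator K x * ennreal (x \<bullet> z) \<partial>lborel)" for z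
      by (rule nn_integral_gauss_layer) (auto simp: ennreal_mult')
    show "(\<integral>\<^sup>+x. gauss_layer K x * ennreal (x \<bullet> z) \<partial>lborel) < \<infinity>"
      unfolding pos using fin[of z] gauss_moment_finite[of "DIM('a) + 1"] by (auto simp: ennreal_mult_less_top)
    show "(\<integral>\<^sup>+x. gauss_layer K x * ennreal (x \<bullet> z) \<partial>lborel) = (\<integral>\<^sup>+x. gauss_layer K x * ennreal (- (x \<bullet> z)) \<partial>lborel)"
      using pos[of z] pos[of "- z"] bal[of z] by simp
  qed (auto intro!: gauss_layer_product_le KL)
  \<comment> \<open>The constant of the functional inequality is the square of the layer integral of
    the ball. Both sides now carry the same factor, which is cancelled below.\<close>
  also have "ennreal ((2 * pi) ^ DIM('a)) = (?c * emeasure lborel (cball (0::'a) 1)) * (?c * emeasure lborel (cball (0::'a) 1))"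
  proof -
    have "(2 * pi) ^ DIM('a) = sqrt (2 * pi) ^ DIM('a) * sqrt (2 * pi) ^ DIM('a)"
      by (subst power_mult_distrib[symmetric]) (simp only: real_sqrt_mult_self, simp)
    then show ?thesis unfolding ball by (simp only:) (rule ennreal_mult', simp)
  qed
  finally have "(?c * ?c) * (emeasure lborel K * emeasure lborel L) \<le> (?c * ?c) * (emeasure lborel (cball (0::'a) 1))\<^sup>2"
    by (simp only: power2_eq_square mult.assoc mult.left_commute)
  then show ?thesis
    using c0 c_fin by (subst (asm) ennreal_mult_le_mult_iff) (auto simp: ennreal_mult_eq_top_iff)
qed

section \<open>Support functions and polar volume\<close>

lemma support_fun_bdd:
  assumes "compact \<Omega>"
  shows "bdd_above ((\<lambda>w. x \<bullet> (w - z)) ` \<Omega>)"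
  by (intro bounded_imp_bdd_above compact_imp_bounded compact_continuous_image assms continuous_intros)

lemma support_fun_upper: "compact \<Omega> \<Longrightarrow> w \<in> \<Omega> \<Longrightarrow> x \<bullet> (w - z) \<le> support_fun \<Omega> z x"
  unfolding support_fun_def by (rule cSUP_upper[OF _ support_fun_bdd])

lemma support_fun_le_iff:
  "compact \<Omega> \<Longrightarrow> \<Omega> \<noteq> {} \<Longrightarrow> support_fun \<Omega> z x \<le> b \<longleftrightarrow> (\<forall>w\<in>\<Omega>. x \<bullet> (w - z) \<le> b)"
  unfolding support_fun_def by (rule cSUP_le_iff[OF _ support_fun_bdd])

lemma support_fun_translate:
  assumes "compact \<Omega>" "\<Omega> \<noteq> {}"
  shows "support_fun \<Omega> z x = support_fun \<Omega> y x - x \<bullet> (z - y)"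
proof (rule antisym)
  show "support_fun \<Omega> z x \<le> support_fun \<Omega> y x - x \<bullet> (z - y)"
    unfolding support_fun_le_iff[OF assms]
  proof
    fix w assume "w \<in> \<Omega>"
    from support_fun_upper[OF assms(1) this, of x y] show "x \<bullet> (w - z) \<le> support_fun \<Omega> y x - x \<bullet> (z - y)"
      by (simp add: inner_diff_right)
  qed
  have "support_fun \<Omega> y x \<le> support_fun \<Omega> z x + x \<bullet> (z - y)"
    unfolding support_fun_le_iff[OF assms]
  proof
    fix w assume "w \<in> \<Omega>"
    from support_fun_upper[OF assms(1) this, of x z] show "x \<bullet> (w - y) \<le> support_fun \<Omega> z x + x \<bullet> (z - y)"
      by (simp add: inner_diff_right)
  qed
  then show "support_fun \<Omega> y x - x \<bullet> (z - y) \<le> support_fun \<Omega> z x" by simp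
qed

lemma support_fun_scaleR:
  assumes "compact \<Omega>" "\<Omega> \<noteq> {}" "0 \<le> c"
  shows "support_fun \<Omega> z (c *\<^sub>R x) = c * support_fun \<Omega> z x"
proof (cases "c = 0")
  case True
  then show ?thesis using assms by (simp add: support_fun_def)
next
  case False
  have le: "support_fun \<Omega> z (a *\<^sub>R y) \<le> a * support_fun \<Omega> z y" if "0 < a" for a y
    unfolding support_fun_le_iff[OF assms(1,2)]
    using support_fun_upper[OF assms(1), of _ y z] that by (auto intro: mult_left_mono)
  show ?thesis
  proof (rule antisym)
    show "support_fun \<Omega> z (c *\<^sub>R x) \<le> c * support_fun \<Omega> z x" using le False assms by auto
    have "support_fun \<Omega> z x \<le> (1 / c) * support_fun \<Omega> z (c *\<^sub>R x)"
      using le[of "1 / c" "c *\<^sub>R x"] False assms by simp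
    then show "c * support_fun \<Omega> z x \<le> support_fun \<Omega> z (c *\<^sub>R x)"
      using False assms by (simp add: field_simps)
  qed
qed

text \<open>A finite convex function on the whole space is continuous.\<close>

lemma continuous_on_support_fun:
  fixes \<Omega> :: "'a::euclidean_space set"
  assumes "compact \<Omega>" "\<Omega> \<noteq> {}"
  shows "continuous_on S (support_fun \<Omega> z)"
proof -
  have "convex_on UNIV (support_fun \<Omega> z)"
  proof (rule convex_onI)
    fix t :: real and x y :: 'a
    assume t: "0 < t" "t < 1"
    show "support_fun \<Omega> z ((1 - t) *\<^sub>R x + t *\<^sub>R y) \<le> (1 - t) * support_fun \<Omega> z x + t * support_fun \<Omega> z y"
      unfolding support_fun_le_iff[OF assms] inner_add_left inner_scaleR_left
      using t by (intro ballI add_mono mult_left_mono support_fun_upper assms) auto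
  qed simp
  then have "continuous_on UNIV (support_fun \<Omega> z)" by (intro convex_on_continuous) auto
  then show ?thesis by (rule continuous_on_subset) simp
qed

lemma measurable_support_fun [measurable (raw)]:
  assumes "compact \<Omega>" "\<Omega> \<noteq> {}"
  shows "support_fun \<Omega> z \<in> borel_measurable borel"
  by (intro borel_measurable_continuous_onI continuous_on_support_fun assms)

lemma support_fun_interior_lower:
  fixes \<Omega> :: "'a::euclidean_space set"
  assumes "compact \<Omega>" "z \<in> interior \<Omega>"
  obtains \<delta> where "0 < \<delta>" "\<And>x. \<delta> * norm x \<le> support_fun \<Omega> z x"
proof -
  obtain \<delta> where \<delta>: "0 < \<delta>" "cball z \<delta> \<subseteq> \<Omega>" using assms(2) by (auto simp: mem_interior_cball)
  have "\<delta> * norm x \<le> support_fun \<Omega> z x" for x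
  proof -
    have "z + \<delta> *\<^sub>R sgn x \<in> \<Omega>" using \<delta> by (intro subsetD[OF \<delta>(2)]) (auto simp: dist_norm norm_sgn)
    from support_fun_upper[OF assms(1) this, of x z] show ?thesis
      by (simp add: sgn_div_norm dot_square_norm power2_eq_square divide_simps split: if_splits)
  qed
  then show ?thesis using that \<delta>(1) by blast
qed

lemma support_fun_cball_upper:
  assumes "compact \<Omega>" "\<Omega> \<noteq> {}" "\<Omega> \<subseteq> cball z D"
  shows "support_fun \<Omega> z x \<le> D * norm x"
  unfolding support_fun_le_iff[OF assms(1,2)]
proof
  fix w assume "w \<in> \<Omega>"
  then have "norm (w - z) \<le> D" using assms(3) by (auto simp: dist_norm norm_minus_commute)
  then have "norm x * norm (w - z) \<le> norm x * D" by (intro mult_left_mono) auto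
  then show "x \<bullet> (w - z) \<le> D * norm x" using norm_cauchy_schwarz[of x "w - z"] by (simp add: mult.commute)
qed

section \<open>Surface measure and polar coordinates\<close>

lemma measurable_sgn_euclidean [measurable]: "(sgn :: 'a::euclidean_space \<Rightarrow> 'a) \<in> borel_measurable borel"
  unfolding sgn_div_norm[abs_def] by measurable

lemma punctured_cball_borel [measurable]: "cball 0 1 - {0} \<in> sets (borel :: 'a::euclidean_space measure)"
  by auto

lemma nn_integral_sphere_measure:
  fixes f :: "'a::euclidean_space \<Rightarrow> ennreal"
  assumes [measurable]: "f \<in> borel_measurable borel"
  shows "(\<integral>\<^sup>+x. f x \<partial>sphere_measure) = of_nat DIM('a) * (\<integral>\<^sup>+x. f (sgn x) * indicator (cball 0 1 - {0}) x \<partial>lborel)"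
proof -
  let ?M = "restrict_space lborel (cball 0 1 - {0::'a})"
  let ?N = "restrict_space borel (sphere (0::'a) 1)"
  have "sgn \<in> ?M \<rightarrow>\<^sub>M ?N"
    by (intro measurable_restrict_space2 measurable_restrict_space1) (auto simp: space_restrict_space norm_sgn)
  moreover have "f \<in> borel_measurable ?N" by (rule measurable_restrict_space1) fact
  ultimately have "(\<integral>\<^sup>+x. f x \<partial>distr ?M ?N sgn) = (\<integral>\<^sup>+x. f (sgn x) \<partial>?M)"
    by (simp add: nn_integral_distr)
  also have "\<dots> = (\<integral>\<^sup>+x. f (sgn x) * indicator (cball 0 1 - {0}) x \<partial>lborel)"
    by (rule nn_integral_restrict_space) simp
  finally show ?thesis
    using \<open>f \<in> borel_measurable ?N\<close> unfolding sphere_measure_def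
    by (subst nn_integral_scale_measure) simp_all
qed

lemma emeasure_lborel_sphere: "emeasure lborel (sphere (a::'a::euclidean_space) r) = 0"
proof -
  have "sphere a r \<in> null_sets lebesgue" by (simp add: negligible_sphere negligible_iff_null_sets[symmetric])
  then show ?thesis by (auto simp: null_sets_def)
qed

text \<open>With a strict inequality on the left, both sides commute with increasing limits of \<open>k\<close>.\<close>

lemma emeasure_star_body:
  fixes k :: "'a::euclidean_space \<Rightarrow> ennreal"
  assumes "k \<in> borel_measurable borel"
  shows "emeasure lborel {x. x \<noteq> 0 \<and> ennreal (norm x ^ DIM('a)) < k (sgn x)}
    = (\<integral>\<^sup>+x. k (sgn x) * indicator (cball 0 1 - {0}) x \<partial>lborel)"
  using assms
proof (induction k rule: borel_measurable_induct)
  case (cong f g)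
  then have "f = g" by auto
  then show ?case using cong by simp
next
  case (set A)
  then have [measurable]: "A \<in> sets borel" by simp
  \<comment> \<open>For an indicator function the two sides measure the cone over A in the open and
    in the closed ball, which differ by part of a sphere.\<close>
  have "AE x in lborel. x \<notin> sphere (0::'a) 1"
    using emeasure_lborel_sphere[of "0::'a" 1] by (intro AE_not_in) (auto simp: null_sets_def)
  then have "AE x::'a in lborel. x \<in> {x. x \<noteq> 0 \<and> ennreal (norm x ^ DIM('a)) < indicator A (sgn x)} \<longleftrightarrow> x \<in> {x \<in> cball 0 1 - {0}. sgn x \<in> A}"
    by eventually_elim (auto split: split_indicator simp: power_less_one_iff ennreal_less_one_iff power_le_one_iff)
  then have "emeasure lborel {x. x \<noteq> 0 \<and> ennreal (norm x ^ DIM('a)) < indicator A (sgn x)} = emeasure lborel {x \<in> cball 0 1 - {0}. sgn x \<in> A}"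
    by (rule emeasure_eq_AE) measurable
  also have "\<dots> = (\<integral>\<^sup>+x. indicator {x \<in> cball 0 1 - {0}. sgn x \<in> A} x \<partial>lborel)" by simp
  also have "\<dots> = (\<integral>\<^sup>+x. indicator A (sgn x) * indicator (cball 0 1 - {0}) x \<partial>lborel)"
    by (intro nn_integral_cong) (auto split: split_indicator)
  finally show ?case .
next
  case (mult u c)
  then have [measurable]: "u \<in> borel_measurable borel" by simp
  show ?case
  proof (cases "c = 0")
    case False
    with mult(1) obtain r where r: "c = ennreal r" "0 < r" by (cases c) (auto simp: zero_less_iff_neq_zero)
    \<comment> \<open>Multiplying k by r dilates the star body by this factor, hence multiplies its
      volume by r.\<close>
    define \<rho> where "\<rho> = root DIM('a) r"
    have \<rho>: "0 < \<rho>" "\<rho> ^ DIM('a) = r" using r by (auto simp: \<rho>_def)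
    let ?S = "\<lambda>u. {x. x \<noteq> 0 \<and> ennreal (norm x ^ DIM('a)) < u (sgn x)} :: 'a set"
    have "emeasure lborel (?S (\<lambda>x. c * u x)) = (\<integral>\<^sup>+x. indicator (?S (\<lambda>x. c * u x)) x \<partial>lborel)" by simp
    also have "\<dots> = ennreal (\<rho> ^ DIM('a)) * (\<integral>\<^sup>+x. indicator (?S (\<lambda>x. c * u x)) (\<rho> *\<^sub>R x) \<partial>lborel)"
      by (rule nn_integral_lborel_scaleR[OF _ \<rho>(1)]) measurable
    also have "(\<lambda>x. indicator (?S (\<lambda>x. c * u x)) (\<rho> *\<^sub>R x)) = (indicator (?S u) :: 'a \<Rightarrow> ennreal)"
    proof
      fix x :: 'a
      have "sgn (\<rho> *\<^sub>R x) = sgn x" using \<rho>(1) by (simp add: sgn_scaleR)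
      moreover have "ennreal (norm (\<rho> *\<^sub>R x) ^ DIM('a)) = c * ennreal (norm x ^ DIM('a))"
        using \<rho> r by (simp add: power_mult_distrib ennreal_mult')
      moreover have "c * ennreal (norm x ^ DIM('a)) < c * u (sgn x) \<longleftrightarrow> ennreal (norm x ^ DIM('a)) < u (sgn x)"
        using False mult(1) by (simp add: not_le[symmetric] ennreal_mult_le_mult_iff)
      ultimately show "indicator (?S (\<lambda>x. c * u x)) (\<rho> *\<^sub>R x) = (indicator (?S u) x :: ennreal)"
        using \<rho> by (simp add: indicator_def)
    qed
    also have "(\<integral>\<^sup>+x. indicator (?S u) x \<partial>lborel) = emeasure lborel (?S u)" by simp
    also have "ennreal (\<rho> ^ DIM('a)) * emeasure lborel (?S u) = c * (\<integral>\<^sup>+x. u (sgn x) * indicator (cball 0 1 - {0}) x \<partial>lborel)"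
      using mult(4) by (simp add: \<rho>(2) r(1))
    also have "\<dots> = (\<integral>\<^sup>+x. c * u (sgn x) * indicator (cball 0 1 - {0}) x \<partial>lborel)"
      by (simp add: mult.assoc nn_integral_cmult)
    finally show ?thesis .
  qed simp
next
  case (add u v)
  then have [measurable]: "u \<in> borel_measurable borel" "v \<in> borel_measurable borel" by simp_all
  let ?S = "\<lambda>u. {x. x \<noteq> 0 \<and> ennreal (norm x ^ DIM('a)) < u (sgn x)} :: 'a set"
  \<comment> \<open>The induction rule only adds functions with disjoint supports, so the star body
    of the sum is a disjoint union.\<close>
  have uv: "u x = 0 \<or> v x = 0" for x using \<open>\<And>x. x \<in> space borel \<Longrightarrow> u x = 0 \<or> v x = 0\<close> by simp
  have "?S (\<lambda>x. v x + u x) = ?S v \<union> ?S u"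
  proof (intro set_eqI)
    fix x show "x \<in> ?S (\<lambda>x. v x + u x) \<longleftrightarrow> x \<in> ?S v \<union> ?S u" using uv[of "sgn x"] by auto
  qed
  moreover have "?S v \<inter> ?S u = {}"
  proof (intro set_eqI)
    fix x show "x \<in> ?S v \<inter> ?S u \<longleftrightarrow> x \<in> {}" using uv[of "sgn x"] by auto
  qed
  ultimately have "emeasure lborel (?S (\<lambda>x. v x + u x)) = emeasure lborel (?S v) + emeasure lborel (?S u)"
    by (simp add: plus_emeasure[symmetric])
  also have "\<dots> = (\<integral>\<^sup>+x. (v (sgn x) + u (sgn x)) * indicator (cball 0 1 - {0}) x \<partial>lborel)"
    using add.IH by (simp add: nn_integral_add[symmetric] distrib_right)
  finally show ?case .
next
  case (seq U)
  then have [measurable]: "U i \<in> borel_measurable borel" for i by simp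
  let ?S = "\<lambda>u. {x. x \<noteq> 0 \<and> ennreal (norm x ^ DIM('a)) < u (sgn x)} :: 'a set"
  have mono: "U m x \<le> U n x" if "m \<le> n" for m n x using \<open>incseq U\<close> that by (auto simp: incseq_def le_fun_def)
  have "?S (SUP i. U i) = (\<Union>i. ?S (U i))" by (auto simp: less_SUP_iff)
  moreover have "(SUP i. emeasure lborel (?S (U i))) = emeasure lborel (\<Union>i. ?S (U i))"
    by (rule SUP_emeasure_incseq) (auto simp: incseq_def intro: less_le_trans mono)
  ultimately have "emeasure lborel (?S (SUP i. U i)) = (SUP i. (\<integral>\<^sup>+x. U i (sgn x) * indicator (cball 0 1 - {0}) x \<partial>lborel))"
    using seq.IH by simp
  also have "\<dots> = (\<integral>\<^sup>+x. (SUP i. U i (sgn x) * indicator (cball 0 1 - {0}) x) \<partial>lborel)"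
    by (rule nn_integral_monotone_convergence_SUP[symmetric])
       (auto simp: incseq_def le_fun_def intro!: mult_right_mono mono)
  also have "\<dots> = (\<integral>\<^sup>+x. (SUP i. U i) (sgn x) * indicator (cball 0 1 - {0}) x \<partial>lborel)"
    by (simp add: SUP_mult_right_ennreal image_comp)
  finally show ?case .
qed

lemma emeasure_sphere_measure_space:
  "emeasure sphere_measure (sphere (0::'a::euclidean_space) 1) = ennreal (real DIM('a) * measure lborel (cball (0::'a) 1))"
proof -
  have "emeasure sphere_measure (sphere (0::'a) 1) = (\<integral>\<^sup>+x. 1 \<partial>(sphere_measure :: 'a measure))"
    by simp
  also have "\<dots> = of_nat DIM('a) * emeasure lborel (cball 0 1 - {0::'a})"
    by (subst nn_integral_sphere_measure) auto
  also have "emeasure lborel (cball 0 1 - {0::'a}) = emeasure lborel (cball (0::'a) 1)"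
    by (rule emeasure_Diff_null_set) (auto simp: null_sets_def)
  also have "\<dots> = ennreal (measure lborel (cball (0::'a) 1))"
    by (rule emeasure_eq_ennreal_measure) (use emeasure_bounded_finite[OF bounded_cball] in \<open>simp add: less_top\<close>)
  finally show ?thesis by (simp add: ennreal_mult' ennreal_of_nat_eq_real_of_nat)
qed

lemma sphere_area_eq: "sphere_area TYPE('a::euclidean_space) = real DIM('a) * measure lborel (cball (0::'a) 1)"
  unfolding sphere_area_def measure_def emeasure_sphere_measure_space by simp

lemma measure_cball_pos: "0 < r \<Longrightarrow> 0 < measure lborel (cball (a::'a::euclidean_space) r)"
  by (rule content_cball_pos)

lemma sphere_area_pos: "0 < sphere_area TYPE('a::euclidean_space)"
  by (simp add: sphere_area_eq measure_cball_pos)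

lemma finite_measure_sphere_measure: "finite_measure (sphere_measure :: 'a::euclidean_space measure)"
  by (rule finite_measureI) (simp add: emeasure_sphere_measure_space)

lemma integrable_sphere_measure:
  fixes f :: "'a::euclidean_space \<Rightarrow> real"
  assumes "f \<in> borel_measurable borel" "continuous_on (sphere 0 1) f"
  shows "integrable sphere_measure f"
proof -
  interpret finite_measure "sphere_measure :: 'a measure" by (rule finite_measure_sphere_measure)
  obtain B where "\<forall>x\<in>sphere 0 1. norm (f x) \<le> B"
    using compact_imp_bounded[OF compact_continuous_image[OF assms(2) compact_sphere]] by (auto simp: bounded_iff)
  moreover have "f \<in> borel_measurable sphere_measure"
    using measurable_restrict_space1[OF assms(1)] by (simp cong: measurable_cong_sets)
  ultimately show ?thesis by (intro integrable_const_bound[where B = B]) auto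
qed

lemma AE_notin_open_imp_empty:
  fixes W :: "'a::euclidean_space set"
  assumes "open W" "AE x in lborel. x \<notin> W"
  shows "W = {}"
proof (rule ccontr)
  assume "W \<noteq> {}"
  have "W \<in> null_sets lborel" using assms by (subst AE_iff_null_sets) auto
  then have "negligible W" by (simp add: negligible_iff_null_sets null_sets_completionI)
  with open_not_negligible[OF assms(1) \<open>W \<noteq> {}\<close>] show False by simp
qed

text \<open>If f were positive at x, its radial extension would be positive on an open set around x
  / 2 in the unit ball, and a nonempty open set is not null.\<close>

lemma sphere_integral_eq_0:
  fixes f :: "'a::euclidean_space \<Rightarrow> real"
  assumes f[measurable]: "f \<in> borel_measurable borel" and cont: "continuous_on (sphere 0 1) f"
    and nonneg: "\<And>x. x \<in> sphere 0 1 \<Longrightarrow> 0 \<le> f x" and 0: "(\<integral>x. f x \<partial>sphere_measure) = 0"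
    and x: "x \<in> sphere 0 1"
  shows "f x = 0"
proof (rule ccontr)
  assume "f x \<noteq> 0"
  then have pos: "0 < f x" using nonneg[OF x] by simp
  have "(\<integral>\<^sup>+x. ennreal (f x) \<partial>sphere_measure) = 0"
    using nn_integral_eq_integral[OF integrable_sphere_measure[OF f cont]] 0 AE_I2[of sphere_measure "\<lambda>x. 0 \<le> f x"] nonneg
    by simp
  then have "(\<integral>\<^sup>+x. ennreal (f (sgn x)) * indicator (cball 0 1 - {0}) x \<partial>lborel) = 0"
    by (simp add: nn_integral_sphere_measure)
  then have AE: "AE x in lborel. ennreal (f (sgn x)) * indicator (cball 0 1 - {0}) x = 0"
    by (subst (asm) nn_integral_0_iff_AE) auto
  define W where "W = {y \<in> ball 0 1 - {0}. f (sgn y) \<in> {0<..}}"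
  have "continuous_on (ball 0 1 - {0::'a}) (\<lambda>y. f (sgn y))"
    by (rule continuous_on_compose2[OF cont]) (auto intro!: continuous_intros simp: norm_sgn split: if_splits)
  then have "open W"
    unfolding W_def using continuous_open_preimage[of "ball 0 1 - {0}" "\<lambda>y. f (sgn y)" "{0<..}"]
    by (simp add: open_delete vimage_def Int_def Collect_conj_eq[symmetric])
  moreover have "(1 / 2) *\<^sub>R x \<in> W"
    using x pos by (auto simp: W_def sgn_div_norm)
  moreover have "AE y in lborel. y \<notin> W"
    using AE by eventually_elim (auto simp: W_def ennreal_eq_0_iff not_less[symmetric] split: split_indicator_asm)
  ultimately show False using AE_notin_open_imp_empty[of W] by blast
qed

context
  fixes \<Omega> :: "'a::euclidean_space set" and z :: 'a
  assumes \<Omega>: "compact \<Omega>" "z \<in> interior \<Omega>"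
begin

private lemma ne: "\<Omega> \<noteq> {}" using \<Omega>(2) interior_subset by auto

lemma support_fun_pos: "x \<noteq> 0 \<Longrightarrow> 0 < support_fun \<Omega> z x"
  using support_fun_interior_lower[OF \<Omega>] by (metis less_le_trans mult_pos_pos zero_less_norm_iff)

lemma support_fun_nonneg: "0 \<le> support_fun \<Omega> z x"
  using support_fun_interior_lower[OF \<Omega>] by (metis less_imp_le mult_nonneg_nonneg norm_ge_zero order_trans)

lemma support_fun_sgn: "support_fun \<Omega> z y = norm y * support_fun \<Omega> z (sgn y)"
  using support_fun_scaleR[OF \<Omega>(1) ne, of "norm y" z "sgn y"] by (cases "y = 0") (simp_all add: sgn_div_norm)

text \<open>In polar coordinates u y \<le> 1 means that the d-th power of the norm of y is at most 1
  / u(sgn y)^d, where d is the dimension. This is \<open>emeasure_star_body\<close> up to the points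
  with u = 1, which lie on the frontier of a convex set and so form a null set.\<close>

lemma emeasure_support_fun_le_1:
  "of_nat DIM('a) * emeasure lborel {y. support_fun \<Omega> z y \<le> 1} = (\<integral>\<^sup>+x. ennreal (1 / support_fun \<Omega> z x ^ DIM('a)) \<partial>sphere_measure)"
proof -
  let ?u = "support_fun \<Omega> z"
  note [measurable] = measurable_support_fun[OF \<Omega>(1) ne]
  have conv: "convex {y. ?u y \<le> 1}"
  proof -
    have "{y. ?u y \<le> 1} = (\<Inter>w\<in>\<Omega>. {y. (w - z) \<bullet> y \<le> 1})"
      by (auto simp: support_fun_le_iff[OF \<Omega>(1) ne] inner_commute)
    then show ?thesis by (auto intro!: convex_INT convex_halfspace_le)
  qed
  have sub: "{y. ?u y \<le> 1} - {y. ?u y < 1} \<subseteq> frontier {y. ?u y \<le> 1}"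
  proof
    fix y assume "y \<in> {y. ?u y \<le> 1} - {y. ?u y < 1}"
    then have y: "?u y = 1" by auto
    have "y \<notin> interior {y. ?u y \<le> 1}"
    proof
      assume "y \<in> interior {y. ?u y \<le> 1}"
      then obtain e where e: "0 < e" "ball y e \<subseteq> {y. ?u y \<le> 1}" by (auto simp: mem_interior)
      have y0: "y \<noteq> 0" using y support_fun_sgn[of 0] by auto
      \<comment> \<open>A dilation so slight that it keeps y in the ball, although it raises u above
        1.\<close>
      define c where "c = 1 + e / (2 * norm y)"
      have c: "1 < c" using e y0 by (simp add: c_def)
      have "dist y (c *\<^sub>R y) = norm ((c - 1) *\<^sub>R y)" by (simp add: dist_norm scaleR_diff_left norm_minus_commute)
      also have "\<dots> < e" using e y0 by (simp add: c_def)
      finally have "?u (c *\<^sub>R y) \<le> 1" using e by auto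
      then show False using support_fun_scaleR[OF \<Omega>(1) ne, of c z y] c y by simp
    qed
    then show "y \<in> frontier {y. ?u y \<le> 1}"
      using closure_subset[of "{y. ?u y \<le> 1}"] y by (auto simp: frontier_def)
  qed
  have "{y. ?u y \<le> 1} - {y. ?u y < 1} \<in> null_sets lebesgue"
    using negligible_subset[OF negligible_convex_frontier[OF conv] sub] by (simp add: negligible_iff_null_sets)
  then have "emeasure lborel ({y. ?u y \<le> 1} - {y. ?u y < 1}) = 0" by (auto simp: null_sets_def)
  then have "AE y in lborel. y \<notin> {y. ?u y \<le> 1} - {y. ?u y < 1}"
    by (intro AE_not_in) (auto simp: null_sets_def)
  moreover have "AE y in lborel. y \<noteq> (0::'a)" by (rule AE_lborel_singleton)
  ultimately have "AE y in lborel. y \<in> {y. ?u y \<le> 1} \<longleftrightarrow> y \<in> {y. y \<noteq> 0 \<and> ennreal (norm y ^ DIM('a)) < ennreal (1 / ?u (sgn y) ^ DIM('a))}"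
  proof eventually_elim
    case (elim y)
    then have sgn: "0 < ?u (sgn y)" using support_fun_pos[of "sgn y"] by (simp add: sgn_zero_iff)
    have "ennreal (norm y ^ DIM('a)) < ennreal (1 / ?u (sgn y) ^ DIM('a)) \<longleftrightarrow> norm y ^ DIM('a) < 1 / ?u (sgn y) ^ DIM('a)"
      by (rule ennreal_less_iff) simp
    also have "\<dots> \<longleftrightarrow> ?u y ^ DIM('a) < 1"
      unfolding support_fun_sgn[of y] using sgn by (simp add: power_mult_distrib field_simps)
    also have "\<dots> \<longleftrightarrow> ?u y < 1" using support_fun_nonneg[of y] by (simp add: power_less_one_iff)
    finally show ?case using elim by auto
  qed
  then have "emeasure lborel {y. ?u y \<le> 1} = emeasure lborel {y. y \<noteq> 0 \<and> ennreal (norm y ^ DIM('a)) < ennreal (1 / ?u (sgn y) ^ DIM('a))}"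
    by (rule emeasure_eq_AE) measurable
  also have "\<dots> = (\<integral>\<^sup>+x. ennreal (1 / ?u (sgn x) ^ DIM('a)) * indicator (cball 0 1 - {0}) x \<partial>lborel)"
    by (rule emeasure_star_body) measurable
  finally show ?thesis by (subst nn_integral_sphere_measure) auto
qed

lemma continuous_on_support_fun_power: "continuous_on (sphere 0 1) (\<lambda>x. 1 / support_fun \<Omega> z x ^ k)"
proof -
  have "support_fun \<Omega> z x \<noteq> 0" if "x \<in> sphere 0 1" for x
    using support_fun_pos[of x] that by force
  then show ?thesis
    by (intro continuous_on_divide continuous_on_const continuous_on_power continuous_on_support_fun[OF \<Omega>(1) ne]) simp
qed

lemma measurable_support_fun_power: "(\<lambda>x. 1 / support_fun \<Omega> z x ^ k) \<in> borel_measurable borel"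
proof -
  note [measurable] = measurable_support_fun[OF \<Omega>(1) ne]
  show ?thesis by measurable
qed

lemma integrable_support_fun_power: "integrable sphere_measure (\<lambda>x. 1 / support_fun \<Omega> z x ^ k)"
  by (rule integrable_sphere_measure[OF measurable_support_fun_power continuous_on_support_fun_power])

lemma polar_dual_eq_image: "polar_dual \<Omega> z = (\<lambda>y. y + z) ` {y. support_fun \<Omega> z y \<le> 1}"
  by (auto simp: polar_dual_def)

lemma measure_polar_dual_eq: "measure lebesgue (polar_dual \<Omega> z) = measure lborel {y. support_fun \<Omega> z y \<le> 1}"
proof -
  note [measurable] = measurable_support_fun[OF \<Omega>(1) ne]
  have "{y. support_fun \<Omega> z y \<le> 1} \<in> sets borel" by measurable
  then show ?thesis
    using measure_lebesgue_affine[of 1 z "{y. support_fun \<Omega> z y \<le> 1}"]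
    by (simp add: polar_dual_eq_image measure_completion)
qed

lemma measure_polar_dual:
  "real DIM('a) * measure lebesgue (polar_dual \<Omega> z) = (\<integral>x. 1 / support_fun \<Omega> z x ^ DIM('a) \<partial>sphere_measure)"
proof -
  let ?I = "\<integral>x. 1 / support_fun \<Omega> z x ^ DIM('a) \<partial>sphere_measure"
  have "of_nat DIM('a) * emeasure lborel {y. support_fun \<Omega> z y \<le> 1} = ennreal ?I"
    unfolding emeasure_support_fun_le_1
    by (rule nn_integral_eq_integral[OF integrable_support_fun_power]) (simp add: support_fun_nonneg)
  moreover have "0 \<le> ?I" by (intro integral_nonneg_AE AE_I2) (simp add: support_fun_nonneg)
  ultimately have "enn2real (of_nat DIM('a) * emeasure lborel {y. support_fun \<Omega> z y \<le> 1}) = ?I" by simp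
  then show ?thesis
    unfolding measure_polar_dual_eq by (simp add: measure_def enn2real_mult)
qed

lemma emeasure_polar_finite: "emeasure lborel {y. support_fun \<Omega> z y \<le> 1} < \<infinity>"
proof -
  have "of_nat DIM('a) * emeasure lborel {y. support_fun \<Omega> z y \<le> 1} < \<infinity>"
    unfolding emeasure_support_fun_le_1
    by (subst nn_integral_eq_integral[OF integrable_support_fun_power]) (simp_all add: support_fun_nonneg)
  then show ?thesis by (auto simp: ennreal_mult_less_top)
qed

end

section \<open>Volume and centroid of a convex body\<close>

lemma convex_body_emeasure:
  fixes \<Omega> :: "'a::euclidean_space set"
  assumes "convex_body \<Omega>"
  shows "emeasure lborel \<Omega> = ennreal (measure lebesgue \<Omega>)" "0 < measure lebesgue \<Omega>"
proof -
  have \<Omega>: "compact \<Omega>" "interior \<Omega> \<noteq> {}" using assms by (auto simp: convex_body_def)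
  then have borel: "\<Omega> \<in> sets borel" by (simp add: compact_imp_closed borel_closed)
  have "emeasure lborel \<Omega> \<noteq> \<infinity>"
    using emeasure_bounded_finite[OF compact_imp_bounded[OF \<Omega>(1)]] by simp
  then show eq: "emeasure lborel \<Omega> = ennreal (measure lebesgue \<Omega>)"
    using borel by (simp add: emeasure_eq_ennreal_measure measure_completion)
  have "measure lebesgue \<Omega> \<noteq> 0"
  proof
    assume "measure lebesgue \<Omega> = 0"
    then have "\<Omega> \<in> null_sets lborel" using eq borel by (auto simp: null_sets_def)
    then have "AE x in lborel. x \<notin> interior \<Omega>"
      by (rule AE_not_in[THEN eventually_mono]) (use interior_subset in auto)
    then show False using AE_notin_open_imp_empty[OF open_interior] \<Omega> by blast
  qed
  then show "0 < measure lebesgue \<Omega>" by (simp add: zero_less_measure_iff)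
qed

text \<open>A centroid outside the interior could be separated from it by a functional a. Then a .
  (x - c) is nonnegative on the body with integral 0, which would confine the interior to a
  hyperplane.\<close>

lemma convex_body_centroid:
  fixes \<Omega> :: "'a::euclidean_space set"
  assumes "convex_body \<Omega>"
  obtains c where "c \<in> interior \<Omega>" "\<And>a. integrable lborel (\<lambda>x. indicator \<Omega> x *\<^sub>R (a \<bullet> (x - c)))"
    "\<And>a. (\<integral>x. indicator \<Omega> x *\<^sub>R (a \<bullet> (x - c)) \<partial>lborel) = 0"
proof -
  have \<Omega>: "compact \<Omega>" "convex \<Omega>" "interior \<Omega> \<noteq> {}" using assms by (auto simp: convex_body_def)
  then have borel: "\<Omega> \<in> sets borel" by (simp add: compact_imp_closed borel_closed)
  define V where "V = measure lborel \<Omega>"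
  have V: "0 < V" "emeasure lborel \<Omega> \<noteq> \<infinity>"
    using convex_body_emeasure[OF assms] borel by (auto simp: V_def measure_completion)
  have intx: "integrable lborel (\<lambda>x. indicator \<Omega> x *\<^sub>R x)"
    by (rule borel_integrable_compact[OF \<Omega>(1)]) (rule continuous_on_id)
  define c where "c = (1 / V) *\<^sub>R (\<integral>x. indicator \<Omega> x *\<^sub>R x \<partial>lborel)"
  have int: "integrable lborel (\<lambda>x. indicator \<Omega> x *\<^sub>R (a \<bullet> (x - c)))" for a
    by (rule borel_integrable_compact[OF \<Omega>(1)]) (intro continuous_intros)
  have zero: "(\<integral>x. indicator \<Omega> x *\<^sub>R (a \<bullet> (x - c)) \<partial>lborel) = 0" for a
  proof -
    have "(\<integral>x. indicator \<Omega> x *\<^sub>R (a \<bullet> (x - c)) \<partial>lborel) = (\<integral>x. a \<bullet> (indicator \<Omega> x *\<^sub>R x) - (a \<bullet> c) * indicator \<Omega> x \<partial>lborel)"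
      by (intro Bochner_Integration.integral_cong) (auto simp: inner_diff_right split: split_indicator)
    also have "\<dots> = (\<integral>x. a \<bullet> (indicator \<Omega> x *\<^sub>R x) \<partial>lborel) - (\<integral>x. (a \<bullet> c) * indicator \<Omega> x \<partial>lborel)"
    proof (rule Bochner_Integration.integral_diff)
      show "integrable lborel (\<lambda>x. a \<bullet> (indicator \<Omega> x *\<^sub>R x))" by (intro integrable_inner_right intx)
      show "integrable lborel (\<lambda>x. (a \<bullet> c) * indicator \<Omega> x)" using borel V by (simp add: less_top)
    qed
    also have "\<dots> = a \<bullet> (\<integral>x. indicator \<Omega> x *\<^sub>R x \<partial>lborel) - (a \<bullet> c) * V"
      by (subst integral_inner_right) (simp_all add: V_def intx)
    also have "\<dots> = 0" using V by (simp add: c_def)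
    finally show ?thesis .
  qed
  have "c \<in> interior \<Omega>"
  proof (rule ccontr)
    assume "c \<notin> interior \<Omega>"
    then obtain a b where a: "a \<noteq> 0" "a \<bullet> c \<le> b" "\<forall>x\<in>interior \<Omega>. b \<le> a \<bullet> x"
      using separating_hyperplane_sets[of "{c}" "interior \<Omega>"] \<Omega> by (auto simp: convex_interior)
    have "closure (interior \<Omega>) \<subseteq> {x. b \<le> a \<bullet> x}"
      using a by (intro closure_minimal closed_halfspace_ge) auto
    then have ge: "0 \<le> a \<bullet> (x - c)" if "x \<in> \<Omega>" for x
      using that a(2) closure_subset[of \<Omega>] convex_closure_interior[OF \<Omega>(2,3)] by (auto simp: inner_diff_right)
    have "AE x in lborel. indicator \<Omega> x *\<^sub>R (a \<bullet> (x - c)) = 0"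
      using zero[of a] ge by (subst (asm) integral_nonneg_eq_0_iff_AE[OF int]) (auto split: split_indicator)
    then have "AE x in lborel. x \<notin> interior \<Omega> \<inter> {x. a \<bullet> c < a \<bullet> x}"
      by eventually_elim (use interior_subset in \<open>auto simp: inner_diff_right split: split_indicator_asm\<close>)
    then have "interior \<Omega> \<inter> {x. a \<bullet> c < a \<bullet> x} = {}"
      by (intro AE_notin_open_imp_empty open_Int open_interior open_halfspace_gt)
    then have "interior \<Omega> \<subseteq> {x. a \<bullet> x = a \<bullet> c}"
      using a by force
    then have "negligible (interior \<Omega>)" using negligible_hyperplane[of a "a \<bullet> c"] a(1) negligible_subset by blast
    then show False using open_not_negligible[OF open_interior \<Omega>(3)] by simp
  qed
  then show thesis using that int zero by blast
qed

lemma nn_integral_lborel_translate: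
  fixes f :: "'a::euclidean_space \<Rightarrow> ennreal"
  assumes [measurable]: "f \<in> borel_measurable borel"
  shows "(\<integral>\<^sup>+x. f x \<partial>lborel) = (\<integral>\<^sup>+x. f (a + x) \<partial>lborel)"
  by (subst lborel_distr_plus[of a, symmetric]) (simp add: nn_integral_distr)

theorem blaschke_santalo:
  fixes \<Omega> :: "'a::euclidean_space set"
  assumes "convex_body \<Omega>"
  obtains c where "c \<in> interior \<Omega>"
    "measure lebesgue \<Omega> * measure lebesgue (polar_dual \<Omega> c) \<le> (measure lebesgue (cball (0::'a) 1))\<^sup>2"
proof -
  have \<Omega>: "compact \<Omega>" "convex \<Omega>" "interior \<Omega> \<noteq> {}" using assms by (auto simp: convex_body_def)
  obtain c where c: "c \<in> interior \<Omega>" "\<And>a. integrable lborel (\<lambda>x. indicator \<Omega> x *\<^sub>R (a \<bullet> (x - c)))"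
    "\<And>a. (\<integral>x. indicator \<Omega> x *\<^sub>R (a \<bullet> (x - c)) \<partial>lborel) = 0"
    using convex_body_centroid[OF assms] by blast
  have ne: "\<Omega> \<noteq> {}" using c interior_subset by auto
  note [measurable] = measurable_support_fun[OF \<Omega>(1) ne]
  have [measurable]: "\<Omega> \<in> sets borel" using \<Omega> by (simp add: compact_imp_closed borel_closed)
  define K where "K = {x. c + x \<in> \<Omega>}"
  have [measurable]: "K \<in> sets borel" unfolding K_def by measurable
  define L where "L = {y. support_fun \<Omega> c y \<le> 1}"
  have [measurable]: "L \<in> sets borel" unfolding L_def by measurable
  have K_int: "(\<integral>\<^sup>+x. indicator K x * ennreal (x \<bullet> z) \<partial>lborel) = (\<integral>\<^sup>+x. ennreal (indicator \<Omega> x *\<^sub>R (z \<bullet> (x - c))) \<partial>lborel)" for z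
    by (subst (2) nn_integral_lborel_translate[of _ c])
       (auto intro!: nn_integral_cong simp: K_def inner_commute split: split_indicator)
  have "emeasure lborel K * emeasure lborel L \<le> (emeasure lborel (cball (0::'a) 1))\<^sup>2"
  proof (rule blaschke_santalo_centered)
    fix z
    show "(\<integral>\<^sup>+x. indicator K x * ennreal (x \<bullet> z) \<partial>lborel) < \<infinity>"
      unfolding K_int by (rule nn_integral_pos_neg_parts_eq[OF c(2,3)])
    have "(\<integral>\<^sup>+x. indicator K x * ennreal (- (x \<bullet> z)) \<partial>lborel) = (\<integral>\<^sup>+x. ennreal (- (indicator \<Omega> x *\<^sub>R (z \<bullet> (x - c)))) \<partial>lborel)"
      using K_int[of "- z"] by simp
    then show "(\<integral>\<^sup>+x. indicator K x * ennreal (x \<bullet> z) \<partial>lborel) = (\<integral>\<^sup>+x. indicator K x * ennreal (- (x \<bullet> z)) \<partial>lborel)"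
      using nn_integral_pos_neg_parts_eq(2)[OF c(2,3), of z] K_int[of z] by simp
  next
    fix k l assume "k \<in> K" "l \<in> L"
    then show "k \<bullet> l \<le> 1"
      using support_fun_upper[OF \<Omega>(1), of "c + k" l c] by (simp add: K_def L_def inner_commute)
  qed measurable
  moreover have "emeasure lborel K = emeasure lborel \<Omega>"
  proof -
    have "emeasure lborel K = (\<integral>\<^sup>+x. indicator K x \<partial>lborel)" by simp
    also have "\<dots> = (\<integral>\<^sup>+x. indicator \<Omega> (c + x) \<partial>lborel)"
      by (rule nn_integral_cong) (simp add: K_def indicator_def)
    also have "\<dots> = emeasure lborel \<Omega>"
      by (subst nn_integral_lborel_translate[symmetric]) auto
    finally show ?thesis .
  qed
  moreover have "emeasure lborel L = ennreal (measure lebesgue (polar_dual \<Omega> c))"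
    using emeasure_polar_finite[OF \<Omega>(1) c(1)] unfolding measure_polar_dual_eq[OF \<Omega>(1) c(1)] L_def
    by (intro emeasure_eq_ennreal_measure) simp
  moreover have "emeasure lborel (cball (0::'a) 1) = ennreal (measure lebesgue (cball (0::'a) 1))"
    using emeasure_bounded_finite[OF bounded_cball, of "0::'a" 1] by (simp add: emeasure_eq_ennreal_measure measure_completion less_top)
  ultimately have "ennreal (measure lebesgue \<Omega> * measure lebesgue (polar_dual \<Omega> c)) \<le> ennreal ((measure lebesgue (cball (0::'a) 1))\<^sup>2)"
    using convex_body_emeasure[OF assms] by (simp add: ennreal_mult'[symmetric] power2_eq_square)
  then show thesis using c(1) that by (simp add: ennreal_le_iff)
qed

section \<open>The Santalo point\<close>

text \<open>The graph of x^(-n) lies above its tangent at b. For q = a / b this follows from q^(-n)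
  = exp (- n ln q) \<ge> 1 - n ln q and ln q \<le> q - 1, the latter being strict unless q =
  1.\<close>

lemma inverse_power_tangent:
  fixes a b :: real
  assumes "0 < a" "0 < b"
  shows "1 / b ^ n * (1 + real n * (1 - a / b)) \<le> 1 / a ^ n"
    and "a \<noteq> b \<Longrightarrow> 0 < n \<Longrightarrow> 1 / b ^ n * (1 + real n * (1 - a / b)) < 1 / a ^ n"
proof -
  define q where "q = a / b"
  have q: "0 < q" "a = q * b" using assms by (auto simp: q_def)
  have "exp (- (real n * ln q)) = 1 / q ^ n"
    using q by (simp add: exp_minus exp_of_nat_mult inverse_eq_divide)
  then have ge: "1 - real n * ln q \<le> 1 / q ^ n"
    using exp_ge_add_one_self[of "- (real n * ln q)"] by simp
  have an: "1 / a ^ n = 1 / b ^ n * (1 / q ^ n)" using q by (simp add: power_mult_distrib)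
  have "real n * ln q \<le> real n * (q - 1)" using ln_le_minus_one[OF q(1)] by (intro mult_left_mono) auto
  then have "1 + real n * (1 - q) \<le> 1 / q ^ n" using ge by (simp add: algebra_simps)
  then show "1 / b ^ n * (1 + real n * (1 - a / b)) \<le> 1 / a ^ n"
    unfolding an q_def[symmetric] using assms by (intro mult_left_mono) auto
  assume "a \<noteq> b" "0 < n"
  then have "q \<noteq> 1" using assms by (simp add: q_def)
  then have "ln q < q - 1" using ln_le_minus_one[OF q(1)] ln_eq_minus_one[OF q(1)] by linarith
  then have "real n * ln q < real n * (q - 1)" using \<open>0 < n\<close> by (intro mult_strict_left_mono) auto
  then have "1 + real n * (1 - q) < 1 / q ^ n" using ge by (simp add: algebra_simps)
  then show "1 / b ^ n * (1 + real n * (1 - a / b)) < 1 / a ^ n"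
    unfolding an q_def[symmetric] using assms by (intro mult_strict_left_mono) auto
qed

lemma inverse_power_convex:
  fixes a b s t :: real
  assumes ab: "0 < a" "0 < b" and st: "0 \<le> s" "0 \<le> t" "s + t = 1"
  shows "1 / (s * a + t * b) ^ n \<le> s * (1 / a ^ n) + t * (1 / b ^ n)"
    and "a \<noteq> b \<Longrightarrow> 0 < n \<Longrightarrow> 0 < s \<Longrightarrow> 0 < t \<Longrightarrow> 1 / (s * a + t * b) ^ n < s * (1 / a ^ n) + t * (1 / b ^ n)"
proof -
  define m where "m = s * a + t * b"
  have "s = 0 \<Longrightarrow> 0 < t * b" using st ab by simp
  then have m: "0 < m"
    using st ab by (cases "s = 0") (auto simp: m_def intro!: add_pos_nonneg)
  \<comment> \<open>The tangent at the mean m. As an affine function it averages to its value at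
    m.\<close>
  define T where "T x = 1 / m ^ n * (1 + real n * (1 - x / m))" for x
  have "s * T a + t * T b = 1 / m ^ n * ((s + t) * (1 + real n) - real n * (s * a + t * b) / m)"
    using m by (simp add: T_def field_simps)
  also have "\<dots> = 1 / m ^ n" using m st by (simp add: m_def[symmetric])
  finally have T: "s * T a + t * T b = 1 / m ^ n" .
  have le: "T a \<le> 1 / a ^ n" "T b \<le> 1 / b ^ n"
    unfolding T_def using inverse_power_tangent(1) ab m by auto
  show "1 / (s * a + t * b) ^ n \<le> s * (1 / a ^ n) + t * (1 / b ^ n)"
    unfolding m_def[symmetric] T[symmetric] using le st by (intro add_mono mult_left_mono) auto
  assume ne: "a \<noteq> b" "0 < n" "0 < s" "0 < t"
  have "a \<noteq> m"
  proof
    assume "a = m"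
    then have "a * (s + t) = s * a + t * b" using st by (simp add: m_def)
    then show False using ne by (simp add: algebra_simps)
  qed
  then have "T a < 1 / a ^ n" unfolding T_def using inverse_power_tangent(2) ab m ne by auto
  then show "1 / (s * a + t * b) ^ n < s * (1 / a ^ n) + t * (1 / b ^ n)"
    unfolding m_def[symmetric] T[symmetric] using le st ne by (intro add_less_le_mono mult_strict_left_mono mult_left_mono) auto
qed

text \<open>A compact convex set is the intersection of its supporting half spaces; a point outside
  is cut off by a strictly separating hyperplane.\<close>

lemma mem_iff_support_fun:
  fixes \<Omega> :: "'a::euclidean_space set"
  assumes "compact \<Omega>" "convex \<Omega>" "\<Omega> \<noteq> {}"
  shows "w \<in> \<Omega> \<longleftrightarrow> (\<forall>x\<in>sphere 0 1. x \<bullet> (w - z) \<le> support_fun \<Omega> z x)"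
proof
  assume le: "\<forall>x\<in>sphere 0 1. x \<bullet> (w - z) \<le> support_fun \<Omega> z x"
  show "w \<in> \<Omega>"
  proof (rule ccontr)
    assume "w \<notin> \<Omega>"
    then obtain a b where ab: "a \<bullet> w < b" "\<forall>y\<in>\<Omega>. b < a \<bullet> y"
      using separating_hyperplane_closed_point[OF assms(2) compact_imp_closed[OF assms(1)]] by blast
    have "a \<noteq> 0" using ab assms(3) by auto
    then have "- sgn a \<in> sphere 0 1" by (simp add: norm_sgn)
    then have "- sgn a \<bullet> (w - z) \<le> support_fun \<Omega> z (- sgn a)" using le by blast
    also have "support_fun \<Omega> z (- sgn a) \<le> - (b - a \<bullet> z) / norm a"
      unfolding support_fun_le_iff[OF assms(1,3)]
    proof
      fix y assume "y \<in> \<Omega>"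
      then have "b - a \<bullet> z \<le> a \<bullet> (y - z)" using ab by (auto simp: inner_diff_right less_imp_le)
      then show "- sgn a \<bullet> (y - z) \<le> - (b - a \<bullet> z) / norm a"
        using \<open>a \<noteq> 0\<close> by (simp add: sgn_div_norm divide_inverse[symmetric] field_simps)
    qed
    finally have "b - a \<bullet> z \<le> a \<bullet> (w - z)"
      using \<open>a \<noteq> 0\<close> by (simp add: sgn_div_norm field_simps)
    then show False using ab(1) by (simp add: inner_diff_right)
  qed
qed (use support_fun_upper[OF assms(1)] in blast)

text \<open>The base point enters only through a linear term, so the support function is affine in
  it. Convexity of the polar volume thus reduces to that of the inverse power.\<close>

lemma support_fun_convex_combination:
  assumes "compact \<Omega>" "\<Omega> \<noteq> {}" "s + t = 1"
  shows "support_fun \<Omega> (s *\<^sub>R z + t *\<^sub>R w) x = s * support_fun \<Omega> z x + t * support_fun \<Omega> w x"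
proof -
  have tr: "support_fun \<Omega> v x = support_fun \<Omega> 0 x - x \<bullet> v" for v
    using support_fun_translate[OF assms(1,2), of v x 0] by simp
  have "s * support_fun \<Omega> z x + t * support_fun \<Omega> w x = (s + t) * support_fun \<Omega> 0 x - x \<bullet> (s *\<^sub>R z + t *\<^sub>R w)"
    unfolding tr[of z] tr[of w] by (simp add: inner_add_right algebra_simps)
  then show ?thesis
    using assms(3) support_fun_translate[OF assms(1,2), of "s *\<^sub>R z + t *\<^sub>R w" x 0] by simp
qed

lemma integral_linear_combination:
  fixes f g :: "'b \<Rightarrow> real"
  assumes "integrable M f" "integrable M g"
  shows "(\<integral>x. s * f x + t * g x \<partial>M) = s * (\<integral>x. f x \<partial>M) + t * (\<integral>x. g x \<partial>M)"
  using assms by simp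

text \<open>Convexity also supplies the continuity on the open interior that the existence of a
  minimiser rests on.\<close>

lemma convex_on_measure_polar_dual:
  fixes \<Omega> :: "'a::euclidean_space set"
  assumes \<Omega>: "compact \<Omega>" "convex \<Omega>"
  shows "convex_on (interior \<Omega>) (\<lambda>z. measure lebesgue (polar_dual \<Omega> z))"
proof (rule convex_onI)
  fix t :: real and z w :: 'a assume t: "0 < t" "t < 1" and z: "z \<in> interior \<Omega>" and w: "w \<in> interior \<Omega>"
  have ne: "\<Omega> \<noteq> {}" using z interior_subset by auto
  let ?m = "(1 - t) *\<^sub>R z + t *\<^sub>R w"
  have m: "?m \<in> interior \<Omega>" using convexD[OF convex_interior[OF \<Omega>(2)] z w, of "1 - t" t] t by simp
  have "real DIM('a) * measure lebesgue (polar_dual \<Omega> ?m)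
    \<le> (\<integral>x. (1 - t) * (1 / support_fun \<Omega> z x ^ DIM('a)) + t * (1 / support_fun \<Omega> w x ^ DIM('a)) \<partial>sphere_measure)"
    unfolding measure_polar_dual[OF \<Omega>(1) m]
  proof (rule integral_mono)
    show "integrable sphere_measure (\<lambda>x. 1 / support_fun \<Omega> ?m x ^ DIM('a))"
      by (rule integrable_support_fun_power[OF \<Omega>(1) m])
    show "integrable sphere_measure (\<lambda>x. (1 - t) * (1 / support_fun \<Omega> z x ^ DIM('a)) + t * (1 / support_fun \<Omega> w x ^ DIM('a)))"
      by (intro Bochner_Integration.integrable_add integrable_mult_right integrable_support_fun_power[OF \<Omega>(1)] z w)
    fix x :: 'a assume "x \<in> space sphere_measure"
    then have "x \<noteq> 0" by auto
    then show "1 / support_fun \<Omega> ?m x ^ DIM('a) \<le> (1 - t) * (1 / support_fun \<Omega> z x ^ DIM('a)) + t * (1 / support_fun \<Omega> w x ^ DIM('a))"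
      unfolding support_fun_convex_combination[OF \<Omega>(1) ne diff_add_cancel]
      using t by (intro inverse_power_convex(1) support_fun_pos \<Omega> z w) auto
  qed
  also have "\<dots> = (1 - t) * (\<integral>x. 1 / support_fun \<Omega> z x ^ DIM('a) \<partial>sphere_measure) + t * (\<integral>x. 1 / support_fun \<Omega> w x ^ DIM('a) \<partial>sphere_measure)"
    by (intro integral_linear_combination integrable_support_fun_power[OF \<Omega>(1)] z w)
  also have "\<dots> = real DIM('a) * ((1 - t) * measure lebesgue (polar_dual \<Omega> z) + t * measure lebesgue (polar_dual \<Omega> w))"
    unfolding measure_polar_dual[OF \<Omega>(1) z, symmetric] measure_polar_dual[OF \<Omega>(1) w, symmetric] by (simp add: algebra_simps)
  finally show "measure lebesgue (polar_dual \<Omega> ?m) \<le> (1 - t) * measure lebesgue (polar_dual \<Omega> z) + t * measure lebesgue (polar_dual \<Omega> w)"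
    by (simp add: mult_le_cancel_left_pos)
qed (rule convex_interior[OF \<Omega>(2)])

text \<open>At the midpoint of two minimisers the convexity inequality, integrated over the sphere,
  is an equality. By continuity it is then an equality in every direction, against strict convexity
  in the direction z - w.\<close>

lemma measure_polar_dual_minimizer_unique:
  fixes \<Omega> :: "'a::euclidean_space set"
  assumes \<Omega>: "compact \<Omega>" "convex \<Omega>" and z: "z \<in> interior \<Omega>" and w: "w \<in> interior \<Omega>"
    and min_z: "\<And>v. v \<in> interior \<Omega> \<Longrightarrow> measure lebesgue (polar_dual \<Omega> z) \<le> measure lebesgue (polar_dual \<Omega> v)"
    and min_w: "\<And>v. v \<in> interior \<Omega> \<Longrightarrow> measure lebesgue (polar_dual \<Omega> w) \<le> measure lebesgue (polar_dual \<Omega> v)"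
  shows "z = w"
proof (rule ccontr)
  assume "z \<noteq> w"
  have ne: "\<Omega> \<noteq> {}" using z interior_subset by auto
  define m where "m = (1 / 2) *\<^sub>R z + (1 / 2) *\<^sub>R w"
  have m: "m \<in> interior \<Omega>" unfolding m_def by (rule convexD[OF convex_interior[OF \<Omega>(2)] z w]) auto
  let ?f = "\<lambda>v x. 1 / support_fun \<Omega> v x ^ DIM('a)"
  define D where "D x = (1 / 2 * ?f z x + 1 / 2 * ?f w x) - ?f m x" for x
  have m_eq: "support_fun \<Omega> m x = 1 / 2 * support_fun \<Omega> z x + 1 / 2 * support_fun \<Omega> w x" for x
    unfolding m_def by (rule support_fun_convex_combination[OF \<Omega>(1) ne]) simp
  have int: "integrable sphere_measure (?f v)" if "v \<in> interior \<Omega>" for v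
    by (rule integrable_support_fun_power[OF \<Omega>(1) that])
  have nonneg: "0 \<le> D x" if "x \<in> sphere 0 1" for x
  proof -
    have "x \<noteq> 0" using that by auto
    then have "?f m x \<le> 1 / 2 * ?f z x + 1 / 2 * ?f w x"
      unfolding m_eq by (intro inverse_power_convex(1) support_fun_pos \<Omega> z w) auto
    then show ?thesis by (simp add: D_def)
  qed
  have "(\<integral>x. D x \<partial>sphere_measure) = (1 / 2 * (\<integral>x. ?f z x \<partial>sphere_measure) + 1 / 2 * (\<integral>x. ?f w x \<partial>sphere_measure)) - (\<integral>x. ?f m x \<partial>sphere_measure)"
    unfolding D_def integral_linear_combination[OF int[OF z] int[OF w], symmetric]
    by (intro Bochner_Integration.integral_diff Bochner_Integration.integrable_add integrable_mult_right int z w m)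
  also have "\<dots> = real DIM('a) * ((measure lebesgue (polar_dual \<Omega> z) + measure lebesgue (polar_dual \<Omega> w)) / 2 - measure lebesgue (polar_dual \<Omega> m))"
    unfolding measure_polar_dual[OF \<Omega>(1) z, symmetric] measure_polar_dual[OF \<Omega>(1) w, symmetric] measure_polar_dual[OF \<Omega>(1) m, symmetric]
    by (simp add: algebra_simps)
  also have "\<dots> \<le> 0"
    using min_z[OF m] min_w[OF m] by (intro mult_nonneg_nonpos) auto
  finally have "(\<integral>x. D x \<partial>sphere_measure) \<le> 0" .
  moreover have "0 \<le> (\<integral>x. D x \<partial>sphere_measure)" using nonneg by (intro integral_nonneg_AE AE_I2) simp
  ultimately have D0: "(\<integral>x. D x \<partial>sphere_measure) = 0" by simp
  have [measurable]: "?f v \<in> borel_measurable borel" if "v \<in> interior \<Omega>" for v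
    by (rule measurable_support_fun_power[OF \<Omega>(1) that])
  \<comment> \<open>In this direction the two support functions differ by the distance of z and
    w.\<close>
  have "D (sgn (z - w)) = 0"
  proof (rule sphere_integral_eq_0[OF _ _ nonneg D0])
    show "D \<in> borel_measurable borel" unfolding D_def[abs_def] using z w m by measurable
    show "continuous_on (sphere 0 1) D"
      unfolding D_def[abs_def]
      by (intro continuous_on_diff continuous_on_add continuous_on_mult_left continuous_on_support_fun_power[OF \<Omega>(1)] z w m)
    show "sgn (z - w) \<in> sphere 0 1" using \<open>z \<noteq> w\<close> by (simp add: norm_sgn)
  qed
  moreover have "support_fun \<Omega> z (sgn (z - w)) \<noteq> support_fun \<Omega> w (sgn (z - w))"
    using \<open>z \<noteq> w\<close> support_fun_translate[OF \<Omega>(1) ne, of z "sgn (z - w)" w] by (simp add: sgn_div_norm)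
  then have "?f m (sgn (z - w)) < 1 / 2 * ?f z (sgn (z - w)) + 1 / 2 * ?f w (sgn (z - w))"
    unfolding m_eq using \<open>z \<noteq> w\<close> by (intro inverse_power_convex(2) support_fun_pos \<Omega> z w) (auto simp: sgn_zero_iff)
  ultimately show False by (simp add: D_def)
qed

text \<open>
  The polar body contains \<open>N\<close> disjoint balls along the direction in which the support function is small.
\<close>

lemma measure_polar_dual_lower:
  fixes \<Omega> :: "'a::euclidean_space set"
  assumes \<Omega>: "compact \<Omega>" and z: "z \<in> interior \<Omega>" and D: "0 < D" "\<Omega> \<subseteq> cball z D"
    and x: "norm x = 1" and small: "2 * real N * support_fun \<Omega> z x \<le> D"
  shows "real N * measure lborel (ball (0::'a) (1 / (2 * D))) \<le> measure lebesgue (polar_dual \<Omega> z)"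
proof -
  have ne: "\<Omega> \<noteq> {}" using z interior_subset by auto
  note [measurable] = measurable_support_fun[OF \<Omega> ne]
  define L where "L = {y. support_fun \<Omega> z y \<le> 1}"
  have [measurable]: "L \<in> sets borel" unfolding L_def by measurable
  \<comment> \<open>The spacing 1 / D is twice the radius, which makes the balls disjoint. On each
    of them u is at most (N / D) u(x) + 1 / 2, and the hypothesis \<open>small\<close> bounds the
    first summand by 1 / 2.\<close>
  define B where "B k = ball ((real k / D) *\<^sub>R x) (1 / (2 * D))" for k
  have "B k \<subseteq> L" if "k < N" for k
  proof
    fix y assume "y \<in> B k"
    then have b: "norm (y - (real k / D) *\<^sub>R x) \<le> 1 / (2 * D)" by (simp add: B_def dist_norm norm_minus_commute)
    have "y \<bullet> (w - z) \<le> 1" if w: "w \<in> \<Omega>" for w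
    proof -
      have "y \<bullet> (w - z) = (real k / D) * (x \<bullet> (w - z)) + (y - (real k / D) *\<^sub>R x) \<bullet> (w - z)"
        by (simp add: inner_diff_left)
      also have "\<dots> \<le> (real k / D) * support_fun \<Omega> z x + norm (y - (real k / D) *\<^sub>R x) * norm (w - z)"
        using D by (intro add_mono mult_left_mono support_fun_upper \<Omega> w norm_cauchy_schwarz) auto
      also have "\<dots> \<le> (real N / D) * support_fun \<Omega> z x + 1 / (2 * D) * D"
        using D b w \<open>k < N\<close> by (intro add_mono mult_mono divide_right_mono support_fun_nonneg \<Omega> z)
          (auto simp: dist_norm norm_minus_commute)
      also have "\<dots> \<le> 1" using small D by (simp add: field_simps)
      finally show ?thesis .
    qed
    then show "y \<in> L" by (simp add: L_def support_fun_le_iff[OF \<Omega> ne])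
  qed
  then have "(\<Union>k\<in>{..<N}. B k) \<subseteq> L" by auto
  moreover have disj: "disjoint_family_on B {..<N}"
    unfolding disjoint_family_on_def
  proof (intro ballI impI)
    fix k l :: nat assume "k \<noteq> l"
    show "B k \<inter> B l = {}"
    proof (rule ccontr)
      assume "B k \<inter> B l \<noteq> {}"
      then obtain y where "dist ((real k / D) *\<^sub>R x) y < 1 / (2 * D)" "dist ((real l / D) *\<^sub>R x) y < 1 / (2 * D)"
        by (auto simp: B_def)
      then have "dist ((real k / D) *\<^sub>R x) ((real l / D) *\<^sub>R x) < 1 / (2 * D) + 1 / (2 * D)"
        using dist_triangle2[of "(real k / D) *\<^sub>R x" "(real l / D) *\<^sub>R x" y] by linarith
      also have "\<dots> = 1 / D" by (simp add: field_simps)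
      finally have "\<bar>real k / D - real l / D\<bar> < 1 / D"
        by (simp add: dist_norm scaleR_diff_left[symmetric] x)
      then have "\<bar>real k - real l\<bar> < 1" using D by (simp add: diff_divide_distrib[symmetric] abs_divide field_simps)
      then show False using \<open>k \<noteq> l\<close> by linarith
    qed
  qed
  have "ennreal (real N * measure lborel (ball (0::'a) (1 / (2 * D)))) = (\<Sum>k<N. emeasure lborel (B k))"
  proof -
    have "emeasure lborel (B k) = ennreal (measure lborel (ball (0::'a) (1 / (2 * D))))" for k
      unfolding B_def using D by (simp add: emeasure_ball content_ball)
    then show ?thesis by (simp add: ennreal_mult' ennreal_of_nat_eq_real_of_nat)
  qed
  also have "\<dots> = emeasure lborel (\<Union>k\<in>{..<N}. B k)"
    by (rule sum_emeasure[OF _ disj]) (auto simp: B_def)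
  also have "\<dots> \<le> emeasure lborel L" by (rule emeasure_mono) (use \<open>(\<Union>k\<in>{..<N}. B k) \<subseteq> L\<close> in auto)
  also have "\<dots> = ennreal (measure lebesgue (polar_dual \<Omega> z))"
    using emeasure_polar_finite[OF \<Omega> z] unfolding measure_polar_dual_eq[OF \<Omega> z] L_def
    by (intro emeasure_eq_ennreal_measure) simp
  finally show ?thesis by (simp add: ennreal_le_iff)
qed

text \<open>The polar volume is large where some value of the support function is small, that is,
  near the boundary. So the minimum over the compact set K of points with u \<ge> \<delta> on the
  sphere is a minimum over the whole interior.\<close>

lemma measure_polar_dual_minimizer_exists:
  fixes \<Omega> :: "'a::euclidean_space set"
  assumes "convex_body \<Omega>"
  obtains z where "z \<in> interior \<Omega>" "\<And>w. w \<in> interior \<Omega> \<Longrightarrow> measure lebesgue (polar_dual \<Omega> z) \<le> measure lebesgue (polar_dual \<Omega> w)"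
proof -
  have \<Omega>: "compact \<Omega>" "convex \<Omega>" "interior \<Omega> \<noteq> {}" using assms by (auto simp: convex_body_def)
  have ne: "\<Omega> \<noteq> {}" using \<Omega> interior_subset by auto
  let ?F = "\<lambda>z. measure lebesgue (polar_dual \<Omega> z)"
  obtain c where c: "c \<in> interior \<Omega>" using \<Omega> by auto
  \<comment> \<open>The added 1 makes D positive at once. The same D serves for all base points in
    \<Omega>.\<close>
  define D where "D = diameter \<Omega> + 1"
  have bdd: "bounded \<Omega>" using \<Omega>(1) by (rule compact_imp_bounded)
  have D: "0 < D" using diameter_ge_0[OF bdd] by (simp add: D_def)
  have sub: "\<Omega> \<subseteq> cball z D" if "z \<in> \<Omega>" for z
    using diameter_bounded_bound[OF bdd that] by (force simp: D_def)
  define \<beta> where "\<beta> = measure lborel (ball (0::'a) (1 / (2 * D)))"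
  have \<beta>: "0 < \<beta>" using D by (simp add: \<beta>_def)
  obtain N where N: "?F c / \<beta> < real N" using reals_Archimedean2 by blast
  have "0 \<le> ?F c / \<beta>" using \<beta> by simp
  then have N0: "0 < real N" using N by linarith
  \<comment> \<open>If u(x) \<le> \<delta> for a unit vector x, then N disjoint balls fit into the
    polar body, and N was chosen so that they exceed the polar volume at c.\<close>
  define \<delta> where "\<delta> = D / (2 * real N)"
  have \<delta>: "0 < \<delta>" using D N0 by (simp add: \<delta>_def)
  have large: "?F c < ?F z" if z: "z \<in> interior \<Omega>" and x: "norm x = 1" "support_fun \<Omega> z x \<le> \<delta>" for z x
  proof -
    have "real N * \<beta> \<le> ?F z"
      unfolding \<beta>_def
    proof (rule measure_polar_dual_lower[OF \<Omega>(1) z D sub x(1)])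
      show "z \<in> \<Omega>" using z interior_subset by auto
      show "2 * real N * support_fun \<Omega> z x \<le> D" using x(2) N0 by (simp add: \<delta>_def field_simps)
    qed
    moreover have "?F c < real N * \<beta>" using N \<beta> by (simp add: field_simps)
    ultimately show ?thesis by simp
  qed
  define K where "K = {z \<in> \<Omega>. \<forall>x\<in>sphere 0 1. \<delta> \<le> support_fun \<Omega> z x}"
  have tr: "support_fun \<Omega> z x = support_fun \<Omega> 0 x - x \<bullet> z" for z x
    using support_fun_translate[OF \<Omega>(1) ne, of z x 0] by simp
  have "K = \<Omega> \<inter> (\<Inter>x\<in>sphere 0 1. {z. x \<bullet> z \<le> support_fun \<Omega> 0 x - \<delta>})"
    unfolding K_def by (subst tr) (auto simp: algebra_simps)
  moreover have "closed (\<Inter>x\<in>sphere 0 1. {z. x \<bullet> z \<le> support_fun \<Omega> 0 x - \<delta>})"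
    by (intro closed_INT ballI closed_halfspace_le)
  ultimately have "compact K" using \<Omega>(1) compact_Int_closed by auto
  have "K \<subseteq> interior \<Omega>"
  proof
    fix z assume z: "z \<in> K"
    \<comment> \<open>Values of at least \<delta> on the sphere mean that all supporting hyperplanes
      have distance at least \<delta> from z.\<close>
    have "ball z \<delta> \<subseteq> \<Omega>"
    proof
      fix w assume "w \<in> ball z \<delta>"
      then have w: "norm (w - z) < \<delta>" by (simp add: dist_norm norm_minus_commute)
      show "w \<in> \<Omega>"
        unfolding mem_iff_support_fun[OF \<Omega>(1,2) ne, of w z]
      proof
        fix x :: 'a assume "x \<in> sphere 0 1"
        then have "x \<bullet> (w - z) \<le> norm (w - z)" "\<delta> \<le> support_fun \<Omega> z x"
          using norm_cauchy_schwarz[of x "w - z"] z by (auto simp: K_def)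
        then show "x \<bullet> (w - z) \<le> support_fun \<Omega> z x" using w by linarith
      qed
    qed
    then show "z \<in> interior \<Omega>" using \<delta> by (auto simp: mem_interior)
  qed
  moreover have "continuous_on (interior \<Omega>) ?F"
    by (intro convex_on_continuous open_interior convex_on_measure_polar_dual \<Omega>)
  ultimately have "continuous_on K ?F" by (rule continuous_on_subset[rotated])
  have "\<delta> \<le> support_fun \<Omega> c x" if "norm x = 1" for x
    using large[OF c that] by force
  then have "c \<in> K" using c interior_subset unfolding K_def by auto
  obtain z where z: "z \<in> K" "\<forall>w\<in>K. ?F z \<le> ?F w"
    using continuous_attains_inf[OF \<open>compact K\<close> _ \<open>continuous_on K ?F\<close>] \<open>c \<in> K\<close> by blast
  have "?F z \<le> ?F w" if w: "w \<in> interior \<Omega>" for w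
  proof (cases "w \<in> K")
    case False
    then obtain x where "x \<in> sphere 0 1" "support_fun \<Omega> w x < \<delta>"
      using w interior_subset by (auto simp: K_def not_le)
    then have "?F c < ?F w" using large[OF w, of x] by simp
    then show ?thesis using z(2) \<open>c \<in> K\<close> by force
  qed (use z in blast)
  then show thesis using that z \<open>K \<subseteq> interior \<Omega>\<close> by blast
qed

lemma santalo_point:
  assumes "convex_body \<Omega>"
  shows "santalo_point \<Omega> \<in> interior \<Omega>"
    and "\<And>w. w \<in> interior \<Omega> \<Longrightarrow> measure lebesgue (polar_dual \<Omega> (santalo_point \<Omega>)) \<le> measure lebesgue (polar_dual \<Omega> w)"
proof -
  let ?P = "\<lambda>z. z \<in> interior \<Omega> \<and> (\<forall>w\<in>interior \<Omega>. measure lebesgue (polar_dual \<Omega> z) \<le> measure lebesgue (polar_dual \<Omega> w))"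
  have \<Omega>: "compact \<Omega>" "convex \<Omega>" using assms by (auto simp: convex_body_def)
  obtain z where z: "z \<in> interior \<Omega>" "\<And>w. w \<in> interior \<Omega> \<Longrightarrow> measure lebesgue (polar_dual \<Omega> z) \<le> measure lebesgue (polar_dual \<Omega> w)"
    using measure_polar_dual_minimizer_exists[OF assms] by metis
  then have "?P z" by simp
  moreover have "w = z" if "?P w" for w
    by (rule measure_polar_dual_minimizer_unique[OF \<Omega>]) (use that z in simp_all)
  ultimately have P: "?P (santalo_point \<Omega>)" unfolding santalo_point_def by (rule theI)
  then show "santalo_point \<Omega> \<in> interior \<Omega>" by simp
  fix w assume "w \<in> interior \<Omega>"
  with P show "measure lebesgue (polar_dual \<Omega> (santalo_point \<Omega>)) \<le> measure lebesgue (polar_dual \<Omega> w)" by simp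
qed

section \<open>Entropy\<close>

lemma integrable_ln_support_fun:
  fixes \<Omega> :: "'a::euclidean_space set"
  assumes "compact \<Omega>" "\<Omega> \<noteq> {}" and pos: "\<And>x. x \<in> sphere 0 1 \<Longrightarrow> 0 < support_fun \<Omega> z x"
  shows "integrable sphere_measure (\<lambda>x. ln (support_fun \<Omega> z x))"
    and "continuous_on (sphere 0 1) (\<lambda>x. ln (support_fun \<Omega> z x))"
    and "(\<lambda>x. ln (support_fun \<Omega> z x)) \<in> borel_measurable borel"
proof -
  note [measurable] = measurable_support_fun[OF assms(1,2)]
  show meas: "(\<lambda>x. ln (support_fun \<Omega> z x)) \<in> borel_measurable borel" by measurable
  show cont: "continuous_on (sphere 0 1) (\<lambda>x. ln (support_fun \<Omega> z x))"
    by (rule continuous_on_ln[OF continuous_on_support_fun[OF assms(1,2)]]) (use pos in force)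
  show "integrable sphere_measure (\<lambda>x. ln (support_fun \<Omega> z x))"
    by (rule integrable_sphere_measure[OF meas cont])
qed

lemma integral_sphere_measure_const:
  "(\<integral>x. c \<partial>(sphere_measure :: 'a::euclidean_space measure)) = c * sphere_area TYPE('a)"
  by (simp add: sphere_area_def mult.commute)

text \<open>A real supremum dominates its values only when these are bounded above; here ln of the
  diameter is a bound.\<close>

lemma mean_log_support_le_entropy:
  fixes \<Omega> :: "'a::euclidean_space set"
  assumes \<Omega>: "compact \<Omega>" and z: "z \<in> interior \<Omega>"
  shows "mean_log_support \<Omega> z \<le> entropy \<Omega>"
proof -
  let ?A = "{z0\<in>\<Omega>. \<forall>x\<in>sphere 0 1. support_fun \<Omega> z0 x > 0}"
  have ne: "\<Omega> \<noteq> {}" using z interior_subset by auto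
  define D where "D = diameter \<Omega>"
  have bdd: "bounded \<Omega>" using \<Omega> by (rule compact_imp_bounded)
  have le: "mean_log_support \<Omega> z0 \<le> ln D" if z0: "z0 \<in> ?A" for z0
  proof -
    have "\<Omega> \<subseteq> cball z0 D" using diameter_bounded_bound[OF bdd] z0 by (auto simp: D_def)
    then have u_le: "support_fun \<Omega> z0 x \<le> D" if "norm x = 1" for x
      using support_fun_cball_upper[OF \<Omega> ne, of z0 D x] that by simp
    have pos: "0 < support_fun \<Omega> z0 x" if "x \<in> sphere 0 1" for x using z0 that by auto
    have "(\<integral>x. ln (support_fun \<Omega> z0 x) \<partial>sphere_measure) \<le> (\<integral>x. ln D \<partial>(sphere_measure :: 'a measure))"
    proof (rule integral_mono)
      show "integrable (sphere_measure :: 'a measure) (\<lambda>x. ln D)"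
        by (rule integrable_sphere_measure) (auto intro: continuous_on_const)
      fix x :: 'a assume "x \<in> space sphere_measure"
      then show "ln (support_fun \<Omega> z0 x) \<le> ln D" using u_le[of x] pos[of x] by (intro ln_mono) auto
    qed (rule integrable_ln_support_fun(1)[OF \<Omega> ne pos])
    also have "\<dots> = ln D * sphere_area TYPE('a)" by (rule integral_sphere_measure_const)
    finally show ?thesis
      using sphere_area_pos[where 'a = 'a] by (simp add: mean_log_support_def field_simps)
  qed
  have "z \<in> \<Omega>" using z interior_subset by blast
  moreover have "0 < support_fun \<Omega> z x" if "x \<in> sphere 0 1" for x
    using support_fun_pos[OF \<Omega> z, of x] that by force
  ultimately have "z \<in> ?A" by blast
  moreover have "bdd_above (mean_log_support \<Omega> ` ?A)" using le by (rule bdd_above.I2)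
  ultimately show ?thesis unfolding entropy_def by (rule cSUP_upper)
qed

text \<open>
  Jensen's inequality for \<open>ln\<close> applied to \<open>u\<^sup>-\<^sup>(\<^sup>n\<^sup>+\<^sup>1\<^sup>)\<close>, whose mean over the sphere is the normalised volume of the polar body.
\<close>

lemma mean_log_support_jensen:
  fixes \<Omega> :: "'a::euclidean_space set"
  assumes \<Omega>: "compact \<Omega>" and z: "z \<in> interior \<Omega>"
  defines "m \<equiv> measure lebesgue (polar_dual \<Omega> z) / measure lborel (cball (0::'a) 1)"
  shows "0 < m" "- ln m / real DIM('a) \<le> mean_log_support \<Omega> z"
    and "mean_log_support \<Omega> z = - ln m / real DIM('a) \<Longrightarrow> \<exists>r>0. \<forall>x\<in>sphere 0 1. support_fun \<Omega> z x = r"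
proof -
  have ne: "\<Omega> \<noteq> {}" using z interior_subset by auto
  let ?d = "real DIM('a)"
  let ?A = "sphere_area TYPE('a)"
  let ?u = "support_fun \<Omega> z"
  let ?w = "\<lambda>x. 1 / ?u x ^ DIM('a)"
  have A: "0 < ?A" by (rule sphere_area_pos)
  have pos: "0 < ?u x" if "x \<in> sphere 0 1" for x
    using that by (intro support_fun_pos[OF \<Omega> z]) auto
  note ln_u = integrable_ln_support_fun[OF \<Omega> ne pos]
  have wint: "integrable sphere_measure ?w" by (rule integrable_support_fun_power[OF \<Omega> z])
  have wI: "(\<integral>x. ?w x \<partial>sphere_measure) = m * ?A"
    unfolding measure_polar_dual[OF \<Omega> z, symmetric] sphere_area_eq m_def
    using measure_cball_pos[of 1 "0::'a"] by simp
  have "(\<integral>x. ?w x \<partial>sphere_measure) \<noteq> 0"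
  proof
    assume 0: "(\<integral>x. ?w x \<partial>sphere_measure) = 0"
    obtain b :: 'a where b: "b \<in> Basis" using nonempty_Basis by blast
    then have "b \<in> sphere 0 1" by simp
    then have "?w b = 0"
      by (intro sphere_integral_eq_0[OF measurable_support_fun_power[OF \<Omega> z] continuous_on_support_fun_power[OF \<Omega> z] _ 0])
         (auto simp: support_fun_nonneg[OF \<Omega> z])
    then show False using pos[OF \<open>b \<in> sphere 0 1\<close>] by simp
  qed
  moreover have "0 \<le> (\<integral>x. ?w x \<partial>sphere_measure)"
    by (intro integral_nonneg_AE AE_I2) (simp add: support_fun_nonneg[OF \<Omega> z])
  ultimately have "0 < m * ?A" unfolding wI by linarith
  then show m: "0 < m" using A by (rule zero_less_mult_pos2)
  \<comment> \<open>On the sphere this is y - 1 - ln y \<ge> 0 for y = u^(-d) / m, written so that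
    it can be integrated term by term. As y has mean 1, the integral is the area times ln m + d
    times the mean of ln u, so the inequality and its equality case both come from G.\<close>
  define G where "G x = (1 / m) * ?w x + ?d * ln (?u x) + (ln m - 1)" for x
  have G_eq: "G x = ?w x / m - 1 - ln (?w x / m)" if "x \<in> sphere 0 1" for x
    using pos[OF that] m by (simp add: G_def ln_div ln_mult ln_realpow mult.commute[of m])
  have wm: "0 < ?w x / m" if "x \<in> sphere 0 1" for x using pos[OF that] m by simp
  have G_nonneg: "0 \<le> G x" if "x \<in> sphere 0 1" for x
    unfolding G_eq[OF that] using ln_le_minus_one[OF wm[OF that]] by simp
  have mean: "(\<integral>x. ln (?u x) \<partial>sphere_measure) = ?A * mean_log_support \<Omega> z"
    using A by (simp add: mean_log_support_def)
  have "(\<integral>x. G x \<partial>sphere_measure) = (\<integral>x. (1 / m) * ?w x + ?d * ln (?u x) \<partial>sphere_measure) + (\<integral>x. ln m - 1 \<partial>(sphere_measure :: 'a measure))"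
    unfolding G_def
    by (intro Bochner_Integration.integral_add Bochner_Integration.integrable_add integrable_mult_right wint ln_u(1)
         integrable_sphere_measure continuous_on_const borel_measurable_const)
  also have "(\<integral>x. (1 / m) * ?w x + ?d * ln (?u x) \<partial>sphere_measure) = (1 / m) * (\<integral>x. ?w x \<partial>sphere_measure) + ?d * (\<integral>x. ln (?u x) \<partial>sphere_measure)"
    by (rule integral_linear_combination[OF wint ln_u(1)])
  also have "\<dots> + (\<integral>x. ln m - 1 \<partial>(sphere_measure :: 'a measure)) = ?A * (ln m + ?d * mean_log_support \<Omega> z)"
    unfolding wI mean integral_sphere_measure_const using m by (simp add: algebra_simps)
  finally have G_int: "(\<integral>x. G x \<partial>sphere_measure) = ?A * (ln m + ?d * mean_log_support \<Omega> z)" .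
  have "0 \<le> (\<integral>x. G x \<partial>sphere_measure)" using G_nonneg by (intro integral_nonneg_AE AE_I2) simp
  then have "0 \<le> ln m + ?d * mean_log_support \<Omega> z" unfolding G_int using A by (simp add: zero_le_mult_iff)
  then show "- ln m / ?d \<le> mean_log_support \<Omega> z" by (simp add: field_simps)
  assume "mean_log_support \<Omega> z = - ln m / ?d"
  then have G0: "(\<integral>x. G x \<partial>sphere_measure) = 0" unfolding G_int by simp
  \<comment> \<open>G = 0 means u^(-d) = m, which determines u.\<close>
  define r where "r = root DIM('a) (1 / m)"
  have r: "0 < r" using m by (simp add: r_def)
  have "?u x = r" if x: "x \<in> sphere 0 1" for x
  proof -
    have "G x = 0"
    proof (rule sphere_integral_eq_0[OF _ _ G_nonneg G0 x])
      note [measurable] = measurable_support_fun_power[OF \<Omega> z, of "DIM('a)"] ln_u(3)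
      show "G \<in> borel_measurable borel" unfolding G_def[abs_def] by measurable
      show "continuous_on (sphere 0 1) G"
        unfolding G_def[abs_def]
        by (intro continuous_on_add continuous_on_mult_left continuous_on_const continuous_on_support_fun_power[OF \<Omega> z] ln_u(2))
    qed
    then have "?w x / m = 1" using ln_eq_minus_one[OF wm[OF x]] unfolding G_eq[OF x] by simp
    then have "?u x ^ DIM('a) = 1 / m" using pos[OF x] m by (simp add: field_simps)
    then show "?u x = r"
      unfolding r_def using pos[OF x] by (metis DIM_positive less_imp_le real_root_power_cancel)
  qed
  then show "\<exists>r>0. \<forall>x\<in>sphere 0 1. ?u x = r" using r by blast
qed

lemma support_fun_const_imp_ball:
  fixes \<Omega> :: "'a::euclidean_space set"
  assumes "compact \<Omega>" "convex \<Omega>" "\<Omega> \<noteq> {}" and r: "0 < r" "\<And>x. x \<in> sphere 0 1 \<Longrightarrow> support_fun \<Omega> z x = r"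
  shows "\<Omega> = cball z r"
proof (intro set_eqI)
  fix w
  have "w \<in> \<Omega> \<longleftrightarrow> (\<forall>x\<in>sphere 0 1. x \<bullet> (w - z) \<le> r)"
    unfolding mem_iff_support_fun[OF assms(1-3), of w z] using r(2) by auto
  also have "\<dots> \<longleftrightarrow> norm (w - z) \<le> r"
  proof
    assume le: "\<forall>x\<in>sphere 0 1. x \<bullet> (w - z) \<le> r"
    show "norm (w - z) \<le> r"
    proof (cases "w = z")
      case False
      then have "sgn (w - z) \<in> sphere 0 1" by (simp add: norm_sgn)
      then have "sgn (w - z) \<bullet> (w - z) \<le> r" using le by blast
      then show ?thesis using False by (simp add: sgn_div_norm dot_square_norm power2_eq_square mult.assoc[symmetric])
    qed (use r in simp)
  next
    assume le: "norm (w - z) \<le> r"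
    show "\<forall>x\<in>sphere 0 1. x \<bullet> (w - z) \<le> r"
    proof
      fix x :: 'a assume "x \<in> sphere 0 1"
      then show "x \<bullet> (w - z) \<le> r" using norm_cauchy_schwarz[of x "w - z"] le by simp
    qed
  qed
  finally show "w \<in> \<Omega> \<longleftrightarrow> w \<in> cball z r" by (simp add: dist_norm norm_minus_commute)
qed

lemma mean_log_support_unit_ball: "mean_log_support (cball z 1) (z::'a::euclidean_space) = 0"
proof -
  have "support_fun (cball z 1) z x = 1" if "x \<in> space sphere_measure" for x
  proof (rule antisym)
    have x: "norm x = 1" using that by simp
    show "support_fun (cball z 1) z x \<le> 1"
      using support_fun_cball_upper[of "cball z 1" z 1 x] x by simp
    have "z + x \<in> cball z 1" using x by (simp add: dist_norm)
    from support_fun_upper[OF compact_cball this, of x z] show "1 \<le> support_fun (cball z 1) z x"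
      using x by (simp add: dot_square_norm)
  qed
  then have "(\<integral>x. ln (support_fun (cball z 1) z x) \<partial>sphere_measure) = (\<integral>x. 0 \<partial>(sphere_measure :: 'a measure))"
    by (intro Bochner_Integration.integral_cong) simp_all
  then show ?thesis by (simp add: mean_log_support_def)
qed

theorem proposition2p1:
  fixes \<Omega> :: "'a::euclidean_space set"
  assumes "convex_body \<Omega>"
  shows
    "(measure lebesgue \<Omega> = measure lebesgue (cball (0::'a) 1) \<longrightarrow>
        mean_log_support \<Omega> (santalo_point \<Omega>) \<ge> 0 \<and>
        (mean_log_support \<Omega> (santalo_point \<Omega>) = 0 \<longleftrightarrow>
           round_ball_centered_at (santalo_point \<Omega>) \<Omega>) \<and>
        entropy \<Omega> \<ge> 0 \<and>
        (\<not> round_ball_centered_at (santalo_point \<Omega>) \<Omega> \<longrightarrow> entropy \<Omega> > 0)) \<and>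
     entropy \<Omega> \<ge> (ln (measure lebesgue \<Omega>) - ln (measure lebesgue (cball (0::'a) 1))) / real DIM('a)"
proof -
  have \<Omega>: "compact \<Omega>" "convex \<Omega>" using assms by (auto simp: convex_body_def)
  let ?V = "measure lebesgue \<Omega>"
  let ?v = "measure lebesgue (cball (0::'a) 1)"
  let ?z = "santalo_point \<Omega>"
  let ?M = "mean_log_support \<Omega> ?z"
  define m where "m = measure lebesgue (polar_dual \<Omega> ?z) / measure lborel (cball (0::'a) 1)"
  have z: "?z \<in> interior \<Omega>" by (rule santalo_point(1)[OF assms])
  then have ne: "\<Omega> \<noteq> {}" using interior_subset by auto
  have V: "0 < ?V" by (rule convex_body_emeasure(2)[OF assms])
  have v_eq: "?v = measure lborel (cball (0::'a) 1)" by (simp add: measure_completion)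
  have v: "0 < ?v" unfolding v_eq by (rule measure_cball_pos) simp
  note jensen = mean_log_support_jensen[OF \<Omega>(1) z, folded m_def]
  obtain c where c: "c \<in> interior \<Omega>" "?V * measure lebesgue (polar_dual \<Omega> c) \<le> ?v\<^sup>2"
    using blaschke_santalo[OF assms] by blast
  have "?V * measure lebesgue (polar_dual \<Omega> ?z) \<le> ?V * measure lebesgue (polar_dual \<Omega> c)"
    using santalo_point(2)[OF assms c(1)] V by (intro mult_left_mono) auto
  also note c(2)
  finally have m_le: "m \<le> ?v / ?V"
    using V v unfolding m_def v_eq[symmetric] by (simp add: field_simps power2_eq_square)
  have "ln m \<le> ln (?v / ?V)" using m_le jensen(1) by (intro ln_mono) auto
  then have ln_m: "ln ?V - ln ?v \<le> - ln m" using V v by (simp add: ln_div)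
  have "(ln ?V - ln ?v) / real DIM('a) \<le> - ln m / real DIM('a)" using ln_m by (rule divide_right_mono) simp
  also have "\<dots> \<le> ?M" by (rule jensen(2))
  finally have M: "(ln ?V - ln ?v) / real DIM('a) \<le> ?M" .
  have entropy: "?M \<le> entropy \<Omega>" by (rule mean_log_support_le_entropy[OF \<Omega>(1) z])
  have norm: "0 \<le> ?M \<and> (?M = 0 \<longleftrightarrow> round_ball_centered_at ?z \<Omega>)" if eq: "?V = ?v"
  proof
    show "0 \<le> ?M" using M eq by simp
    show "?M = 0 \<longleftrightarrow> round_ball_centered_at ?z \<Omega>"
    proof
      assume "?M = 0"
      \<comment> \<open>For equal volumes 0 \<le> - ln m / d \<le> ?M, so ?M = 0 forces equality in
        Jensen's inequality, and the support function is constant.\<close>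
      moreover have "0 \<le> - ln m / real DIM('a)" using ln_m eq by (intro divide_nonneg_nonneg) auto
      ultimately have "?M = - ln m / real DIM('a)" using jensen(2) by linarith
      then obtain r where "0 < r" "\<forall>x\<in>sphere 0 1. support_fun \<Omega> ?z x = r" using jensen(3) by blast
      then have "\<Omega> = cball ?z r" using support_fun_const_imp_ball[OF \<Omega> ne] by blast
      then show "round_ball_centered_at ?z \<Omega>" using \<open>0 < r\<close> unfolding round_ball_centered_at_def by blast
    next
      assume "round_ball_centered_at ?z \<Omega>"
      then obtain r where r: "0 < r" "\<Omega> = cball ?z r" unfolding round_ball_centered_at_def by blast
      \<comment> \<open>The volume normalisation leaves only the radius 1, for which the support
        function is 1 on the sphere and its logarithm vanishes.\<close>
      have "measure lebesgue (cball ?z r) = ?v" using eq by (subst r(2)[symmetric])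
      then have "measure lborel (cball ?z r) = measure lborel (cball (0::'a) 1)"
        by (simp add: measure_completion)
      then have "unit_ball_vol (real DIM('a)) * r ^ DIM('a) = unit_ball_vol (real DIM('a))"
        using r(1) by (simp add: content_cball)
      then have "r ^ DIM('a) = 1" using less_imp_neq[OF unit_ball_vol_pos[of "real DIM('a)"]] by auto
      then have "r = 1" using r(1) power_eq_imp_eq_base[of r "DIM('a)" 1] by simp
      then show "?M = 0" using mean_log_support_unit_ball[of ?z] r(2) by simp
    qed
  qed
  show ?thesis
  proof (intro conjI impI)
    assume eq: "?V = ?v"
    show "0 \<le> ?M" "?M = 0 \<longleftrightarrow> round_ball_centered_at ?z \<Omega>" using norm[OF eq] by blast+
    show "0 \<le> entropy \<Omega>" using norm[OF eq] entropy by linarith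
    assume "\<not> round_ball_centered_at ?z \<Omega>"
    then have "?M \<noteq> 0" using norm[OF eq] by blast
    then show "0 < entropy \<Omega>" using norm[OF eq] entropy by linarith
  next
    show "(ln ?V - ln ?v) / real DIM('a) \<le> entropy \<Omega>" using M entropy by linarith
  qed
qed

end
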